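(* Let $\alpha>1$. Fix $\delta\in(0,\tfrac{\alpha}{4})$ and $\tau\in(\tfrac1\alpha,1]$ arbitrarily. Let the weights $\boldsymbol{\gamma}=(\gamma_{\mathfrak{u}})_{\mathfrak{u}\subset\mathbb{N}}$ satisfy $\gamma_\emptyset=1$. Then there is a constant $C_{\alpha,\delta,\tau,d}=C_{\alpha,\delta,\tau,d}((\gamma_{\mathfrak{u}})_{\mathfrak{u}\subset\mathbb{N}})>0$ (independent of $f$, $M$, $N$, $\lambda$) such that for every probability density $f\in\mathcal{N}_{\mathrm{kor},\alpha}$, every $M\ge1$, every $\lambda>0$ and every prime $N$, $$\mathbb{E}\Bigl[\int_{[0,1]^d}|f^\lambda_{M,N;\boldsymbol{Y}}(\boldsymbol{x})-f(\boldsymbol{x})|^2\,\mathrm{d}\boldsymbol{x}\Bigr]\le C_{\alpha,\delta,\tau,d}\biggl(\|f\|_{\mathrm{kor},\alpha}^2\frac1{N^{\alpha/2-2\delta}}+\lambda\|f\|_{\mathrm{kor},\alpha}^2+\frac{\|f\|_{L^2([0,1]^d)}}{M\lambda^\tau}\biggr),$$ where $C_{\alpha,\delta,\tau,d}$ depends on $\alpha,\delta,\tau$ but can be bounded independently of $d$ provided that $$\sum_{\mathfrak{u}\subset\mathbb{N},\,|\mathfrak{u}|<\infty}\max(|\mathfrak{u}|,1)\,\gamma_{\mathfrak{u}}^{\frac1{\alpha-4\delta}}\bigl[2\zeta\bigl(\tfrac{\alpha}{\alpha-4\delta}\bigr)\bigr]^{|\mathfrak{u}|}<\infty .$$ Moreover,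 if $f$ belongs to the reproducing kernel Hilbert space $(\mathcal{N}_{\widetilde{\mathrm{kor}},\alpha},\|\cdot\|_{\widetilde{\mathrm{kor}},\alpha})$ of the kernel $\tilde K^{\mathrm{kor}}_\alpha$, then the bound improves to $$\mathbb{E}\Bigl[\int_{[0,1]^d}|f^\lambda_{M,N;\boldsymbol{Y}}(\boldsymbol{x})-f(\boldsymbol{x})|^2\,\mathrm{d}\boldsymbol{x}\Bigr]\le\widetilde C_{\alpha,\delta,\tau,d}\biggl(\|f\|_{\mathrm{kor},\alpha}^2\frac1{N^{\alpha/2-2\delta}}+\lambda^2\|f\|_{\widetilde{\mathrm{kor}},\alpha}^2+\frac{\|f\|_{L^2([0,1]^d)}}{M\lambda^\tau}\biggr),$$ where the constant $\widetilde C_{\alpha,\delta,\tau,d}=\widetilde C_{\alpha,\delta,\tau,d}((\gamma_{\mathfrak{u}})_{\mathfrak{u}\subset\mathbb{N}})>0$ depends on $\alpha,\delta,\tau$ but can be bounded independently of $d$ provided that the weights corresponding to the kernel $\tilde K^{\mathrm{kor}}_\alpha$ satisfy the analogous summability condition, i.e. the condition displayed above with $\alpha$ replaced by $2\alpha$ and $\gamma_{\mathfrak{u}}$ replaced by $\gamma_{\mathfrak{u}}^2$.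
   Context: Let $d\ge1$ and let $\boldsymbol{\gamma}=(\gamma_{\mathfrak{u}})$ be positive weights indexed by finite subsets $\mathfrak{u}\subset\mathbb{N}$, with $\gamma_\emptyset=1$. For $\boldsymbol{h}\in\mathbb{Z}^d$ let $\mathrm{supp}(\boldsymbol{h})=\{1\le j\le d\mid h_j\ne0\}$, $r(\boldsymbol{0},\gamma)=1$, and $r(\boldsymbol{h},\gamma)=\gamma_{\mathrm{supp}(\boldsymbol{h})}^{-1}\prod_{j\in\mathrm{supp}(\boldsymbol{h})}|h_j|^\alpha$ for $\boldsymbol{h}\neq\boldsymbol{0}$. The Korobov kernel is $K^{\mathrm{kor}}_\alpha(\boldsymbol{x},\boldsymbol{x}')=\sum_{\boldsymbol{h}\in\mathbb{Z}^d}r(\boldsymbol{h},\gamma)^{-1}e^{2\pi i\boldsymbol{h}\cdot(\boldsymbol{x}-\boldsymbol{x}')}$ on $[0,1]^d$. Its reproducing kernel Hilbert space is $\mathcal{N}_{\mathrm{kor},\alpha}$, with norm $\|v\|_{\mathrm{kor},\alpha}=\bigl(\sum_{\boldsymbol{h}}r(\boldsymbol{h},\gamma)|\hat v(\boldsymbol{h})|^2\bigr)^{1/2}$, $\hat v(\boldsymbol{h})=\int_{[0,1]^d}v(\boldsymbol{x})e^{-2\pi i\boldsymbol{h}\cdot\boldsymbol{x}}\,\mathrm{d}\boldsymbol{x}$, and inner product $\langle\cdot,\cdot\rangle_{\mathrm{kor},\alpha}$. Further, $\tilde K^{\mathrm{kor}}_\alpha(\boldsymbol{x},\boldsymbol{x}')=\sum_{\boldsymbol{h}\in\mathbb{Z}^d}r(\boldsymbol{h},\gamma)^{-2}e^{2\pi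 i\boldsymbol{h}\cdot(\boldsymbol{x}-\boldsymbol{x}')}$; its RKHS norm is $\|v\|_{\widetilde{\mathrm{kor}},\alpha}=\bigl(\sum_{\boldsymbol{h}}r(\boldsymbol{h},\gamma)^2|\hat v(\boldsymbol{h})|^2\bigr)^{1/2}$. $\zeta$ is the Riemann zeta function. Lattice points: for a prime $N$, $\boldsymbol{x}_k=\{k\boldsymbol{z}/N\}$, $k=1,\dots,N$ (componentwise fractional part), where $\boldsymbol{z}\in\{1,\dots,N\}^d$ is a generating vector (depending on $N,d,\alpha,\boldsymbol{\gamma}$, not on $f$) obtained by the component-by-component construction, with the property that for every $g\in\mathcal{N}_{\mathrm{kor},\alpha}$ $$\|\mathscr{I}_Ng-g\|_{L^2([0,1]^d)}\le C_{\alpha,\delta,d}\|g\|_{\mathrm{kor},\alpha}N^{-(\alpha/4-\delta)},$$ $$C_{\alpha,\delta,d}=\Bigl(\sum_{\mathfrak{u}\subset\{1,\dots,d\}}\max(|\mathfrak{u}|,1)\gamma_{\mathfrak{u}}^{\frac{1}{\alpha-4\delta}}[2\zeta(\tfrac{\alpha}{\alpha-4\delta})]^{|\mathfrak{u}|}\Bigr)^{\alpha-4\delta}.$$ Here $\mathscr{I}_Ng$ is the kernel interpolant of $g$ at $\boldsymbol{x}_1,\dots,\boldsymbol{x}_N$, i.e. the $\mathcal{N}_{\mathrm{kor},\alpha}$-orthogonal projection of $g$ onto $V_N=\mathrm{span}\{K^{\mathrm{kor}}_\alpha(\boldsymbol{x}_k,\cdot)\mid k=1,\dots,N\}$. This property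 of $\boldsymbol{z}$ is a known result that may be taken as given. Estimator: $Y_1,\dots,Y_M$ are i.i.d. $[0,1]^d$-valued random variables with density $f$ with respect to the uniform (Lebesgue) measure. For $\lambda>0$, $f^\lambda_{M,N;\boldsymbol{Y}}\in V_N$ is the unique element with $\langle f^\lambda_{M,N;\boldsymbol{Y}},v\rangle_{L^2([0,1]^d)}+\lambda\langle f^\lambda_{M,N;\boldsymbol{Y}},v\rangle_{\mathrm{kor},\alpha}=\frac1M\sum_{m=1}^Mv(Y_m)$ for all $v\in V_N$.
   Formalization: Boundedness of the constants in d fails as stated for small τ; it is proved under the displayed condition plus: τ ≥ 1/(α−4δ) (for the second constant τ ≥ 1/(α−2δ)), or Σ_u γ_u^τ [2ζ(ατ)]^{|u|} < ∞. *)

theory Defs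
  imports "HOL-Probability.Probability" "HOL-Computational_Algebra.Primes"
begin

text \<open>
  The dimension \<open>d\<close> is a number, not a type, because the constants are compared across all \<open>d\<close>.
  Points of \<open>[0,1]^d\<close> and frequencies in \<open>\<int>^d\<close> are therefore extensional functions on the
  index set \<open>{1..d}\<close>.
\<close>

definition cube :: "nat \<Rightarrow> (nat \<Rightarrow> real) set" where
  "cube d = {1..d} \<rightarrow>\<^sub>E {0..1}"

definition cube_measure :: "nat \<Rightarrow> (nat \<Rightarrow> real) measure" where
  "cube_measure d = Pi\<^sub>M {1..d} (\<lambda>_. restrict_space lborel {0..1})"

definition freqs :: "nat \<Rightarrow> (nat \<Rightarrow> int) set" where
  "freqs d = {1..d} \<rightarrow>\<^sub>E UNIV"

definition fdot :: "nat \<Rightarrow> (nat \<Rightarrow> int) \<Rightarrow> (nat \<Rightarrow> real) \<Rightarrow> real" where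
  "fdot d h x = (\<Sum>j\<in>{1..d}. real_of_int (h j) * x j)"

definition l2_inner :: "nat \<Rightarrow> ((nat \<Rightarrow> real) \<Rightarrow> real) \<Rightarrow> ((nat \<Rightarrow> real) \<Rightarrow> real) \<Rightarrow> real" where
  "l2_inner d u v = (\<integral>x. u x * v x \<partial>cube_measure d)"

definition l2_norm :: "nat \<Rightarrow> ((nat \<Rightarrow> real) \<Rightarrow> real) \<Rightarrow> real" where
  "l2_norm d v = sqrt (\<integral>x. \<bar>v x\<bar>\<^sup>2 \<partial>cube_measure d)"

definition fcoeff :: "nat \<Rightarrow> ((nat \<Rightarrow> real) \<Rightarrow> real) \<Rightarrow> (nat \<Rightarrow> int) \<Rightarrow> complex" where
  "fcoeff d v h = (\<integral>x. complex_of_real (v x) * cis (- (2 * pi * fdot d h x)) \<partial>cube_measure d)"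


subsection \<open>Reproducing kernel Hilbert spaces of translation-invariant kernels\<close>

text \<open>
  Everything is parametrised by the function \<open>\<rho>\<close> on \<open>\<int>^d\<close> in the role of \<open>r(\<cdot>, \<gamma>)\<close>, so that the
  second kernel is obtained by replacing \<open>\<rho>\<close> by \<open>\<rho>\<^sup>2\<close>. The spaces consist of real-valued functions;
  the \<open>Re\<close> below only serves to convert the type, as all \<open>\<rho>\<close> used are even in \<open>h\<close>.
\<close>

definition rk_kernel ::
  "nat \<Rightarrow> ((nat \<Rightarrow> int) \<Rightarrow> real) \<Rightarrow> (nat \<Rightarrow> real) \<Rightarrow> (nat \<Rightarrow> real) \<Rightarrow> real" where
  "rk_kernel d \<rho> x x' =
     Re (\<Sum>\<^sub>\<infinity>h\<in>freqs d. complex_of_real (1 / \<rho> h) * cis (2 * pi * fdot d h (\<lambda>j. x j - x' j)))"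

definition rk_inner ::
  "nat \<Rightarrow> ((nat \<Rightarrow> int) \<Rightarrow> real) \<Rightarrow> ((nat \<Rightarrow> real) \<Rightarrow> real) \<Rightarrow> ((nat \<Rightarrow> real) \<Rightarrow> real) \<Rightarrow> real" where
  "rk_inner d \<rho> u v = Re (\<Sum>\<^sub>\<infinity>h\<in>freqs d. complex_of_real (\<rho> h) * fcoeff d u h * cnj (fcoeff d v h))"

definition rk_norm :: "nat \<Rightarrow> ((nat \<Rightarrow> int) \<Rightarrow> real) \<Rightarrow> ((nat \<Rightarrow> real) \<Rightarrow> real) \<Rightarrow> real" where
  "rk_norm d \<rho> v = sqrt (\<Sum>\<^sub>\<infinity>h\<in>freqs d. \<rho> h * (cmod (fcoeff d v h))\<^sup>2)"

text \<open>
  Elements of the space are genuine functions on the cube, not classes modulo null sets, hence the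
  pointwise Fourier representation; values outside the cube are irrelevant.
\<close>

definition rk_space :: "nat \<Rightarrow> ((nat \<Rightarrow> int) \<Rightarrow> real) \<Rightarrow> ((nat \<Rightarrow> real) \<Rightarrow> real) set" where
  "rk_space d \<rho> = {v. integrable (cube_measure d) v \<and>
     (\<lambda>h. \<rho> h * (cmod (fcoeff d v h))\<^sup>2) summable_on freqs d \<and>
     (\<forall>x\<in>cube d. ((\<lambda>h. fcoeff d v h * cis (2 * pi * fdot d h x)) has_sum complex_of_real (v x)) (freqs d))}"


subsection \<open>Korobov weights\<close>

definition supp :: "nat \<Rightarrow> (nat \<Rightarrow> int) \<Rightarrow> nat set" where
  "supp d h = {j\<in>{1..d}. h j \<noteq> 0}"

definition kor :: "nat \<Rightarrow> real \<Rightarrow> (nat set \<Rightarrow> real) \<Rightarrow> (nat \<Rightarrow> int) \<Rightarrow> real" where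
  "kor d \<alpha> \<gamma> h = (if supp d h = {} then 1
     else (\<Prod>j\<in>supp d h. \<bar>real_of_int (h j)\<bar> powr \<alpha>) / \<gamma> (supp d h))"

definition korsq :: "nat \<Rightarrow> real \<Rightarrow> (nat set \<Rightarrow> real) \<Rightarrow> (nat \<Rightarrow> int) \<Rightarrow> real" where
  "korsq d \<alpha> \<gamma> h = (kor d \<alpha> \<gamma> h)\<^sup>2"

text \<open>Only used for \<open>s > 1\<close>, where the series converges.\<close>

definition zeta :: "real \<Rightarrow> real" where
  "zeta s = (\<Sum>n. 1 / real (Suc n) powr s)"

definition finsets :: "nat set set" where
  "finsets = {u. finite u \<and> u \<subseteq> {1..}}"

definition weight_term :: "real \<Rightarrow> real \<Rightarrow> (nat set \<Rightarrow> real) \<Rightarrow> nat set \<Rightarrow> real" where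
  "weight_term \<alpha> \<delta> \<gamma> u = real (max (card u) 1) * \<gamma> u powr (1 / (\<alpha> - 4 * \<delta>)) *
     (2 * zeta (\<alpha> / (\<alpha> - 4 * \<delta>))) ^ card u"

definition interp_const :: "nat \<Rightarrow> real \<Rightarrow> real \<Rightarrow> (nat set \<Rightarrow> real) \<Rightarrow> real" where
  "interp_const d \<alpha> \<delta> \<gamma> = (\<Sum>u\<in>Pow {1..d}. weight_term \<alpha> \<delta> \<gamma> u) powr (\<alpha> - 4 * \<delta>)"

text \<open>
  Grouping by support, \<open>\<Sum>\<^sub>h r(h, \<gamma>) powr (-\<tau>)\<close> over \<open>\<int>^d\<close> is the sum of these terms over \<open>u \<subseteq> {1..d}\<close>.
  Summability of \<open>weight_term \<alpha> \<delta> \<gamma>\<close> implies that of \<open>trace_term \<alpha> \<tau> \<gamma>\<close> if \<open>\<tau> \<ge> 1 / (\<alpha> - 4 * \<delta>)\<close>,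
  but not for smaller \<open>\<tau>\<close>, where the constants may then grow with \<open>d\<close>: take
  \<open>\<gamma> {j} = c * j powr (-a)\<close> with \<open>\<tau> < 1 / a < 1 / (\<alpha> - 4 * \<delta>)\<close>, tiny weights on larger sets,
  \<open>f = 1\<close>, \<open>M = 1\<close>, \<open>N \<rightarrow> \<infinity>\<close>; the risk is then at least of order \<open>lam powr (-1 / a)\<close> for
  large \<open>d\<close> and small \<open>lam\<close>.
\<close>

definition trace_term :: "real \<Rightarrow> real \<Rightarrow> (nat set \<Rightarrow> real) \<Rightarrow> nat set \<Rightarrow> real" where
  "trace_term \<alpha> \<tau> \<gamma> u = \<gamma> u powr \<tau> * (2 * zeta (\<alpha> * \<tau>)) ^ card u"


subsection \<open>Lattice points, kernel interpolation and the density estimator\<close>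

definition lattice_pt :: "nat \<Rightarrow> nat \<Rightarrow> (nat \<Rightarrow> nat) \<Rightarrow> nat \<Rightarrow> (nat \<Rightarrow> real)" where
  "lattice_pt d N z k = (\<lambda>j\<in>{1..d}. frac (real k * real (z j) / real N))"

definition lattice_span ::
  "nat \<Rightarrow> ((nat \<Rightarrow> int) \<Rightarrow> real) \<Rightarrow> nat \<Rightarrow> (nat \<Rightarrow> nat) \<Rightarrow> ((nat \<Rightarrow> real) \<Rightarrow> real) set" where
  "lattice_span d \<rho> N z =
     {(\<lambda>x\<in>cube d. \<Sum>k=1..N. c k * rk_kernel d \<rho> (lattice_pt d N z k) x) | c :: nat \<Rightarrow> real. True}"

definition interpolant ::
  "nat \<Rightarrow> ((nat \<Rightarrow> int) \<Rightarrow> real) \<Rightarrow> nat \<Rightarrow> (nat \<Rightarrow> nat) \<Rightarrow> ((nat \<Rightarrow> real) \<Rightarrow> real) \<Rightarrow> (nat \<Rightarrow> real) \<Rightarrow> real" where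
  "interpolant d \<rho> N z g = (THE u. u \<in> lattice_span d \<rho> N z \<and>
     (\<forall>v\<in>lattice_span d \<rho> N z. rk_inner d \<rho> (\<lambda>x. g x - u x) v = 0))"

definition good_generator ::
  "nat \<Rightarrow> real \<Rightarrow> real \<Rightarrow> (nat set \<Rightarrow> real) \<Rightarrow> nat \<Rightarrow> (nat \<Rightarrow> nat) \<Rightarrow> bool" where
  "good_generator d \<alpha> \<delta> \<gamma> N z \<longleftrightarrow> z \<in> {1..d} \<rightarrow>\<^sub>E {1..N} \<and>
     (\<forall>g\<in>rk_space d (kor d \<alpha> \<gamma>).
        l2_norm d (\<lambda>x. interpolant d (kor d \<alpha> \<gamma>) N z g x - g x)
          \<le> interp_const d \<alpha> \<delta> \<gamma> * rk_norm d (kor d \<alpha> \<gamma>) g * real N powr (- (\<alpha> / 4 - \<delta>)))"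

definition estimator ::
  "nat \<Rightarrow> ((nat \<Rightarrow> int) \<Rightarrow> real) \<Rightarrow> nat \<Rightarrow> (nat \<Rightarrow> nat) \<Rightarrow> nat \<Rightarrow> real \<Rightarrow> (nat \<Rightarrow> nat \<Rightarrow> real) \<Rightarrow>
     (nat \<Rightarrow> real) \<Rightarrow> real" where
  "estimator d \<rho> N z M lam y = (THE u. u \<in> lattice_span d \<rho> N z \<and>
     (\<forall>v\<in>lattice_span d \<rho> N z.
        l2_inner d u v + lam * rk_inner d \<rho> u v = (\<Sum>m=1..M. v (y m)) / real M))"

definition prob_density :: "nat \<Rightarrow> ((nat \<Rightarrow> real) \<Rightarrow> real) \<Rightarrow> bool" where
  "prob_density d f \<longleftrightarrow> (\<forall>x\<in>cube d. 0 \<le> f x) \<and> integrable (cube_measure d) f \<and>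
     (\<integral>x. f x \<partial>cube_measure d) = 1"

definition iid_sample ::
  "nat \<Rightarrow> ((nat \<Rightarrow> real) \<Rightarrow> real) \<Rightarrow> nat \<Rightarrow> 'w measure \<Rightarrow> (nat \<Rightarrow> 'w \<Rightarrow> (nat \<Rightarrow> real)) \<Rightarrow> bool" where
  "iid_sample d f M P Y \<longleftrightarrow> prob_space P \<and>
     prob_space.indep_vars P (\<lambda>_. cube_measure d) Y {1..M} \<and>
     (\<forall>m\<in>{1..M}. distributed P (cube_measure d) (Y m) (\<lambda>x. ennreal (f x)))"

definition sq_error ::
  "nat \<Rightarrow> ((nat \<Rightarrow> int) \<Rightarrow> real) \<Rightarrow> nat \<Rightarrow> (nat \<Rightarrow> nat) \<Rightarrow> nat \<Rightarrow> real \<Rightarrow> ((nat \<Rightarrow> real) \<Rightarrow> real) \<Rightarrow>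
     (nat \<Rightarrow> 'w \<Rightarrow> (nat \<Rightarrow> real)) \<Rightarrow> 'w \<Rightarrow> real" where
  "sq_error d \<rho> N z M lam f Y \<omega> =
     (\<integral>x. \<bar>estimator d \<rho> N z M lam (\<lambda>m. Y m \<omega>) x - f x\<bar>\<^sup>2 \<partial>cube_measure d)"


subsection \<open>The spaces are the reproducing kernel Hilbert spaces of their kernels\<close>

definition is_rkhs ::
  "'a set \<Rightarrow> ('a \<Rightarrow> 'a \<Rightarrow> real) \<Rightarrow> ('a \<Rightarrow> real) set \<Rightarrow> (('a \<Rightarrow> real) \<Rightarrow> ('a \<Rightarrow> real) \<Rightarrow> real) \<Rightarrow> bool" where
  "is_rkhs X K H ip \<longleftrightarrow>
     (\<forall>u\<in>H. \<forall>v\<in>H. \<forall>a b. (\<lambda>x. a * u x + b * v x) \<in> H) \<and>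
     (\<forall>u\<in>H. \<forall>v\<in>H. ip u v = ip v u) \<and>
     (\<forall>u\<in>H. \<forall>v\<in>H. \<forall>w\<in>H. \<forall>a b. ip (\<lambda>x. a * u x + b * v x) w = a * ip u w + b * ip v w) \<and>
     (\<forall>u\<in>H. 0 \<le> ip u u \<and> (ip u u = 0 \<longrightarrow> (\<forall>x\<in>X. u x = 0))) \<and>
     (\<forall>s. range s \<subseteq> H \<longrightarrow>
        (\<forall>e>0. \<exists>n0. \<forall>m\<ge>n0. \<forall>n\<ge>n0. ip (\<lambda>x. s m x - s n x) (\<lambda>x. s m x - s n x) < e) \<longrightarrow>
        (\<exists>u\<in>H. (\<lambda>n. ip (\<lambda>x. s n x - u x) (\<lambda>x. s n x - u x)) \<longlonglongrightarrow> 0)) \<and>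
     (\<forall>x\<in>X. K x \<in> H \<and> (\<forall>u\<in>H. ip u (K x) = u x))"

lemma space_cube_measure: "space (cube_measure d) = cube d"
  by (simp add: cube_measure_def cube_def space_PiM space_restrict_space)

lemma prob_unit: "prob_space (restrict_space lborel {0..1::real})"
  by (rule prob_spaceI) (simp add: space_restrict_space emeasure_restrict_space)

lemma prob_cube: "prob_space (cube_measure d)"
  unfolding cube_measure_def by (rule prob_space_PiM) (rule prob_unit)

lemma unit_char_integral:
  "(\<integral>x. cis (2 * pi * (of_int k * x)) \<partial>restrict_space lborel {0..1}) = (if k = 0 then 1 else 0)"
proof (cases "k = 0")
  case True
  interpret prob_space "restrict_space lborel {0..1::real}" by (rule prob_unit)
  show ?thesis using True prob_space by simp
next
  case False
  define c where "c = 2 * pi * real_of_int k"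
  have c: "c \<noteq> 0" using False by (simp add: c_def)
  have "(\<integral>x. cis (2 * pi * (of_int k * x)) \<partial>restrict_space lborel {0..1})
      = (LBINT x:{0..1}. cis (c * x))"
    by (subst integral_restrict_space) (simp_all add: set_lebesgue_integral_def c_def mult_ac)
  also have "\<dots> = (cis (c * 1) / (\<i> * c)) - (cis (c * 0) / (\<i> * c))"
    unfolding set_lebesgue_integral_def
  proof (rule integral_FTC_Icc)
    show "((\<lambda>x. cis (c * x) / (\<i> * complex_of_real c)) has_vector_derivative cis (c * x)) (at x within {0..1})"
      for x
      unfolding cis_conv_exp using c
      by (auto intro!: derivative_eq_intros has_vector_derivative_real_field simp: field_simps)
  qed (auto intro!: continuous_intros)
  also have "\<dots> = 0"
    using cis_multiple_2pi[of "real_of_int k"] by (simp add: c_def)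
  finally show ?thesis using False by simp
qed

definition echar :: "nat \<Rightarrow> (nat \<Rightarrow> int) \<Rightarrow> (nat \<Rightarrow> real) \<Rightarrow> complex" where
  "echar d h x = cis (2 * pi * fdot d h x)"

lemma echar_prod: "echar d h x = (\<Prod>j\<in>{1..d}. cis (2 * pi * (of_int (h j) * x j)))"
proof -
  have "cis (sum f A) = (\<Prod>j\<in>A. cis (f j))" if "finite A" for f :: "nat \<Rightarrow> real" and A
    using that by induction (auto simp: cis_mult[symmetric])
  then show ?thesis by (simp add: echar_def fdot_def sum_distrib_left)
qed

lemma unit_measurable: "(f \<in> borel_measurable borel) \<Longrightarrow> f \<in> borel_measurable (restrict_space lborel {0..1::real})"
  by (rule measurable_restrict_space1) simp

lemma echar_integral:
  assumes "h \<in> freqs d"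
  shows "(\<integral>x. echar d h x \<partial>cube_measure d) = (if \<forall>j\<in>{1..d}. h j = 0 then 1 else 0)"
proof -
  interpret I: prob_space "restrict_space lborel {0..1::real}" by (rule prob_unit)
  interpret product_sigma_finite "\<lambda>_::nat. restrict_space lborel {0..1::real}"
    by standard
  have "(\<integral>x. echar d h x \<partial>cube_measure d)
     = (\<Prod>j\<in>{1..d}. \<integral>x. cis (2 * pi * (of_int (h j) * x)) \<partial>restrict_space lborel {0..1})"
    unfolding echar_prod cube_measure_def
    by (rule product_integral_prod)
       (auto intro!: I.integrable_const_bound[where B=1] unit_measurable borel_measurable_continuous_onI continuous_intros)
  also have "\<dots> = (if \<forall>j\<in>{1..d}. h j = 0 then 1 else 0)"
    by (auto simp: unit_char_integral prod_zero_iff)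
  finally show ?thesis .
qed

lemma proj_measurable: "j \<in> {1..d} \<Longrightarrow> (\<lambda>x. x j) \<in> borel_measurable (cube_measure d)"
proof -
  assume j: "j \<in> {1..d}"
  have "(\<lambda>x. x j) \<in> cube_measure d \<rightarrow>\<^sub>M restrict_space lborel {0..1::real}"
    unfolding cube_measure_def using j by (rule measurable_component_singleton)
  moreover have "(\<lambda>t. t) \<in> borel_measurable (restrict_space lborel {0..1::real})"
    by (rule unit_measurable) simp
  ultimately show ?thesis using measurable_compose by blast
qed

lemma fdot_measurable: "fdot d h \<in> borel_measurable (cube_measure d)"
  unfolding fdot_def[abs_def]
  by (intro borel_measurable_sum borel_measurable_times borel_measurable_const proj_measurable) 

lemma cis_measurable: "cis \<in> borel_measurable borel"
  by (intro borel_measurable_continuous_onI continuous_intros)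

lemma echar_measurable [measurable]: "echar d h \<in> borel_measurable (cube_measure d)"
  unfolding echar_def[abs_def]
  by (rule measurable_compose[OF _ cis_measurable]) (intro borel_measurable_times borel_measurable_const fdot_measurable)

lemma norm_echar [simp]: "norm (echar d h x) = 1"
  by (simp add: echar_def)

lemma echar_diff: "echar d (\<lambda>j\<in>{1..d}. h j - k j) x = echar d h x * cnj (echar d k x)"
proof -
  have "fdot d (\<lambda>j\<in>{1..d}. h j - k j) x = fdot d h x - fdot d k x"
    by (simp add: fdot_def sum_subtractf[symmetric] algebra_simps)
  then show ?thesis by (simp add: echar_def cis_cnj cis_mult right_diff_distrib)
qed

lemma echar_ortho:
  assumes "h \<in> freqs d" "k \<in> freqs d"
  shows "(\<integral>x. echar d h x * cnj (echar d k x) \<partial>cube_measure d) = (if h = k then 1 else 0)"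
proof -
  have *: "(\<forall>j\<in>{1..d}. (\<lambda>j\<in>{1..d}. h j - k j) j = 0) \<longleftrightarrow> h = k"
    using assms unfolding freqs_def by (auto intro: PiE_ext)
  show ?thesis
    unfolding echar_diff[symmetric]
    by (subst echar_integral) (use * in \<open>auto simp: freqs_def\<close>)
qed

lemma fcoeff_echar: "fcoeff d v h = (\<integral>x. complex_of_real (v x) * cnj (echar d h x) \<partial>cube_measure d)"
  by (simp add: fcoeff_def echar_def cis_cnj)

lemma countable_freqs: "countable (freqs d)"
  unfolding freqs_def by (rule countable_PiE) auto

definition fneg :: "nat \<Rightarrow> (nat \<Rightarrow> int) \<Rightarrow> (nat \<Rightarrow> int)" where
  "fneg d h = (\<lambda>j\<in>{1..d}. - h j)"

lemma fneg_freqs [simp]: "fneg d h \<in> freqs d"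
  by (auto simp: fneg_def freqs_def)

lemma fneg_fneg: "h \<in> freqs d \<Longrightarrow> fneg d (fneg d h) = h"
  unfolding freqs_def fneg_def by (auto intro!: ext simp: PiE_def extensional_def)

lemma bij_fneg: "bij_betw (fneg d) (freqs d) (freqs d)"
  by (rule bij_betw_byWitness[where f'="fneg d"]) (auto simp: fneg_fneg)

lemma echar_fneg: "echar d (fneg d h) x = cnj (echar d h x)"
  by (simp add: echar_def cis_cnj fdot_def fneg_def sum_negf)

lemma fcoeff_fneg: "fcoeff d v (fneg d h) = cnj (fcoeff d v h)"
  unfolding fcoeff_echar echar_fneg by (subst Bochner_Integration.integral_cnj[symmetric]) simp

lemma has_sum_integral:
  fixes f :: "'i \<Rightarrow> 'a \<Rightarrow> complex"
  assumes "finite_measure M" "countable A" and meas: "\<And>h. h \<in> A \<Longrightarrow> f h \<in> borel_measurable M"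
    and bd: "\<And>h x. h \<in> A \<Longrightarrow> x \<in> space M \<Longrightarrow> norm (f h x) \<le> b h"
    and summ: "b summable_on A"
  shows "((\<lambda>h. \<integral>x. f h x \<partial>M) has_sum (\<integral>x. (\<Sum>\<^sub>\<infinity>h\<in>A. f h x) \<partial>M)) A"
    and "integrable M (\<lambda>x. \<Sum>\<^sub>\<infinity>h\<in>A. f h x)"
proof -
  interpret finite_measure M by fact
  have int: "integrable M (f h)" if "h \<in> A" for h
    by (rule integrable_const_bound[where B="b h"]) (use that meas bd in auto)
  have "((\<lambda>h. \<integral>x. f h x \<partial>M) has_sum (\<integral>x. (\<Sum>\<^sub>\<infinity>h\<in>A. f h x) \<partial>M)) A \<and>
     integrable M (\<lambda>x. \<Sum>\<^sub>\<infinity>h\<in>A. f h x)"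
  proof (cases "finite A")
    case True
    then show ?thesis using int by (auto simp: has_sum_finite_iff Bochner_Integration.integral_sum)
  next
    case False
    define e where "e = from_nat_into A"
    have bij: "bij_betw e UNIV A"
      unfolding e_def using \<open>countable A\<close> False by (rule bij_betw_from_nat_into)
    then have eA: "e i \<in> A" for i by (auto simp: bij_betw_def)
    show ?thesis
    proof (cases "space M = {}")
      case True
      then have z: "integral\<^sup>L M g = 0" "integrable M g" for g :: "'a \<Rightarrow> complex"
        using Bochner_Integration.integral_cong[of M M g "\<lambda>_. 0"]
          Bochner_Integration.integrable_cong[of M M g "\<lambda>_. 0"] by auto
      show ?thesis by (simp add: z has_sum_0)
    next
      case ne: False
      have bs: "(\<lambda>i. b (e i)) summable_on UNIV"
        using summ summable_on_reindex_bij_betw[OF bij, of b] by simp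
      then have bsum: "summable (\<lambda>i. b (e i))" by (rule summable_on_imp_summable)
      have ns: "summable (\<lambda>i. norm (f (e i) x))" if "x \<in> space M" for x
        by (rule summable_comparison_test'[OF bsum]) (use bd eA that in auto)
      have eq: "(\<Sum>\<^sub>\<infinity>h\<in>A. f h x) = (\<Sum>i. f (e i) x)" if "x \<in> space M" for x
      proof -
        have "((\<lambda>i. f (e i) x) has_sum (\<Sum>i. f (e i) x)) UNIV"
          using norm_summable_imp_has_sum[OF ns[OF that]] summable_sums[OF summable_norm_cancel[OF ns[OF that]]] by blast
        then have "((\<lambda>h. f h x) has_sum (\<Sum>i. f (e i) x)) A"
          using has_sum_reindex_bij_betw[OF bij, of "\<lambda>h. f h x"] by simp
        then show ?thesis by (rule infsumI)
      qed
      have i1: "integrable M (f (e i))" for i using int eA by auto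
      have i3: "summable (\<lambda>i. \<integral>x. norm (f (e i) x) \<partial>M)"
      proof (rule summable_comparison_test')
        show "summable (\<lambda>i. b (e i) * measure M (space M))" using bsum by (rule summable_mult2)
        show "norm (\<integral>x. norm (f (e i) x) \<partial>M) \<le> b (e i) * measure M (space M)" for i
        proof -
          have "(\<integral>x. norm (f (e i) x) \<partial>M) \<le> (\<integral>x. b (e i) \<partial>M)"
            by (rule integral_mono) (use i1 bd eA in auto)
          then show ?thesis by (simp add: mult.commute)
        qed
      qed
      have ae: "AE x in M. summable (\<lambda>i. norm (f (e i) x))" using ns by auto
      have S: "(\<lambda>i. \<integral>x. f (e i) x \<partial>M) sums (\<integral>x. (\<Sum>i. f (e i) x) \<partial>M)"
        by (rule sums_integral[OF i1 ae i3])
      have I: "integrable M (\<lambda>x. \<Sum>i. f (e i) x)"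
        by (rule integrable_suminf[OF i1 ae i3])
      have "summable (\<lambda>i. norm (\<integral>x. f (e i) x \<partial>M))"
        by (rule summable_comparison_test'[OF i3]) auto
      then have "((\<lambda>i. \<integral>x. f (e i) x \<partial>M) has_sum (\<integral>x. (\<Sum>i. f (e i) x) \<partial>M)) UNIV"
        using S by (rule norm_summable_imp_has_sum)
      then have "((\<lambda>h. \<integral>x. f h x \<partial>M) has_sum (\<integral>x. (\<Sum>i. f (e i) x) \<partial>M)) A"
        using has_sum_reindex_bij_betw[OF bij, of "\<lambda>h. \<integral>x. f h x \<partial>M"] by simp
      moreover have "(\<integral>x. (\<Sum>i. f (e i) x) \<partial>M) = (\<integral>x. (\<Sum>\<^sub>\<infinity>h\<in>A. f h x) \<partial>M)"
        by (rule Bochner_Integration.integral_cong) (auto simp: eq)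
      moreover have "integrable M (\<lambda>x. \<Sum>\<^sub>\<infinity>h\<in>A. f h x)"
        using I by (subst Bochner_Integration.integrable_cong[OF refl eq])
      ultimately show ?thesis by simp
    qed
  qed
  then show "((\<lambda>h. \<integral>x. f h x \<partial>M) has_sum (\<integral>x. (\<Sum>\<^sub>\<infinity>h\<in>A. f h x) \<partial>M)) A"
    and "integrable M (\<lambda>x. \<Sum>\<^sub>\<infinity>h\<in>A. f h x)" by auto
qed


lemma rk_space_echar: "rk_space d \<rho> = {v. integrable (cube_measure d) v \<and>
     (\<lambda>h. \<rho> h * (cmod (fcoeff d v h))\<^sup>2) summable_on freqs d \<and>
     (\<forall>x\<in>cube d. ((\<lambda>h. fcoeff d v h * echar d h x) has_sum complex_of_real (v x)) (freqs d))}"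
  by (simp add: rk_space_def echar_def)

lemma integrable_echar:
  assumes "integrable (cube_measure d) v"
  shows "integrable (cube_measure d) (\<lambda>x. complex_of_real (v x) * cnj (echar d h x))"
  using assms
  by (rule Bochner_Integration.integrable_bound[OF integrable_norm[OF integrable_of_real[where 'a=complex]]])
     (use assms borel_measurable_integrable in \<open>auto simp: norm_mult intro!: borel_measurable_times
        borel_measurable_of_real measurable_compose[OF echar_measurable borel_measurable_continuous_onI[OF continuous_on_cnj[OF continuous_on_id]]]\<close>)

lemma fcoeff_lincomb:
  assumes "integrable (cube_measure d) u" "integrable (cube_measure d) v"
  shows "fcoeff d (\<lambda>x. a * u x + b * v x) h = of_real a * fcoeff d u h + of_real b * fcoeff d v h"
proof -
  have "fcoeff d (\<lambda>x. a * u x + b * v x) h =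
    (\<integral>x. of_real a * (complex_of_real (u x) * cnj (echar d h x)) + of_real b * (complex_of_real (v x) * cnj (echar d h x)) \<partial>cube_measure d)"
    unfolding fcoeff_echar by (rule Bochner_Integration.integral_cong) (auto simp: algebra_simps)
  also have "\<dots> = of_real a * fcoeff d u h + of_real b * fcoeff d v h"
    unfolding fcoeff_echar
    by (subst Bochner_Integration.integral_add) (auto intro!: integrable_echar assms)
  finally show ?thesis .
qed

definition synth :: "nat \<Rightarrow> ((nat \<Rightarrow> int) \<Rightarrow> complex) \<Rightarrow> (nat \<Rightarrow> real) \<Rightarrow> real" where
  "synth d a x = Re (\<Sum>\<^sub>\<infinity>h\<in>freqs d. a h * echar d h x)"

lemma synth:
  assumes a: "(\<lambda>h. norm (a h)) summable_on freqs d" and ev: "\<And>h. h \<in> freqs d \<Longrightarrow> a (fneg d h) = cnj (a h)"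
  shows "((\<lambda>h. a h * echar d h x) has_sum complex_of_real (synth d a x)) (freqs d)" (is ?A)
    and "integrable (cube_measure d) (synth d a)"
    and "k \<in> freqs d \<Longrightarrow> fcoeff d (synth d a) k = a k"
proof -
  have s: "(\<lambda>h. a h * echar d h x) summable_on freqs d" for x
    by (rule abs_summable_summable) (use a in \<open>simp add: norm_mult\<close>)
  have real: "(\<Sum>\<^sub>\<infinity>h\<in>freqs d. a h * echar d h x) = complex_of_real (synth d a x)" for x
  proof -
    let ?S = "\<Sum>\<^sub>\<infinity>h\<in>freqs d. a h * echar d h x"
    have "?S = (\<Sum>\<^sub>\<infinity>h\<in>freqs d. a (fneg d h) * echar d (fneg d h) x)"
      using infsum_reindex_bij_betw[OF bij_fneg, of "\<lambda>h. a h * echar d h x"] by simp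
    also have "\<dots> = (\<Sum>\<^sub>\<infinity>h\<in>freqs d. cnj (a h * echar d h x))"
      by (rule infsum_cong) (simp add: ev echar_fneg)
    also have "\<dots> = cnj ?S" by (rule infsum_cnj)
    finally have "?S = cnj ?S" .
    then have "Im ?S = 0" by (metis cnj.simps(2) equal_neg_zero)
    then show ?thesis by (simp add: synth_def complex_eq_iff)
  qed
  show ?A using s[of x] by (simp add: has_sum_infsum flip: real)
  interpret prob_space "cube_measure d" by (rule prob_cube)
  have bm: "(\<lambda>x. a h * echar d h x) \<in> borel_measurable (cube_measure d)" for h
    by measurable
  have "integrable (cube_measure d) (\<lambda>x. \<Sum>\<^sub>\<infinity>h\<in>freqs d. a h * echar d h x)"
    by (rule has_sum_integral(2)[OF finite_measure_axioms countable_freqs bm _ a]) (simp add: norm_mult)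
  then show "integrable (cube_measure d) (synth d a)"
    unfolding synth_def[abs_def] by (rule integrable_Re)
  assume k: "k \<in> freqs d"
  have "fcoeff d (synth d a) k = (\<integral>x. (\<Sum>\<^sub>\<infinity>h\<in>freqs d. a h * (echar d h x * cnj (echar d k x))) \<partial>cube_measure d)"
    unfolding fcoeff_echar
    by (rule Bochner_Integration.integral_cong[OF refl])
       (simp only: mult.assoc[symmetric] infsum_cmult_left' real)
  moreover have "((\<lambda>h. \<integral>x. a h * (echar d h x * cnj (echar d k x)) \<partial>cube_measure d) has_sum
      (\<integral>x. (\<Sum>\<^sub>\<infinity>h\<in>freqs d. a h * (echar d h x * cnj (echar d k x))) \<partial>cube_measure d)) (freqs d)"
    by (rule has_sum_integral(1)[OF finite_measure_axioms countable_freqs _ _ a])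
       (auto simp: norm_mult simp flip: echar_diff)
  ultimately have "((\<lambda>h. a h * (if h = k then 1 else 0)) has_sum fcoeff d (synth d a) k) (freqs d)"
    using has_sum_cong[of "freqs d" "\<lambda>h. \<integral>x. a h * (echar d h x * cnj (echar d k x)) \<partial>cube_measure d"
        "\<lambda>h. a h * (if h = k then 1 else 0)"] k by (simp add: echar_ortho)
  moreover have "((\<lambda>h. a h * (if h = k then 1 else 0)) has_sum a k) (freqs d)"
    by (rule has_sum_finite_neutralI[of "{k}"]) (use k in auto)
  ultimately show "fcoeff d (synth d a) k = a k" by (rule has_sum_unique)
qed

locale tik =
  fixes d :: nat and \<rho> :: "(nat \<Rightarrow> int) \<Rightarrow> real"
  assumes pos: "h \<in> freqs d \<Longrightarrow> \<rho> h > 0"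
    and even: "h \<in> freqs d \<Longrightarrow> \<rho> (fneg d h) = \<rho> h"
    and summ: "(\<lambda>h. 1 / \<rho> h) summable_on freqs d"
begin

lemma abs_summ:
  assumes "(\<lambda>h. \<rho> h * (cmod (a h))\<^sup>2) summable_on freqs d"
  shows "(\<lambda>h. norm (a h)) summable_on freqs d"
proof (rule summable_on_comparison_test[OF summable_on_add[OF assms summ]])
  fix h assume h: "h \<in> freqs d"
  have "0 \<le> (\<rho> h * cmod (a h) - 1)\<^sup>2" by simp
  then have "2 * \<rho> h * cmod (a h) \<le> \<rho> h * (\<rho> h * (cmod (a h))\<^sup>2 + 1 / \<rho> h)"
    using pos[OF h] by (simp add: power2_eq_square algebra_simps)
  then have "2 * cmod (a h) \<le> \<rho> h * (cmod (a h))\<^sup>2 + 1 / \<rho> h"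
    using pos[OF h] by (metis (no_types, lifting) mult.assoc mult.left_commute mult_le_cancel_left_pos)
  then show "cmod (a h) \<le> \<rho> h * (cmod (a h))\<^sup>2 + 1 / \<rho> h"
    using norm_ge_zero[of "a h"] by linarith
qed auto

lemma prod_summ:
  assumes "(\<lambda>h. \<rho> h * (cmod (a h))\<^sup>2) summable_on freqs d" "(\<lambda>h. \<rho> h * (cmod (b h))\<^sup>2) summable_on freqs d"
  shows "(\<lambda>h. complex_of_real (\<rho> h) * a h * cnj (b h)) summable_on freqs d"
proof (rule abs_summable_summable, rule summable_on_comparison_test[OF summable_on_add[OF assms]])
  fix h assume h: "h \<in> freqs d"
  have "2 * (cmod (a h) * cmod (b h)) \<le> (cmod (a h))\<^sup>2 + (cmod (b h))\<^sup>2"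
    using sum_squares_bound[of "cmod (a h)" "cmod (b h)"] by (simp add: mult_ac)
  moreover have "0 \<le> cmod (a h) * cmod (b h)" by simp
  ultimately have "cmod (a h) * cmod (b h) \<le> (cmod (a h))\<^sup>2 + (cmod (b h))\<^sup>2" by linarith
  then have "\<rho> h * (cmod (a h) * cmod (b h)) \<le> \<rho> h * ((cmod (a h))\<^sup>2 + (cmod (b h))\<^sup>2)"
    using pos[OF h] by simp
  then show "cmod (complex_of_real (\<rho> h) * a h * cnj (b h)) \<le> \<rho> h * (cmod (a h))\<^sup>2 + \<rho> h * (cmod (b h))\<^sup>2"
    using pos[OF h] by (simp add: norm_mult algebra_simps)
qed auto

lemma lin_summ:
  assumes "(\<lambda>h. \<rho> h * (cmod (a h))\<^sup>2) summable_on freqs d" "(\<lambda>h. \<rho> h * (cmod (b h))\<^sup>2) summable_on freqs d"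
  shows "(\<lambda>h. \<rho> h * (cmod (s * a h + t * b h))\<^sup>2) summable_on freqs d"
proof (rule summable_on_comparison_test)
  show "(\<lambda>h. 2 * (cmod s)\<^sup>2 * (\<rho> h * (cmod (a h))\<^sup>2) + 2 * (cmod t)\<^sup>2 * (\<rho> h * (cmod (b h))\<^sup>2)) summable_on freqs d"
    by (intro summable_on_add summable_on_cmult_right assms)
  fix h assume h: "h \<in> freqs d"
  have "(cmod (s * a h + t * b h))\<^sup>2 \<le> (cmod (s * a h) + cmod (t * b h))\<^sup>2"
    by (intro power_mono norm_triangle_ineq) auto
  also have "\<dots> \<le> 2 * (cmod (s * a h))\<^sup>2 + 2 * (cmod (t * b h))\<^sup>2"
    using sum_squares_bound[of "cmod (s * a h)" "cmod (t * b h)"] by (simp add: power2_sum)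
  finally have "\<rho> h * (cmod (s * a h + t * b h))\<^sup>2 \<le> \<rho> h * (2 * (cmod (s * a h))\<^sup>2 + 2 * (cmod (t * b h))\<^sup>2)"
    using pos[OF h] by simp
  then show "\<rho> h * (cmod (s * a h + t * b h))\<^sup>2
     \<le> 2 * (cmod s)\<^sup>2 * (\<rho> h * (cmod (a h))\<^sup>2) + 2 * (cmod t)\<^sup>2 * (\<rho> h * (cmod (b h))\<^sup>2)"
    by (simp add: norm_mult power_mult_distrib algebra_simps)
next
  fix h assume "h \<in> freqs d"
  then show "0 \<le> \<rho> h * (cmod (s * a h + t * b h))\<^sup>2" using pos[of h] by simp
qed

lemma rkD:
  assumes "u \<in> rk_space d \<rho>"
  shows "integrable (cube_measure d) u"
    and "(\<lambda>h. \<rho> h * (cmod (fcoeff d u h))\<^sup>2) summable_on freqs d"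
    and "x \<in> cube d \<Longrightarrow> ((\<lambda>h. fcoeff d u h * echar d h x) has_sum complex_of_real (u x)) (freqs d)"
  using assms by (auto simp: rk_space_echar)

lemma synth_mem:
  assumes "(\<lambda>h. \<rho> h * (cmod (a h))\<^sup>2) summable_on freqs d"
    and ev: "\<And>h. h \<in> freqs d \<Longrightarrow> a (fneg d h) = cnj (a h)"
  shows "synth d a \<in> rk_space d \<rho>" and "\<And>h. h \<in> freqs d \<Longrightarrow> fcoeff d (synth d a) h = a h"
proof -
  note S = synth[OF abs_summ[OF assms(1)] ev]
  show c: "\<And>h. h \<in> freqs d \<Longrightarrow> fcoeff d (synth d a) h = a h" by (rule S(3))
  show "synth d a \<in> rk_space d \<rho>"
    unfolding rk_space_echar using S(1,2) assms(1) c
    by (auto cong: summable_on_cong has_sum_cong)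
qed

lemma lincomb_mem:
  assumes u: "u \<in> rk_space d \<rho>" and v: "v \<in> rk_space d \<rho>"
  shows "(\<lambda>x. a * u x + b * v x) \<in> rk_space d \<rho>"
proof -
  have "((\<lambda>h. (of_real a * fcoeff d u h + of_real b * fcoeff d v h) * echar d h x) has_sum
       complex_of_real (a * u x + b * v x)) (freqs d)" if "x \<in> cube d" for x
    using has_sum_add[OF has_sum_cmult_right[OF rkD(3)[OF u that], of "of_real a"]
        has_sum_cmult_right[OF rkD(3)[OF v that], of "of_real b"]]
    by (simp add: algebra_simps)
  then show ?thesis
    unfolding rk_space_echar
    using rkD[OF u] rkD[OF v] lin_summ[OF rkD(2)[OF u] rkD(2)[OF v], of "of_real a" "of_real b"]
    by (auto simp: fcoeff_lincomb)
qed

lemma inner_self: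
  assumes "u \<in> rk_space d \<rho>"
  shows "rk_inner d \<rho> u u = (\<Sum>\<^sub>\<infinity>h\<in>freqs d. \<rho> h * (cmod (fcoeff d u h))\<^sup>2)"
proof -
  have "(\<Sum>\<^sub>\<infinity>h\<in>freqs d. complex_of_real (\<rho> h) * fcoeff d u h * cnj (fcoeff d u h))
     = (\<Sum>\<^sub>\<infinity>h\<in>freqs d. complex_of_real (\<rho> h * (cmod (fcoeff d u h))\<^sup>2))"
    by (rule infsum_cong) (simp only: of_real_mult complex_norm_square mult.assoc)
  also have "\<dots> = of_real (\<Sum>\<^sub>\<infinity>h\<in>freqs d. \<rho> h * (cmod (fcoeff d u h))\<^sup>2)"
    by (rule infsumI, rule has_sum_of_real, rule has_sum_infsum, rule rkD(2)[OF assms])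
  finally show ?thesis by (simp add: rk_inner_def)
qed

lemma rk_norm_inner: "u \<in> rk_space d \<rho> \<Longrightarrow> rk_norm d \<rho> u = sqrt (rk_inner d \<rho> u u)"
  by (simp add: inner_self rk_norm_def)

lemma inner_sym: "rk_inner d \<rho> u v = rk_inner d \<rho> v u"
proof -
  have "(\<Sum>\<^sub>\<infinity>h\<in>freqs d. complex_of_real (\<rho> h) * fcoeff d u h * cnj (fcoeff d v h))
     = (\<Sum>\<^sub>\<infinity>h\<in>freqs d. cnj (complex_of_real (\<rho> h) * fcoeff d v h * cnj (fcoeff d u h)))"
    by (rule infsum_cong) simp
  then show ?thesis unfolding rk_inner_def infsum_cnj by simp
qed

lemma inner_lin:
  assumes u: "u \<in> rk_space d \<rho>" and v: "v \<in> rk_space d \<rho>" and w: "w \<in> rk_space d \<rho>"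
  shows "rk_inner d \<rho> (\<lambda>x. a * u x + b * v x) w = a * rk_inner d \<rho> u w + b * rk_inner d \<rho> v w"
proof -
  let ?t = "\<lambda>u h. complex_of_real (\<rho> h) * fcoeff d u h * cnj (fcoeff d w h)"
  have "infsum (?t (\<lambda>x. a * u x + b * v x)) (freqs d)
     = (\<Sum>\<^sub>\<infinity>h\<in>freqs d. of_real a * ?t u h + of_real b * ?t v h)"
    by (rule infsum_cong) (simp add: fcoeff_lincomb rkD(1)[OF u] rkD(1)[OF v] algebra_simps)
  also have "\<dots> = of_real a * infsum (?t u) (freqs d) + of_real b * infsum (?t v) (freqs d)"
    using prod_summ[OF rkD(2)[OF u] rkD(2)[OF w]] prod_summ[OF rkD(2)[OF v] rkD(2)[OF w]]
    by (simp add: infsum_add summable_on_cmult_right infsum_cmult_right)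
  finally show ?thesis by (simp add: rk_inner_def)
qed

lemma inner_pos:
  assumes u: "u \<in> rk_space d \<rho>"
  shows "0 \<le> rk_inner d \<rho> u u" and "rk_inner d \<rho> u u = 0 \<Longrightarrow> x \<in> cube d \<Longrightarrow> u x = 0"
proof -
  have nn: "0 \<le> \<rho> h * (cmod (fcoeff d u h))\<^sup>2" if "h \<in> freqs d" for h
    using pos[OF that] by simp
  show "0 \<le> rk_inner d \<rho> u u"
    unfolding inner_self[OF u] by (rule infsum_nonneg) (rule nn)
  assume z: "rk_inner d \<rho> u u = 0" and x: "x \<in> cube d"
  have "fcoeff d u h = 0" if "h \<in> freqs d" for h
    using nonneg_infsum_le_0D[OF _ rkD(2)[OF u] nn that] z pos[OF that] unfolding inner_self[OF u] by simp
  then have "((\<lambda>h. fcoeff d u h * echar d h x) has_sum 0) (freqs d)"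
    by (intro has_sum_0) auto
  with rkD(3)[OF u x] show "u x = 0" using has_sum_unique by fastforce
qed

lemma kernel_synth:
  "rk_kernel d \<rho> x = synth d (\<lambda>h. of_real (1 / \<rho> h) * cnj (echar d h x))"
proof
  fix x'
  have "cis (2 * pi * fdot d h (\<lambda>j. x j - x' j)) = echar d h x * cnj (echar d h x')" for h
    by (simp add: echar_def fdot_def cis_cnj cis_mult right_diff_distrib sum_subtractf)
  then have "rk_kernel d \<rho> x x' = Re (\<Sum>\<^sub>\<infinity>h\<in>freqs d. cnj (of_real (1 / \<rho> h) * cnj (echar d h x) * echar d h x'))"
    by (simp add: rk_kernel_def mult.assoc)
  then show "rk_kernel d \<rho> x x' = synth d (\<lambda>h. of_real (1 / \<rho> h) * cnj (echar d h x)) x'"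
    unfolding synth_def infsum_cnj by simp
qed

lemma kernel_mem:
  "rk_kernel d \<rho> x \<in> rk_space d \<rho>"
  "\<And>h. h \<in> freqs d \<Longrightarrow> fcoeff d (rk_kernel d \<rho> x) h = of_real (1 / \<rho> h) * cnj (echar d h x)"
proof -
  have eq: "\<rho> h * (cmod (of_real (1 / \<rho> h) * cnj (echar d h x)))\<^sup>2 = 1 / \<rho> h" if "h \<in> freqs d" for h
    using pos[OF that] by (simp add: norm_mult norm_divide power_divide power2_eq_square)
  have 1: "(\<lambda>h. \<rho> h * (cmod (of_real (1 / \<rho> h) * cnj (echar d h x)))\<^sup>2) summable_on freqs d"
    using summ eq by (metis (no_types, lifting) summable_on_cong)
  have 2: "of_real (1 / \<rho> (fneg d h)) * cnj (echar d (fneg d h) x) = cnj (of_real (1 / \<rho> h) * cnj (echar d h x))"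
    if "h \<in> freqs d" for h using even[OF that] by (simp add: echar_fneg)
  show "rk_kernel d \<rho> x \<in> rk_space d \<rho>"
    "\<And>h. h \<in> freqs d \<Longrightarrow> fcoeff d (rk_kernel d \<rho> x) h = of_real (1 / \<rho> h) * cnj (echar d h x)"
    unfolding kernel_synth using synth_mem[OF 1 2] by auto
qed

lemma reproducing:
  assumes u: "u \<in> rk_space d \<rho>" and x: "x \<in> cube d"
  shows "rk_inner d \<rho> u (rk_kernel d \<rho> x) = u x"
proof -
  have "(\<Sum>\<^sub>\<infinity>h\<in>freqs d. complex_of_real (\<rho> h) * fcoeff d u h * cnj (fcoeff d (rk_kernel d \<rho> x) h))
     = (\<Sum>\<^sub>\<infinity>h\<in>freqs d. fcoeff d u h * echar d h x)"
  proof (rule infsum_cong)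
    fix h assume h: "h \<in> freqs d"
    show "complex_of_real (\<rho> h) * fcoeff d u h * cnj (fcoeff d (rk_kernel d \<rho> x) h) = fcoeff d u h * echar d h x"
      using pos[OF h] by (simp add: kernel_mem(2)[OF h])
  qed
  also have "\<dots> = of_real (u x)" using rkD(3)[OF u x] by (rule infsumI)
  finally show ?thesis by (simp add: rk_inner_def)
qed

lemma complete:
  assumes s: "\<And>n. s n \<in> rk_space d \<rho>"
    and cauchy: "\<And>e. e > 0 \<Longrightarrow> \<exists>n0. \<forall>m\<ge>n0. \<forall>n\<ge>n0. rk_inner d \<rho> (\<lambda>x. s m x - s n x) (\<lambda>x. s m x - s n x) < e"
  shows "\<exists>u\<in>rk_space d \<rho>. (\<lambda>n. rk_inner d \<rho> (\<lambda>x. s n x - u x) (\<lambda>x. s n x - u x)) \<longlonglongrightarrow> 0"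
proof -
  define c where "c n h = fcoeff d (s n) h" for n h
  have diff: "(\<lambda>x. u x - v x) \<in> rk_space d \<rho>"
     "fcoeff d (\<lambda>x. u x - v x) h = fcoeff d u h - fcoeff d v h"
    if "u \<in> rk_space d \<rho>" "v \<in> rk_space d \<rho>" for u v h
    using lincomb_mem[OF that, of 1 "-1"] fcoeff_lincomb[OF that[THEN rkD(1)], of 1 "-1" h] by auto
  have part: "(\<Sum>h\<in>F. \<rho> h * (cmod (c m h - c n h))\<^sup>2)
      \<le> rk_inner d \<rho> (\<lambda>x. s m x - s n x) (\<lambda>x. s m x - s n x)" if "finite F" "F \<subseteq> freqs d" for m n F
    using finite_sum_le_infsum[OF rkD(2)[OF diff(1)[OF s s, of m n]] that] pos
    by (simp add: inner_self diff s c_def less_imp_le)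
  have "Cauchy (\<lambda>n. c n h)" if h: "h \<in> freqs d" for h
  proof (rule metric_CauchyI)
    fix e :: real assume e: "e > 0"
    then obtain n0 where n0: "\<And>m n. m \<ge> n0 \<Longrightarrow> n \<ge> n0 \<Longrightarrow>
        rk_inner d \<rho> (\<lambda>x. s m x - s n x) (\<lambda>x. s m x - s n x) < \<rho> h * e\<^sup>2"
      using cauchy[of "\<rho> h * e\<^sup>2"] pos[OF h] by auto
    have "dist (c m h) (c n h) < e" if "m \<ge> n0" "n \<ge> n0" for m n
    proof -
      have "\<rho> h * (cmod (c m h - c n h))\<^sup>2 < \<rho> h * e\<^sup>2"
        using part[of "{h}" m n] h n0[OF that] by simp
      then have "(cmod (c m h - c n h))\<^sup>2 < e\<^sup>2" using pos[OF h] by simp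
      then show ?thesis using e by (simp add: dist_norm power2_less_imp_less)
    qed
    then show "\<exists>M. \<forall>m\<ge>M. \<forall>n\<ge>M. dist (c m h) (c n h) < e" by blast
  qed
  then have "\<forall>h. \<exists>l. h \<in> freqs d \<longrightarrow> (\<lambda>n. c n h) \<longlonglongrightarrow> l"
    by (auto simp: Cauchy_convergent_iff convergent_def)
  then obtain l where l: "\<And>h. h \<in> freqs d \<Longrightarrow> (\<lambda>n. c n h) \<longlonglongrightarrow> l h" by metis
  have lim: "(\<Sum>h\<in>F. \<rho> h * (cmod (c n h - l h))\<^sup>2) \<le> e"
    if F: "finite F" "F \<subseteq> freqs d" and n: "n \<ge> n0"
      and n0: "\<And>m n. m \<ge> n0 \<Longrightarrow> n \<ge> n0 \<Longrightarrow> rk_inner d \<rho> (\<lambda>x. s m x - s n x) (\<lambda>x. s m x - s n x) < e"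
    for F n n0 e
  proof (rule LIMSEQ_le_const2)
    show "(\<lambda>m. \<Sum>h\<in>F. \<rho> h * (cmod (c n h - c m h))\<^sup>2) \<longlonglongrightarrow> (\<Sum>h\<in>F. \<rho> h * (cmod (c n h - l h))\<^sup>2)"
      by (intro tendsto_intros l) (use F in auto)
    show "\<exists>N. \<forall>m\<ge>N. (\<Sum>h\<in>F. \<rho> h * (cmod (c n h - c m h))\<^sup>2) \<le> e"
      using part[OF F, of n] n0[OF n] by (meson less_imp_le order_trans)
  qed
  have tail: "(\<lambda>h. \<rho> h * (cmod (c n h - l h))\<^sup>2) summable_on freqs d"
     "(\<Sum>\<^sub>\<infinity>h\<in>freqs d. \<rho> h * (cmod (c n h - l h))\<^sup>2) \<le> e"
    if n: "n \<ge> n0"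
      and n0: "\<And>m n. m \<ge> n0 \<Longrightarrow> n \<ge> n0 \<Longrightarrow> rk_inner d \<rho> (\<lambda>x. s m x - s n x) (\<lambda>x. s m x - s n x) < e"
    for n n0 e
  proof -
    show 1: "(\<lambda>h. \<rho> h * (cmod (c n h - l h))\<^sup>2) summable_on freqs d"
      by (rule nonneg_bounded_partial_sums_imp_summable_on[where C=e])
         (use lim[OF _ _ n n0] pos in \<open>auto simp: less_imp_le intro!: eventually_finite_subsets_at_top_weakI\<close>)
    show "(\<Sum>\<^sub>\<infinity>h\<in>freqs d. \<rho> h * (cmod (c n h - l h))\<^sup>2) \<le> e"
      by (rule infsum_le_finite_sums[OF 1]) (use lim[OF _ _ n n0] in auto)
  qed
  obtain n1 where n1: "\<And>m n. m \<ge> n1 \<Longrightarrow> n \<ge> n1 \<Longrightarrow> rk_inner d \<rho> (\<lambda>x. s m x - s n x) (\<lambda>x. s m x - s n x) < 1"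
    using cauchy[of 1] by auto
  have lsum: "(\<lambda>h. \<rho> h * (cmod (l h))\<^sup>2) summable_on freqs d"
  proof -
    have "(\<lambda>h. \<rho> h * (cmod (c n1 h - l h))\<^sup>2) summable_on freqs d"
      by (rule tail(1)[where n0=n1 and e=1]) (rule order_refl, rule n1)
    from lin_summ[OF rkD(2)[OF s[of n1]] this, of 1 "-1"] show ?thesis by (simp add: c_def)
  qed
  have lev: "l (fneg d h) = cnj (l h)" if h: "h \<in> freqs d" for h
  proof (rule LIMSEQ_unique)
    show "(\<lambda>n. c n (fneg d h)) \<longlonglongrightarrow> l (fneg d h)" by (rule l) simp
    show "(\<lambda>n. c n (fneg d h)) \<longlonglongrightarrow> cnj (l h)"
      unfolding c_def fcoeff_fneg by (intro tendsto_intros) (use l[OF h] in \<open>simp add: c_def\<close>)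
  qed
  define u where "u = synth d l"
  have u: "u \<in> rk_space d \<rho>" and cu: "\<And>h. h \<in> freqs d \<Longrightarrow> fcoeff d u h = l h"
    unfolding u_def using synth_mem[OF lsum lev] by auto
  have eq: "rk_inner d \<rho> (\<lambda>x. s n x - u x) (\<lambda>x. s n x - u x) = (\<Sum>\<^sub>\<infinity>h\<in>freqs d. \<rho> h * (cmod (c n h - l h))\<^sup>2)" for n
    unfolding inner_self[OF diff(1)[OF s u]]
    by (rule infsum_cong) (simp add: diff(2)[OF s u] cu c_def)
  have "(\<lambda>n. rk_inner d \<rho> (\<lambda>x. s n x - u x) (\<lambda>x. s n x - u x)) \<longlonglongrightarrow> 0"
  proof (rule LIMSEQ_I)
    fix e :: real assume "e > 0"
    then obtain n0 where n0: "\<And>m n. m \<ge> n0 \<Longrightarrow> n \<ge> n0 \<Longrightarrow>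
        rk_inner d \<rho> (\<lambda>x. s m x - s n x) (\<lambda>x. s m x - s n x) < e / 2"
      using cauchy[of "e / 2"] by auto
    have "norm (rk_inner d \<rho> (\<lambda>x. s n x - u x) (\<lambda>x. s n x - u x) - 0) < e" if "n \<ge> n0" for n
      using tail(2)[OF that n0] inner_pos(1)[OF diff(1)[OF s u], of n] \<open>e > 0\<close> by (simp add: eq)
    then show "\<exists>no. \<forall>n\<ge>no. norm (rk_inner d \<rho> (\<lambda>x. s n x - u x) (\<lambda>x. s n x - u x) - 0) < e" by blast
  qed
  with u show ?thesis by blast
qed

theorem rk_space_rkhs: "is_rkhs (cube d) (rk_kernel d \<rho>) (rk_space d \<rho>) (rk_inner d \<rho>)"
  unfolding is_rkhs_def
  using lincomb_mem inner_sym inner_lin inner_pos kernel_mem(1) reproducing complete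
  by (intro conjI ballI allI impI) (auto simp: image_subset_iff)

end


lemma summable_powr_int:
  assumes "\<alpha> > 1"
  shows "(\<lambda>k::int. if k = 0 then 1 else \<bar>real_of_int k\<bar> powr - \<alpha>) summable_on UNIV" (is "?w summable_on _")
proof -
  have n: "(\<lambda>n. real n powr - \<alpha>) summable_on UNIV"
    by (rule norm_summable_imp_summable_on) (use assms in \<open>simp add: summable_real_powr_iff\<close>)
  have n1: "(\<lambda>n. real n powr - \<alpha>) summable_on {1..}"
    by (rule summable_on_subset_banach[OF n]) simp
  have "(?w \<circ> int) summable_on {1..} \<longleftrightarrow> (\<lambda>n. real n powr - \<alpha>) summable_on {1..}"
    by (rule summable_on_cong) simp
  then have p: "?w summable_on (int ` {1..})"
    using n1 by (subst summable_on_reindex) (simp_all only: inj_on_of_nat)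
  have "(?w \<circ> (\<lambda>n. - int n)) summable_on {1..} \<longleftrightarrow> (\<lambda>n. real n powr - \<alpha>) summable_on {1..}"
    by (rule summable_on_cong) simp
  moreover have "inj_on (\<lambda>n. - int n) {1..}" by (rule inj_onI) simp
  ultimately have m: "?w summable_on ((\<lambda>n. - int n) ` {1..})"
    using n1 by (subst summable_on_reindex) simp_all
  have "k \<in> {0} \<union> (int ` {1..} \<union> (\<lambda>n. - int n) ` {1..})" for k :: int
  proof (cases "k = 0")
    case False
    then have "k = int (nat k) \<and> nat k \<ge> 1 \<or> k = - int (nat (- k)) \<and> nat (- k) \<ge> 1" by linarith
    then show ?thesis by (auto simp del: of_nat_nat int_nat_eq)
  qed simp
  then have U: "UNIV = {0} \<union> (int ` {1..} \<union> (\<lambda>n. - int n) ` {1..})" by blast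
  have "?w summable_on {0}" by (rule summable_on_finite) simp
  then have "?w summable_on ({0} \<union> (int ` {1..} \<union> (\<lambda>n. - int n) ` {1..}))"
    by (intro summable_on_union p m)
  then show ?thesis by (simp only: U[symmetric])
qed

lemma tik_kor:
  assumes "\<alpha> > 1" and g: "\<And>u. u \<subseteq> {1..d} \<Longrightarrow> \<gamma> u > 0"
  shows "tik d (kor d \<alpha> \<gamma>)"
proof -
  define w where "w k = (if k = 0 then 1 else \<bar>real_of_int k\<bar> powr - \<alpha>)" for k
  define G where "G = 1 + (\<Sum>u\<in>Pow {1..d}. \<gamma> u)"
  define P where "P h = (\<Prod>j\<in>supp d h. \<bar>real_of_int (h j)\<bar> powr \<alpha>)" for h
  have sub: "supp d h \<subseteq> {1..d}" for h by (auto simp: supp_def)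
  have gs: "\<gamma> (supp d h) > 0" for h using sub by (rule g)
  have gG: "\<gamma> (supp d h) \<le> G" for h
  proof -
    have "\<gamma> (supp d h) \<le> (\<Sum>u\<in>Pow {1..d}. \<gamma> u)"
      by (rule member_le_sum) (use sub g in \<open>auto intro: less_imp_le\<close>)
    then show ?thesis by (simp add: G_def)
  qed
  have "0 \<le> (\<Sum>u\<in>Pow {1..d}. \<gamma> u)"
    by (rule sum_nonneg) (use g in \<open>auto intro: less_imp_le\<close>)
  then have G1: "1 \<le> G" by (simp add: G_def)
  have P: "P h > 0" for h
    unfolding P_def by (rule prod_pos) (simp add: supp_def)
  have kor: "kor d \<alpha> \<gamma> h = (if supp d h = {} then 1 else P h / \<gamma> (supp d h))" for h
    by (simp add: kor_def P_def)
  have pos: "kor d \<alpha> \<gamma> h > 0" for h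
    unfolding kor using gs P by simp
  have even: "kor d \<alpha> \<gamma> (fneg d h) = kor d \<alpha> \<gamma> h" for h
  proof -
    have s: "supp d (fneg d h) = supp d h" by (auto simp: supp_def fneg_def)
    have "P (fneg d h) = P h"
      unfolding P_def s by (rule prod.cong[OF refl]) (simp add: supp_def fneg_def)
    then show ?thesis by (simp add: kor s)
  qed
  have wn: "norm (w k) = w k" for k by (simp add: w_def)
  have "w summable_on UNIV" unfolding w_def[abs_def] by (rule summable_powr_int[OF assms(1)])
  then have "(\<lambda>k. norm (w k)) summable_on UNIV" by (simp only: wn)
  then have "Infinite_Set_Sum.abs_summable_on w UNIV" by (rule abs_summable_equivalent[THEN iffD1])
  then have "Infinite_Set_Sum.abs_summable_on (\<lambda>h. \<Prod>j\<in>{1..d}. w (h j)) (PiE {1..d} (\<lambda>_. UNIV))"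
    by (intro abs_summable_on_prod_PiE) simp_all
  then have "(\<lambda>h. norm (\<Prod>j\<in>{1..d}. w (h j))) summable_on (PiE {1..d} (\<lambda>_. UNIV))"
    by (rule abs_summable_equivalent[THEN iffD2])
  then have "(\<lambda>h. \<Prod>j\<in>{1..d}. w (h j)) summable_on freqs d"
    unfolding freqs_def by (rule abs_summable_summable)
  then have "(\<lambda>h. G * (\<Prod>j\<in>{1..d}. w (h j))) summable_on freqs d"
    by (rule summable_on_cmult_right)
  then have summ: "(\<lambda>h. 1 / kor d \<alpha> \<gamma> h) summable_on freqs d"
  proof (rule summable_on_comparison_test)
    fix h
    have "(\<Prod>j\<in>{1..d}. w (h j)) = (\<Prod>j\<in>supp d h. w (h j))"
      by (rule prod.mono_neutral_right) (auto simp: supp_def w_def)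
    also have "\<dots> = (\<Prod>j\<in>supp d h. 1 / (\<bar>real_of_int (h j)\<bar> powr \<alpha>))"
      by (rule prod.cong[OF refl]) (simp only: w_def supp_def powr_minus_divide mem_Collect_eq if_False simp_thms)
    also have "\<dots> = 1 / P h" unfolding P_def by (simp add: prod_dividef)
    finally have eq: "(\<Prod>j\<in>{1..d}. w (h j)) = 1 / P h" .
    show "1 / kor d \<alpha> \<gamma> h \<le> G * (\<Prod>j\<in>{1..d}. w (h j))"
    proof (cases "supp d h = {}")
      case True
      then show ?thesis unfolding eq kor using G1 by (simp add: P_def)
    next
      case False
      then show ?thesis unfolding eq kor using gG[of h] P[of h] by (simp add: divide_right_mono)
    qed
    show "0 \<le> 1 / kor d \<alpha> \<gamma> h" using pos[of h] by simp
  qed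
  show ?thesis by (rule tik.intro) (rule pos even summ)+
qed

lemma korsq_eq: "korsq d \<alpha> \<gamma> = kor d (2 * \<alpha>) (\<lambda>u. (\<gamma> u)\<^sup>2)"
proof
  fix h
  have "x powr \<alpha> * x powr \<alpha> = x powr (2 * \<alpha>)" for x :: real
    by (simp only: powr_add[symmetric] mult_2)
  then have "(\<Prod>j\<in>supp d h. \<bar>real_of_int (h j)\<bar> powr \<alpha>)\<^sup>2 = (\<Prod>j\<in>supp d h. \<bar>real_of_int (h j)\<bar> powr (2 * \<alpha>))"
    unfolding power2_eq_square prod.distrib[symmetric] by simp
  then show "korsq d \<alpha> \<gamma> h = kor d (2 * \<alpha>) (\<lambda>u. (\<gamma> u)\<^sup>2) h"
    unfolding korsq_def kor_def by (simp only: power_divide if_distrib[of "\<lambda>x. x\<^sup>2"] power_one)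
qed

theorem korobov_rkhs:
  assumes "\<alpha> > 1" and "\<And>u. u \<subseteq> {1..d} \<Longrightarrow> \<gamma> u > 0"
  shows "is_rkhs (cube d) (rk_kernel d (kor d \<alpha> \<gamma>)) (rk_space d (kor d \<alpha> \<gamma>)) (rk_inner d (kor d \<alpha> \<gamma>))"
    and "is_rkhs (cube d) (rk_kernel d (korsq d \<alpha> \<gamma>)) (rk_space d (korsq d \<alpha> \<gamma>)) (rk_inner d (korsq d \<alpha> \<gamma>))"
    and "v \<in> rk_space d (kor d \<alpha> \<gamma>) \<Longrightarrow> rk_norm d (kor d \<alpha> \<gamma>) v = sqrt (rk_inner d (kor d \<alpha> \<gamma>) v v)"
    and "v \<in> rk_space d (korsq d \<alpha> \<gamma>) \<Longrightarrow> rk_norm d (korsq d \<alpha> \<gamma>) v = sqrt (rk_inner d (korsq d \<alpha> \<gamma>) v v)"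
proof -
  have 1: "tik d (kor d \<alpha> \<gamma>)" using assms by (rule tik_kor)
  have 2: "tik d (korsq d \<alpha> \<gamma>)"
    unfolding korsq_eq
  proof (rule tik_kor)
    show "1 < 2 * \<alpha>" using assms(1) by linarith
    show "0 < (\<gamma> u)\<^sup>2" if "u \<subseteq> {1..d}" for u
      using assms(2)[OF that] by (rule zero_less_power)
  qed
  show "is_rkhs (cube d) (rk_kernel d (kor d \<alpha> \<gamma>)) (rk_space d (kor d \<alpha> \<gamma>)) (rk_inner d (kor d \<alpha> \<gamma>))"
    using 1 by (rule tik.rk_space_rkhs)
  show "is_rkhs (cube d) (rk_kernel d (korsq d \<alpha> \<gamma>)) (rk_space d (korsq d \<alpha> \<gamma>)) (rk_inner d (korsq d \<alpha> \<gamma>))"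
    using 2 by (rule tik.rk_space_rkhs)
  show "v \<in> rk_space d (kor d \<alpha> \<gamma>) \<Longrightarrow> rk_norm d (kor d \<alpha> \<gamma>) v = sqrt (rk_inner d (kor d \<alpha> \<gamma>) v v)"
    using 1 by (rule tik.rk_norm_inner)
  show "v \<in> rk_space d (korsq d \<alpha> \<gamma>) \<Longrightarrow> rk_norm d (korsq d \<alpha> \<gamma>) v = sqrt (rk_inner d (korsq d \<alpha> \<gamma>) v v)"
    using 2 by (rule tik.rk_norm_inner)
qed

end

theory Submission
  imports Defs
begin

text \<open>
  Unmarked norms and inner products are those of \<open>L\<^sup>2\<close> on the cube. Write \<open>\<rho> = r(\<cdot>, \<gamma>)\<close>, \<open>V\<close> for the
  lattice span, and \<open>B(u, v) = \<langle>u, v\<rangle> + \<lambda> \<langle>u, v\<rangle>\<^bsub>kor\<^esub>\<close>. By Parseval, \<open>B\<close> is the inner product of the kernel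
  space with weights \<open>1 + \<lambda> \<rho>\<close>, which has the same elements as the Korobov space (\<open>rk_space_reg\<close>,
  \<open>rk_inner_reg\<close>). The estimator is the \<open>B\<close>-Riesz representative in \<open>V\<close> of the empirical mean
  \<open>v \<mapsto> (1/M) \<Sum> v(Y\<^sub>j)\<close>, and its expectation is the representative \<open>u\<close> of \<open>v \<mapsto> \<langle>f, v\<rangle>\<close>. In a
  \<open>B\<close>-orthonormal basis \<open>\<phi>\<^sub>i\<close> of \<open>V\<close> both are explicit: their coefficients are the sample means and the
  true means of \<open>\<phi>\<^sub>i(Y)\<close>.

  Variance (\<open>risk_decomposition\<close>, \<open>effective_dimension\<close>). The squared \<open>L\<^sup>2\<close> distance of the estimator
  from \<open>u\<close> is at most its squared \<open>B\<close>-distance, which is a sum of squared errors of sample means and has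
  expectation at most \<open>(1/M) E[\<Sum> \<phi>\<^sub>i(Y)\<^sup>2]\<close>. The inner sum is the diagonal of the reproducing kernel of
  \<open>(V, B)\<close>; it is bounded, uniformly in the point, by the diagonal \<open>\<Sum>\<^sub>h 1 / (1 + \<lambda> \<rho>(h))\<close> of the kernel
  of the whole space. Since \<open>t powr \<tau> \<le> 1 + t\<close>, this is at most \<open>\<lambda> powr -\<tau>\<close> times
  \<open>\<Sum>\<^sub>h \<rho>(h) powr -\<tau>\<close>, and sorting the frequencies by their support turns the last series into the sum of
  \<open>trace_term\<close> over the subsets of \<open>{1..d}\<close> (\<open>kor_trace_term\<close>). The factor \<open>\<parallel>f\<parallel>\<close> may be inserted because
  it is at least \<open>1\<close> for a density.

  Bias (\<open>bias_energy\<close>, \<open>bias_smooth\<close>). Let \<open>w\<close> be the kernel interpolant of \<open>f\<close>. The function \<open>u\<close>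
  minimises \<open>\<parallel>f - v\<parallel>\<^sup>2 + \<lambda> \<parallel>v\<parallel>\<^bsub>kor\<^esub>\<^sup>2\<close> over \<open>V\<close>; comparison with \<open>w\<close> gives the bound with \<open>\<lambda>\<close>. For the bound with
  \<open>\<lambda>\<^sup>2\<close> one uses \<open>B(u - w, v) = \<langle>f - w, v\<rangle> - \<lambda> \<langle>f, v\<rangle>\<^bsub>kor\<^esub>\<close>, in which the last product is controlled by the
  \<open>L\<^sup>2\<close> norm of \<open>v\<close> when \<open>h \<mapsto> \<rho>(h) |fcoeff d f h|\<close> is square summable. In both cases \<open>\<parallel>f - w\<parallel>\<close> is the interpolation error
  that a good generating vector makes small.

  The same constant serves both bounds. It depends on \<open>d\<close> only through finite sums of nonnegative terms
  over subsets of \<open>{1..d}\<close>. Weight sums with different exponents are compared in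
  \<open>weight_at_summable_mono\<close>: summability for one exponent gives it for all larger ones, so that the
  summability condition for the squared kernel implies the one for the original kernel.
\<close>

section \<open>Functions on the cube and finite spans\<close>

text \<open>
  Functions in a span are undefined outside the cube, so they agree with members of the kernel space
  only on the cube. The following congruence rules make this harmless.
\<close>

lemma fcoeff_cong: "(\<And>x. x \<in> cube d \<Longrightarrow> u x = v x) \<Longrightarrow> fcoeff d u = fcoeff d v"
  unfolding fcoeff_def by (intro ext Bochner_Integration.integral_cong) (auto simp: space_cube_measure)

lemma rk_inner_cong:
  "(\<And>x. x \<in> cube d \<Longrightarrow> u x = u' x) \<Longrightarrow> (\<And>x. x \<in> cube d \<Longrightarrow> v x = v' x) \<Longrightarrow>
    rk_inner d \<rho> u v = rk_inner d \<rho> u' v'"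
  using fcoeff_cong[of d u u'] fcoeff_cong[of d v v'] by (simp add: rk_inner_def)

lemma l2_inner_cong:
  "(\<And>x. x \<in> cube d \<Longrightarrow> u x = u' x) \<Longrightarrow> (\<And>x. x \<in> cube d \<Longrightarrow> v x = v' x) \<Longrightarrow>
    l2_inner d u v = l2_inner d u' v'"
  unfolding l2_inner_def by (intro Bochner_Integration.integral_cong) (auto simp: space_cube_measure)

lemma rk_space_cong:
  assumes "\<And>x. x \<in> cube d \<Longrightarrow> u x = v x"
  shows "u \<in> rk_space d \<rho> \<longleftrightarrow> v \<in> rk_space d \<rho>"
proof -
  have "integrable (cube_measure d) u \<longleftrightarrow> integrable (cube_measure d) v"
    by (rule Bochner_Integration.integrable_cong) (auto simp: space_cube_measure assms)
  then show ?thesis using assms fcoeff_cong[of d u v] by (simp add: rk_space_def)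
qed

lemma l2_norm_sq: "(l2_norm d v)\<^sup>2 = l2_inner d v v"
proof -
  have "0 \<le> (\<integral>x. v x * v x \<partial>cube_measure d)"
    by (rule Bochner_Integration.integral_nonneg) simp
  then show ?thesis by (simp add: l2_norm_def l2_inner_def power2_eq_square)
qed

lemma l2_inner_nonneg: "0 \<le> l2_inner d v v"
  using l2_norm_sq[of d v] by (metis zero_le_power2)

text \<open>
  The span is cut off to the cube in order to be literally the lattice span; it is therefore not closed
  under pointwise addition, and linear combinations in it are always followed by a restriction.
\<close>

definition fspan :: "nat \<Rightarrow> (nat \<Rightarrow> (nat \<Rightarrow> real) \<Rightarrow> real) \<Rightarrow> nat \<Rightarrow> ((nat \<Rightarrow> real) \<Rightarrow> real) set" where
  "fspan d g n = {(\<lambda>x\<in>cube d. \<Sum>k=1..n. c k * g k x) | c. True}"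

lemma lattice_span_fspan: "lattice_span d \<rho> N z = fspan d (\<lambda>k. rk_kernel d \<rho> (lattice_pt d N z k)) N"
  by (simp add: lattice_span_def fspan_def)

lemma fspanI: "v = (\<lambda>x\<in>cube d. \<Sum>k=1..n. c k * g k x) \<Longrightarrow> v \<in> fspan d g n"
  by (auto simp: fspan_def)

lemma fspan_restrict: "v \<in> fspan d g n \<Longrightarrow> restrict v (cube d) = v"
  by (auto simp: fspan_def)

lemma fspan_lincomb:
  assumes "\<And>i. i \<in> I \<Longrightarrow> \<phi> i \<in> fspan d g n"
  shows "(\<lambda>x\<in>cube d. \<Sum>i\<in>I. a i * \<phi> i x) \<in> fspan d g n"
proof -
  have "\<forall>i\<in>I. \<exists>c. \<phi> i = (\<lambda>x\<in>cube d. \<Sum>k=1..n. c k * g k x)"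
    using assms by (auto simp: fspan_def)
  then obtain c where c: "\<And>i. i \<in> I \<Longrightarrow> \<phi> i = (\<lambda>x\<in>cube d. \<Sum>k=1..n. c i k * g k x)"
    by metis
  have "(\<lambda>x\<in>cube d. \<Sum>i\<in>I. a i * \<phi> i x) = (\<lambda>x\<in>cube d. \<Sum>k=1..n. (\<Sum>i\<in>I. a i * c i k) * g k x)"
  proof (rule restrict_ext)
    fix x assume x: "x \<in> cube d"
    have "(\<Sum>i\<in>I. a i * \<phi> i x) = (\<Sum>i\<in>I. \<Sum>k=1..n. a i * c i k * g k x)"
      by (rule sum.cong[OF refl]) (simp add: c x sum_distrib_left mult.assoc)
    also have "\<dots> = (\<Sum>k=1..n. (\<Sum>i\<in>I. a i * c i k) * g k x)"
      by (subst sum.swap) (simp add: sum_distrib_right)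
    finally show "(\<Sum>i\<in>I. a i * \<phi> i x) = (\<Sum>k=1..n. (\<Sum>i\<in>I. a i * c i k) * g k x)" .
  qed
  then show ?thesis by (rule fspanI)
qed

lemma fspan_generator:
  assumes "k \<in> {1..n}"
  shows "restrict (g k) (cube d) \<in> fspan d g n"
proof -
  have "restrict (g k) (cube d) = (\<lambda>x\<in>cube d. \<Sum>l=1..n. (if l = k then 1 else 0) * g l x)"
    by (rule restrict_ext) (use assms in \<open>simp add: sum.remove[of _ k]\<close>)
  then show ?thesis by (rule fspanI)
qed

lemma fspan_Suc: "fspan d g n \<subseteq> fspan d g (Suc n)"
proof
  fix v assume "v \<in> fspan d g n"
  then obtain c where v: "v = (\<lambda>x\<in>cube d. \<Sum>k=1..n. c k * g k x)" by (auto simp: fspan_def)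
  have "v = (\<lambda>x\<in>cube d. \<Sum>k=1..Suc n. (c(Suc n := 0)) k * g k x)"
    unfolding v by (rule restrict_ext) simp
  then show "v \<in> fspan d g (Suc n)" by (rule fspanI)
qed

text \<open>
  The last clause is an expansion rather than a dimension statement: the generators may be linearly
  dependent, for instance when lattice points coincide, and then \<open>m\<close> is smaller than their number.
\<close>

definition onb ::
  "nat \<Rightarrow> ((nat \<Rightarrow> int) \<Rightarrow> real) \<Rightarrow> ((nat \<Rightarrow> real) \<Rightarrow> real) set \<Rightarrow> nat \<Rightarrow> (nat \<Rightarrow> (nat \<Rightarrow> real) \<Rightarrow> real) \<Rightarrow> bool" where
  "onb d \<rho> V m \<phi> \<longleftrightarrow> (\<forall>i<m. \<phi> i \<in> V) \<and>
     (\<forall>i<m. \<forall>j<m. rk_inner d \<rho> (\<phi> i) (\<phi> j) = (if i = j then 1 else 0)) \<and>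
     (\<forall>v\<in>V. \<forall>x\<in>cube d. v x = (\<Sum>i<m. rk_inner d \<rho> v (\<phi> i) * \<phi> i x))"

section \<open>Orthonormal bases and Riesz representation\<close>

context tik
begin

lemma sum_mem:
  assumes "finite I" "\<And>i. i \<in> I \<Longrightarrow> \<phi> i \<in> rk_space d \<rho>"
  shows "(\<lambda>x. \<Sum>i\<in>I. a i * \<phi> i x) \<in> rk_space d \<rho>"
    and "w \<in> rk_space d \<rho> \<Longrightarrow>
      rk_inner d \<rho> (\<lambda>x. \<Sum>i\<in>I. a i * \<phi> i x) w = (\<Sum>i\<in>I. a i * rk_inner d \<rho> (\<phi> i) w)"
proof -
  have "(\<lambda>x. \<Sum>i\<in>I. a i * \<phi> i x) \<in> rk_space d \<rho> \<and> (w \<in> rk_space d \<rho> \<longrightarrow>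
      rk_inner d \<rho> (\<lambda>x. \<Sum>i\<in>I. a i * \<phi> i x) w = (\<Sum>i\<in>I. a i * rk_inner d \<rho> (\<phi> i) w))"
    using assms
  proof (induction I rule: finite_induct)
    case empty
    have "(\<lambda>x. 0) \<in> rk_space d \<rho>" using lincomb_mem[OF kernel_mem(1) kernel_mem(1), of 0 undefined 0 undefined] by simp
    moreover have "rk_inner d \<rho> (\<lambda>x. 0) w = 0" by (simp add: rk_inner_def fcoeff_def)
    ultimately show ?case by simp
  next
    case (insert i I)
    then show ?case
      using lincomb_mem[of "\<phi> i" "\<lambda>x. \<Sum>i\<in>I. a i * \<phi> i x" "a i" 1]
        inner_lin[of "\<phi> i" "\<lambda>x. \<Sum>i\<in>I. a i * \<phi> i x" w "a i" 1] by simp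
  qed
  then show "(\<lambda>x. \<Sum>i\<in>I. a i * \<phi> i x) \<in> rk_space d \<rho>"
    and "w \<in> rk_space d \<rho> \<Longrightarrow>
      rk_inner d \<rho> (\<lambda>x. \<Sum>i\<in>I. a i * \<phi> i x) w = (\<Sum>i\<in>I. a i * rk_inner d \<rho> (\<phi> i) w)" by auto
qed

lemma diff_mem: "u \<in> rk_space d \<rho> \<Longrightarrow> v \<in> rk_space d \<rho> \<Longrightarrow> (\<lambda>x. u x - v x) \<in> rk_space d \<rho>"
  using lincomb_mem[of u v 1 "-1"] by simp

lemma inner_diff:
  "u \<in> rk_space d \<rho> \<Longrightarrow> v \<in> rk_space d \<rho> \<Longrightarrow> w \<in> rk_space d \<rho> \<Longrightarrow>
    rk_inner d \<rho> (\<lambda>x. u x - v x) w = rk_inner d \<rho> u w - rk_inner d \<rho> v w"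
  using inner_lin[of u v w 1 "-1"] by simp

lemma fspan_mem:
  assumes "\<And>k. k \<in> {1..n} \<Longrightarrow> g k \<in> rk_space d \<rho>" and "v \<in> fspan d g n"
  shows "v \<in> rk_space d \<rho>"
proof -
  obtain c where v: "v = (\<lambda>x\<in>cube d. \<Sum>k=1..n. c k * g k x)" using assms(2) by (auto simp: fspan_def)
  have "v \<in> rk_space d \<rho> \<longleftrightarrow> (\<lambda>x. \<Sum>k=1..n. c k * g k x) \<in> rk_space d \<rho>"
    by (rule rk_space_cong) (simp add: v)
  then show ?thesis using sum_mem(1)[of "{1..n}" g c] assms(1) by simp
qed

text \<open>
  Gram-Schmidt. A generator whose component orthogonal to the previous basis vectors has norm zero
  vanishes on the cube, by definiteness, and is skipped.
\<close>

lemma onb_exists: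
  assumes "\<And>k. k \<in> {1..n} \<Longrightarrow> g k \<in> rk_space d \<rho>"
  shows "\<exists>m \<phi>. onb d \<rho> (fspan d g n) m \<phi>"
proof -
  \<comment> \<open>The induction only carries expansions of the generators; those of the other elements follow by linearity.\<close>
  have "\<exists>(m::nat) \<phi>. (\<forall>i<m. \<phi> i \<in> fspan d g n) \<and>
     (\<forall>i<m. \<forall>j<m. rk_inner d \<rho> (\<phi> i) (\<phi> j) = (if i = j then 1 else 0)) \<and>
     (\<exists>a. \<forall>k\<in>{1..n}. \<forall>x\<in>cube d. g k x = (\<Sum>i<m. a k i * \<phi> i x))"
    using assms
  proof (induction n)
    case 0
    show ?case by (intro exI[of _ "0::nat"]) auto
  next
    case (Suc n)
    have "\<exists>(m::nat) \<phi>. (\<forall>i<m. \<phi> i \<in> fspan d g n) \<and>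
       (\<forall>i<m. \<forall>j<m. rk_inner d \<rho> (\<phi> i) (\<phi> j) = (if i = j then 1 else 0)) \<and>
       (\<exists>a. \<forall>k\<in>{1..n}. \<forall>x\<in>cube d. g k x = (\<Sum>i<m. a k i * \<phi> i x))"
      by (rule Suc.IH) (use Suc.prems in auto)
    then obtain m :: nat and \<phi> a where hyp: "\<forall>i<m. \<phi> i \<in> fspan d g n"
      "\<forall>i<m. \<forall>j<m. rk_inner d \<rho> (\<phi> i) (\<phi> j) = (if i = j then 1 else 0)"
      "\<forall>k\<in>{1..n}. \<forall>x\<in>cube d. g k x = (\<Sum>i<m. a k i * \<phi> i x)"
      by (elim exE conjE) (rule that)
    note \<phi> = hyp(1)[rule_format] and ortho = hyp(2)[rule_format] and a = hyp(3)[rule_format]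
    have g: "g k \<in> rk_space d \<rho>" if "k \<in> {1..Suc n}" for k using Suc.prems that by simp
    have \<phi>S: "\<phi> i \<in> fspan d g (Suc n)" if "i < m" for i using \<phi>[OF that] fspan_Suc by blast
    have \<phi>H: "\<phi> i \<in> rk_space d \<rho>" if "i < m" for i by (rule fspan_mem[OF g \<phi>S[OF that]])
    define G where "G = g (Suc n)"
    have GH: "G \<in> rk_space d \<rho>" unfolding G_def by (rule g) simp
    define b where "b i = rk_inner d \<rho> G (\<phi> i)" for i
    define p where "p x = (\<Sum>i<m. b i * \<phi> i x)" for x
    have pH: "p \<in> rk_space d \<rho>"
      unfolding p_def[abs_def] by (rule sum_mem) (use \<phi>H in auto)
    have pin: "rk_inner d \<rho> p w = (\<Sum>i<m. b i * rk_inner d \<rho> (\<phi> i) w)" if "w \<in> rk_space d \<rho>" for w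
      unfolding p_def[abs_def] by (rule sum_mem) (use \<phi>H that in auto)
    define w where "w x = G x - p x" for x
    have wH: "w \<in> rk_space d \<rho>" unfolding w_def[abs_def] by (rule diff_mem[OF GH pH])
    have w\<phi>: "rk_inner d \<rho> w (\<phi> j) = 0" if j: "j < m" for j
    proof -
      have "rk_inner d \<rho> p (\<phi> j) = (\<Sum>i<m. if i = j then b i else 0)"
        unfolding pin[OF \<phi>H[OF j]] by (rule sum.cong) (auto simp: ortho j)
      then have "rk_inner d \<rho> p (\<phi> j) = b j" using j by simp
      then show ?thesis unfolding w_def[abs_def] inner_diff[OF GH pH \<phi>H[OF j]] by (simp add: b_def)
    qed
    show ?case
    proof (cases "rk_inner d \<rho> w w = 0")
      case True
      have "G x = (\<Sum>i<m. b i * \<phi> i x)" if "x \<in> cube d" for x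
        using inner_pos(2)[OF wH True that] by (simp add: w_def p_def)
      then have "\<forall>k\<in>{1..Suc n}. \<forall>x\<in>cube d. g k x = (\<Sum>i<m. (a(Suc n := b)) k i * \<phi> i x)"
        using a by (auto simp: G_def le_Suc_eq)
      moreover have "\<forall>i<m. \<phi> i \<in> fspan d g (Suc n)" using \<phi>S by simp
      ultimately show ?thesis
        by (intro exI[of _ m] exI[of _ \<phi>] conjI exI[of _ "a(Suc n := b)"] hyp(2))
    next
      case False
      define s where "s = sqrt (rk_inner d \<rho> w w)"
      have s: "s > 0" "s * s = rk_inner d \<rho> w w" using False inner_pos(1)[OF wH] by (auto simp: s_def)
      define \<psi> where "\<psi> = (\<lambda>x\<in>cube d. w x / s)"
      have "\<psi> = (\<lambda>x\<in>cube d. \<Sum>i<Suc m. (if i = m then 1 / s else - b i / s) *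
          (if i = m then restrict G (cube d) else \<phi> i) x)"
        unfolding \<psi>_def
        by (intro restrict_ext) (simp add: w_def p_def diff_divide_distrib sum_divide_distrib sum_negf)
      also have "\<dots> \<in> fspan d g (Suc n)"
        by (rule fspan_lincomb) (use \<phi>S in \<open>auto simp: G_def intro!: fspan_generator\<close>)
      finally have \<psi>S: "\<psi> \<in> fspan d g (Suc n)" .
      have \<psi>in: "rk_inner d \<rho> \<psi> v = rk_inner d \<rho> w v / s" if "v \<in> rk_space d \<rho>" for v
      proof -
        have "rk_inner d \<rho> \<psi> v = rk_inner d \<rho> (\<lambda>x. (1 / s) * w x + 0 * w x) v"
          by (rule rk_inner_cong) (auto simp: \<psi>_def)
        then show ?thesis using inner_lin[OF wH wH that, of "1 / s" 0] by simp
      qed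
      have \<psi>H: "\<psi> \<in> rk_space d \<rho>" by (rule fspan_mem[OF g \<psi>S])
      have \<psi>\<phi>: "rk_inner d \<rho> \<psi> (\<phi> i) = 0" if "i < m" for i
        using \<psi>in[OF \<phi>H[OF that]] w\<phi>[OF that] by simp
      then have \<phi>\<psi>: "rk_inner d \<rho> (\<phi> i) \<psi> = 0" if "i < m" for i
        using that inner_sym[of \<psi> "\<phi> i"] by simp
      have \<psi>\<psi>: "rk_inner d \<rho> \<psi> \<psi> = 1"
      proof -
        have "rk_inner d \<rho> \<psi> \<psi> = rk_inner d \<rho> \<psi> w / s"
          unfolding \<psi>in[OF \<psi>H] by (rule arg_cong[OF inner_sym])
        also have "\<dots> = 1" unfolding \<psi>in[OF wH] using s False by (simp add: field_simps)
        finally show ?thesis .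
      qed
      let ?\<phi> = "\<phi>(m := \<psi>)"
      have 1: "\<forall>i<Suc m. ?\<phi> i \<in> fspan d g (Suc n)" using \<phi>S \<psi>S by (auto simp: less_Suc_eq)
      have 2: "\<forall>i<Suc m. \<forall>j<Suc m. rk_inner d \<rho> (?\<phi> i) (?\<phi> j) = (if i = j then 1 else 0)"
        using ortho \<psi>\<phi> \<psi>\<psi> \<phi>\<psi> by (auto simp: less_Suc_eq)
      have 3: "\<forall>k\<in>{1..Suc n}. \<forall>x\<in>cube d. g k x =
          (\<Sum>i<Suc m. (if k = Suc n then b(m := s) else (a k)(m := 0)) i * ?\<phi> i x)"
      proof (intro ballI)
        fix k x assume k: "k \<in> {1..Suc n}" and x: "x \<in> cube d"
        show "g k x = (\<Sum>i<Suc m. (if k = Suc n then b(m := s) else (a k)(m := 0)) i * ?\<phi> i x)"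
        proof (cases "k = Suc n")
          case True
          have "g k x = p x + s * \<psi> x" using True x s(1) by (simp add: \<psi>_def w_def G_def)
          then show ?thesis using True by (simp add: p_def)
        next
          case False
          then have "k \<in> {1..n}" using k by auto
          then show ?thesis using a[of k x] x False by simp
        qed
      qed
      show ?thesis
        by (intro exI[of _ "Suc m"] exI[of _ ?\<phi>] conjI)
           (rule 1, rule 2, rule exI[of _ "\<lambda>k i. (if k = Suc n then b(m := s) else (a k)(m := 0)) i"], rule 3)
    qed
  qed
  then obtain m :: nat and \<phi> a where hyp: "\<forall>i<m. \<phi> i \<in> fspan d g n"
    "\<forall>i<m. \<forall>j<m. rk_inner d \<rho> (\<phi> i) (\<phi> j) = (if i = j then 1 else 0)"
    "\<forall>k\<in>{1..n}. \<forall>x\<in>cube d. g k x = (\<Sum>i<m. a k i * \<phi> i x)"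
    by (elim exE conjE) (rule that)
  note \<phi> = hyp(1)[rule_format] and ortho = hyp(2)[rule_format] and a = hyp(3)[rule_format]
  have \<phi>H: "\<phi> i \<in> rk_space d \<rho>" if "i < m" for i by (rule fspan_mem[OF assms \<phi>[OF that]])
  have "v x = (\<Sum>i<m. rk_inner d \<rho> v (\<phi> i) * \<phi> i x)" if v: "v \<in> fspan d g n" and x: "x \<in> cube d" for v x
  proof -
    obtain c where c: "v = (\<lambda>x\<in>cube d. \<Sum>k=1..n. c k * g k x)" using v by (auto simp: fspan_def)
    define e where "e i = (\<Sum>k=1..n. c k * a k i)" for i
    have eq: "v x = (\<Sum>i<m. e i * \<phi> i x)" if x: "x \<in> cube d" for x
    proof -
      have "v x = (\<Sum>k=1..n. \<Sum>i<m. c k * a k i * \<phi> i x)"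
        using x by (simp add: c a sum_distrib_left mult.assoc)
      also have "\<dots> = (\<Sum>i<m. e i * \<phi> i x)"
        by (subst sum.swap) (simp add: e_def sum_distrib_right)
      finally show ?thesis .
    qed
    have "rk_inner d \<rho> v (\<phi> j) = e j" if j: "j < m" for j
    proof -
      have "rk_inner d \<rho> v (\<phi> j) = rk_inner d \<rho> (\<lambda>x. \<Sum>i<m. e i * \<phi> i x) (\<phi> j)"
        by (rule rk_inner_cong) (auto simp: eq)
      also have "\<dots> = (\<Sum>i<m. e i * rk_inner d \<rho> (\<phi> i) (\<phi> j))"
        by (rule sum_mem) (use \<phi>H j in auto)
      also have "\<dots> = (\<Sum>i<m. if i = j then e i else 0)"
        by (rule sum.cong) (auto simp: ortho j)
      finally show ?thesis using j by simp
    qed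
    then show ?thesis by (simp add: eq[OF x])
  qed
  then have "onb d \<rho> (fspan d g n) m \<phi>" unfolding onb_def using \<phi> ortho by blast
  then show ?thesis by blast
qed

text \<open>
  Linearity of \<open>L\<close> is only asked on combinations of the basis, as the span is not closed under pointwise
  operations. The functionals of interest are sample means, integration against \<open>f\<close>, and the kernel inner
  product with \<open>f\<close>; they give the estimator, its mean, and the interpolant.
\<close>

lemma onb_riesz:
  assumes g: "\<And>k. k \<in> {1..n} \<Longrightarrow> g k \<in> rk_space d \<rho>" and onb: "onb d \<rho> (fspan d g n) m \<phi>"
    and L: "\<And>a. L (\<lambda>x\<in>cube d. \<Sum>i<m. a i * \<phi> i x) = (\<Sum>i<m. a i * L (\<phi> i))"
  defines "u \<equiv> (\<lambda>x\<in>cube d. \<Sum>i<m. L (\<phi> i) * \<phi> i x)"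
  shows "u \<in> fspan d g n" and "v \<in> fspan d g n \<Longrightarrow> rk_inner d \<rho> u v = L v"
    and "w \<in> fspan d g n \<Longrightarrow> (\<And>v. v \<in> fspan d g n \<Longrightarrow> rk_inner d \<rho> w v = L v) \<Longrightarrow> w = u"
proof -
  note D = onb[unfolded onb_def]
  have \<phi>: "\<phi> i \<in> fspan d g n" if "i < m" for i using D that by blast
  have \<phi>H: "\<phi> i \<in> rk_space d \<rho>" if "i < m" for i by (rule fspan_mem[OF g \<phi>[OF that]])
  have expand: "v = (\<lambda>x\<in>cube d. \<Sum>i<m. rk_inner d \<rho> v (\<phi> i) * \<phi> i x)" if "v \<in> fspan d g n" for v
  proof -
    have "v = restrict v (cube d)" using fspan_restrict[OF that] by simp
    also have "\<dots> = (\<lambda>x\<in>cube d. \<Sum>i<m. rk_inner d \<rho> v (\<phi> i) * \<phi> i x)"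
      by (rule restrict_ext) (use D that in blast)
    finally show ?thesis .
  qed
  show u: "u \<in> fspan d g n" unfolding u_def by (rule fspan_lincomb) (use \<phi> in auto)
  have *: "rk_inner d \<rho> u v = L v" if v: "v \<in> fspan d g n" for v
  proof -
    have vH: "v \<in> rk_space d \<rho>" by (rule fspan_mem[OF g v])
    have "rk_inner d \<rho> u v = rk_inner d \<rho> (\<lambda>x. \<Sum>i<m. L (\<phi> i) * \<phi> i x) v"
      by (rule rk_inner_cong) (auto simp: u_def)
    also have "\<dots> = (\<Sum>i<m. L (\<phi> i) * rk_inner d \<rho> (\<phi> i) v)"
      by (rule sum_mem) (use \<phi>H vH in auto)
    also have "\<dots> = (\<Sum>i<m. rk_inner d \<rho> v (\<phi> i) * L (\<phi> i))"
      by (rule sum.cong) (auto simp: inner_sym[of v])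
    also have "\<dots> = L v" using L[of "\<lambda>i. rk_inner d \<rho> v (\<phi> i)"] expand[OF v] by simp
    finally show ?thesis .
  qed
  then show "v \<in> fspan d g n \<Longrightarrow> rk_inner d \<rho> u v = L v" .
  assume w: "w \<in> fspan d g n" and wL: "\<And>v. v \<in> fspan d g n \<Longrightarrow> rk_inner d \<rho> w v = L v"
  have "w = (\<lambda>x\<in>cube d. \<Sum>i<m. rk_inner d \<rho> w (\<phi> i) * \<phi> i x)" by (rule expand[OF w])
  also have "\<dots> = u" unfolding u_def by (rule restrict_ext) (simp add: wL \<phi>)
  finally show "w = u" .
qed

section \<open>Parseval's identity\<close>

lemma sup_bound:
  assumes "u \<in> rk_space d \<rho>" "x \<in> cube d"
  shows "\<bar>u x\<bar> \<le> (\<Sum>\<^sub>\<infinity>h\<in>freqs d. cmod (fcoeff d u h))"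
proof -
  have s: "(\<lambda>h. cmod (fcoeff d u h * echar d h x)) summable_on freqs d"
    using abs_summ[OF rkD(2)[OF assms(1)]] by (simp add: norm_mult)
  have "complex_of_real (u x) = (\<Sum>\<^sub>\<infinity>h\<in>freqs d. fcoeff d u h * echar d h x)"
    using rkD(3)[OF assms] by (simp add: infsumI)
  then have "\<bar>u x\<bar> = cmod (\<Sum>\<^sub>\<infinity>h\<in>freqs d. fcoeff d u h * echar d h x)" by (metis norm_of_real)
  also have "\<dots> \<le> (\<Sum>\<^sub>\<infinity>h\<in>freqs d. cmod (fcoeff d u h * echar d h x))"
    by (rule norm_infsum_bound[OF s])
  finally show ?thesis by (simp add: norm_mult)
qed

lemma l2_integrable:
  assumes u: "u \<in> rk_space d \<rho>" and v: "v \<in> rk_space d \<rho>"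
  shows "integrable (cube_measure d) (\<lambda>x. u x * v x)"
proof -
  interpret prob_space "cube_measure d" by (rule prob_cube)
  have "u \<in> borel_measurable (cube_measure d)" "v \<in> borel_measurable (cube_measure d)"
    using rkD(1)[OF u] rkD(1)[OF v] by auto
  moreover have "AE x in cube_measure d. norm (u x * v x) \<le>
      (\<Sum>\<^sub>\<infinity>h\<in>freqs d. cmod (fcoeff d u h)) * (\<Sum>\<^sub>\<infinity>h\<in>freqs d. cmod (fcoeff d v h))"
    using sup_bound[OF u] sup_bound[OF v]
    by (intro AE_I2) (auto simp: space_cube_measure abs_mult intro!: mult_mono order_trans[OF abs_ge_zero])
  ultimately show ?thesis by (intro integrable_const_bound) auto
qed

text \<open>
  The Fourier series of \<open>u\<close> converges absolutely and uniformly and \<open>v\<close> is bounded, so \<open>u * v\<close> may be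
  integrated term by term.
\<close>

lemma parseval:
  assumes u: "u \<in> rk_space d \<rho>" and v: "v \<in> rk_space d \<rho>"
  shows "((\<lambda>h. fcoeff d u h * cnj (fcoeff d v h)) has_sum complex_of_real (l2_inner d u v)) (freqs d)"
proof -
  interpret prob_space "cube_measure d" by (rule prob_cube)
  let ?f = "\<lambda>h x. fcoeff d u h * echar d h x * complex_of_real (v x)"
  let ?B = "\<Sum>\<^sub>\<infinity>h\<in>freqs d. cmod (fcoeff d v h)"
  have vm: "v \<in> borel_measurable (cube_measure d)" using rkD(1)[OF v] by auto
  have "((\<lambda>h. \<integral>x. ?f h x \<partial>cube_measure d) has_sum
      (\<integral>x. (\<Sum>\<^sub>\<infinity>h\<in>freqs d. ?f h x) \<partial>cube_measure d)) (freqs d)"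
  proof (rule has_sum_integral(1)[OF finite_measure_axioms countable_freqs])
    show "?f h \<in> borel_measurable (cube_measure d)" for h using vm by measurable
    show "norm (?f h x) \<le> cmod (fcoeff d u h) * ?B" if "x \<in> space (cube_measure d)" for h x
      using sup_bound[OF v] that by (auto simp: norm_mult space_cube_measure intro!: mult_left_mono)
    show "(\<lambda>h. cmod (fcoeff d u h) * ?B) summable_on freqs d"
      by (rule summable_on_cmult_left[OF abs_summ[OF rkD(2)[OF u]]])
  qed
  moreover have "(\<integral>x. ?f h x \<partial>cube_measure d) = fcoeff d u h * cnj (fcoeff d v h)" for h
  proof -
    have "cnj (fcoeff d v h) = (\<integral>x. cnj (complex_of_real (v x) * cnj (echar d h x)) \<partial>cube_measure d)"
      unfolding fcoeff_echar by (rule Bochner_Integration.integral_cnj[symmetric])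
    also have "\<dots> = (\<integral>x. echar d h x * complex_of_real (v x) \<partial>cube_measure d)"
      by (rule Bochner_Integration.integral_cong) (auto simp: mult.commute)
    finally show ?thesis by (simp add: mult.assoc)
  qed
  moreover have "(\<integral>x. (\<Sum>\<^sub>\<infinity>h\<in>freqs d. ?f h x) \<partial>cube_measure d) = complex_of_real (l2_inner d u v)"
  proof -
    have "(\<Sum>\<^sub>\<infinity>h\<in>freqs d. ?f h x) = complex_of_real (u x * v x)" if "x \<in> cube d" for x
      using infsumI[OF has_sum_cmult_left[OF rkD(3)[OF u that], of "complex_of_real (v x)"]] by simp
    then have "(\<integral>x. (\<Sum>\<^sub>\<infinity>h\<in>freqs d. ?f h x) \<partial>cube_measure d) = (\<integral>x. complex_of_real (u x * v x) \<partial>cube_measure d)"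
      by (intro Bochner_Integration.integral_cong) (auto simp: space_cube_measure)
    then show ?thesis by (simp only: integral_complex_of_real l2_inner_def)
  qed
  ultimately show ?thesis by simp
qed

lemma l2_inner_lin:
  assumes "u \<in> rk_space d \<rho>" "v \<in> rk_space d \<rho>" "w \<in> rk_space d \<rho>"
  shows "l2_inner d (\<lambda>x. a * u x + b * v x) w = a * l2_inner d u w + b * l2_inner d v w"
proof -
  have "l2_inner d (\<lambda>x. a * u x + b * v x) w = (\<integral>x. a * (u x * w x) + b * (v x * w x) \<partial>cube_measure d)"
    unfolding l2_inner_def by (rule Bochner_Integration.integral_cong) (auto simp: algebra_simps)
  also have "\<dots> = a * l2_inner d u w + b * l2_inner d v w"
    unfolding l2_inner_def using l2_integrable[OF assms(1,3)] l2_integrable[OF assms(2,3)] by simp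
  finally show ?thesis .
qed

lemma l2_self:
  assumes u: "u \<in> rk_space d \<rho>"
  shows "((\<lambda>h. (cmod (fcoeff d u h))\<^sup>2) has_sum l2_inner d u u) (freqs d)"
proof -
  have "((\<lambda>h. complex_of_real ((cmod (fcoeff d u h))\<^sup>2)) has_sum complex_of_real (l2_inner d u u)) (freqs d)"
    using parseval[OF u u] by (simp only: complex_norm_square)
  then show ?thesis by (simp only: has_sum_of_real_iff)
qed

end

lemma l2_inner_sym: "l2_inner d u v = l2_inner d v u"
  by (simp add: l2_inner_def mult.commute)

section \<open>The regularised inner product\<close>

context tik
begin

text \<open>
  The weights of the form \<open>B\<close>. Together with \<open>rk_space_reg\<close> and \<open>rk_inner_reg\<close> below, the lemma
  \<open>tik_reg\<close> makes every fact on translation-invariant kernel spaces available for \<open>B\<close>.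
\<close>

definition reg :: "real \<Rightarrow> (nat \<Rightarrow> int) \<Rightarrow> real" where
  "reg lam h = 1 + lam * \<rho> h"

lemma tik_reg:
  assumes "lam > 0"
  shows "tik d (reg lam)"
proof
  fix h assume h: "h \<in> freqs d"
  show "reg lam h > 0" using pos[OF h] assms by (simp add: reg_def add_pos_pos)
  show "reg lam (fneg d h) = reg lam h" using even[OF h] by (simp add: reg_def)
next
  show "(\<lambda>h. 1 / reg lam h) summable_on freqs d"
  proof (rule summable_on_comparison_test[OF summable_on_cmult_right[OF summ, of "1 / lam"]])
    fix h assume h: "h \<in> freqs d"
    have "lam * \<rho> h > 0" using pos[OF h] assms by simp
    then show "1 / reg lam h \<le> 1 / lam * (1 / \<rho> h)" "0 \<le> 1 / reg lam h"
      by (auto simp: reg_def intro!: divide_left_mono)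
  qed
qed

lemma rk_space_reg:
  assumes lam: "lam > 0"
  shows "rk_space d (reg lam) = rk_space d \<rho>"
proof (intro subset_antisym subsetI)
  fix u assume u: "u \<in> rk_space d \<rho>"
  have "(\<lambda>h. (cmod (fcoeff d u h))\<^sup>2 + lam * (\<rho> h * (cmod (fcoeff d u h))\<^sup>2)) summable_on freqs d"
    by (intro summable_on_add summable_on_cmult_right rkD(2)[OF u] has_sum_imp_summable[OF l2_self[OF u]])
  then have "(\<lambda>h. reg lam h * (cmod (fcoeff d u h))\<^sup>2) summable_on freqs d"
    by (simp add: reg_def algebra_simps)
  then show "u \<in> rk_space d (reg lam)" using u by (auto simp: rk_space_def)
next
  fix u assume u: "u \<in> rk_space d (reg lam)"
  have "(\<lambda>h. \<rho> h * (cmod (fcoeff d u h))\<^sup>2) summable_on freqs d"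
  proof (rule summable_on_comparison_test[OF summable_on_cmult_right[of _ _ "1 / lam"]])
    show "(\<lambda>h. reg lam h * (cmod (fcoeff d u h))\<^sup>2) summable_on freqs d"
      using u by (auto simp: rk_space_def)
    fix h assume h: "h \<in> freqs d"
    show "0 \<le> \<rho> h * (cmod (fcoeff d u h))\<^sup>2" using pos[OF h] by simp
    show "\<rho> h * (cmod (fcoeff d u h))\<^sup>2 \<le> 1 / lam * (reg lam h * (cmod (fcoeff d u h))\<^sup>2)"
      using lam by (simp add: reg_def field_simps)
  qed
  then show "u \<in> rk_space d \<rho>" using u by (auto simp: rk_space_def)
qed

lemma rk_inner_reg:
  assumes u: "u \<in> rk_space d \<rho>" and v: "v \<in> rk_space d \<rho>"
  shows "rk_inner d (reg lam) u v = l2_inner d u v + lam * rk_inner d \<rho> u v"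
proof -
  let ?c = "\<lambda>h. fcoeff d u h * cnj (fcoeff d v h)" and ?t = "\<lambda>h. complex_of_real (\<rho> h) * fcoeff d u h * cnj (fcoeff d v h)"
  have "((\<lambda>h. ?c h + of_real lam * ?t h) has_sum (of_real (l2_inner d u v) + of_real lam * infsum ?t (freqs d))) (freqs d)"
    by (intro has_sum_add has_sum_cmult_right parseval u v has_sum_infsum prod_summ rkD)
  moreover have "complex_of_real (reg lam h) * fcoeff d u h * cnj (fcoeff d v h) = ?c h + of_real lam * ?t h" for h
    by (simp add: reg_def algebra_simps)
  ultimately have "(\<Sum>\<^sub>\<infinity>h\<in>freqs d. complex_of_real (reg lam h) * fcoeff d u h * cnj (fcoeff d v h)) =
      of_real (l2_inner d u v) + of_real lam * infsum ?t (freqs d)"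
    by (simp add: infsumI)
  then show ?thesis by (simp add: rk_inner_def)
qed

lemma kernel_diag:
  assumes "x \<in> cube d"
  shows "rk_kernel d \<rho> x x = (\<Sum>\<^sub>\<infinity>h\<in>freqs d. 1 / \<rho> h)"
proof -
  have "rk_kernel d \<rho> x x = Re (\<Sum>\<^sub>\<infinity>h\<in>freqs d. complex_of_real (1 / \<rho> h))"
    by (simp add: rk_kernel_def fdot_def)
  also have "\<dots> = (\<Sum>\<^sub>\<infinity>h\<in>freqs d. 1 / \<rho> h)"
    using infsumI[OF has_sum_of_real[OF has_sum_infsum[OF summ], where 'a=complex]] by simp
  finally show ?thesis .
qed

text \<open>
  The sum is the reproducing kernel of the span on the diagonal. It is dominated by the kernel \<open>K\<close> of the
  whole space because \<open>v = \<Sum> \<phi>\<^sub>i(y) \<phi>\<^sub>i\<close> is the orthogonal projection of \<open>K(y, \<cdot>)\<close>: the squared norm of the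
  remainder is \<open>K(y, y) - (\<Sum> \<phi>\<^sub>i(y)\<^sup>2)\<close>.
\<close>

lemma onb_diag_bound:
  assumes g: "\<And>k. k \<in> {1..n} \<Longrightarrow> g k \<in> rk_space d \<rho>" and onb: "onb d \<rho> (fspan d g n) m \<phi>"
    and y: "y \<in> cube d"
  shows "(\<Sum>i<m. (\<phi> i y)\<^sup>2) \<le> (\<Sum>\<^sub>\<infinity>h\<in>freqs d. 1 / \<rho> h)"
proof -
  note D = onb[unfolded onb_def]
  have \<phi>H: "\<phi> i \<in> rk_space d \<rho>" if "i < m" for i by (rule fspan_mem[OF g]) (use D that in auto)
  define K where "K = rk_kernel d \<rho> y"
  define v where "v x = (\<Sum>i<m. \<phi> i y * \<phi> i x)" for x
  define s where "s = (\<Sum>i<m. (\<phi> i y)\<^sup>2)"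
  have KH: "K \<in> rk_space d \<rho>" unfolding K_def by (rule kernel_mem)
  have vH: "v \<in> rk_space d \<rho>" unfolding v_def[abs_def] by (rule sum_mem) (use \<phi>H in auto)
  have vin: "rk_inner d \<rho> v w = (\<Sum>i<m. \<phi> i y * rk_inner d \<rho> (\<phi> i) w)" if "w \<in> rk_space d \<rho>" for w
    unfolding v_def[abs_def] by (rule sum_mem) (use \<phi>H that in auto)
  have "rk_inner d \<rho> v (\<phi> j) = \<phi> j y" if j: "j < m" for j
  proof -
    have "rk_inner d \<rho> v (\<phi> j) = (\<Sum>i<m. if i = j then \<phi> i y else 0)"
      unfolding vin[OF \<phi>H[OF j]] by (rule sum.cong) (use D j in auto)
    then show ?thesis using j by simp
  qed
  then have vv: "rk_inner d \<rho> v v = s"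
    unfolding vin[OF vH] s_def by (intro sum.cong) (auto simp: inner_sym[of _ v] power2_eq_square)
  have vK: "rk_inner d \<rho> v K = s"
    unfolding K_def reproducing[OF vH y] by (simp add: v_def s_def power2_eq_square)
  have KK: "rk_inner d \<rho> K K = (\<Sum>\<^sub>\<infinity>h\<in>freqs d. 1 / \<rho> h)"
    using reproducing[OF KH y] kernel_diag[OF y] by (simp add: K_def)
  have "0 \<le> rk_inner d \<rho> (\<lambda>x. K x - v x) (\<lambda>x. K x - v x)"
    by (rule inner_pos(1)[OF diff_mem[OF KH vH]])
  also have "\<dots> = rk_inner d \<rho> K (\<lambda>x. K x - v x) - rk_inner d \<rho> v (\<lambda>x. K x - v x)"
    by (rule inner_diff[OF KH vH diff_mem[OF KH vH]])
  also have "\<dots> = rk_inner d \<rho> K K - 2 * rk_inner d \<rho> v K + rk_inner d \<rho> v v"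
    unfolding inner_sym[of K "\<lambda>x. K x - v x"] inner_sym[of v "\<lambda>x. K x - v x"]
    by (simp add: inner_diff KH vH inner_sym[of K v])
  finally show ?thesis unfolding vv vK KK s_def by simp
qed

end

section \<open>Sample means\<close>

text \<open>
  Centred independent variables are uncorrelated, so only the \<open>n\<close> diagonal terms of the squared sum
  survive; the variance is bounded by the second moment \<open>q\<close>.
\<close>

lemma mean_square_error_sample_mean:
  fixes X :: "nat \<Rightarrow> 'w \<Rightarrow> real"
  assumes "prob_space P" and n: "n \<ge> 1" and indep: "prob_space.indep_vars P (\<lambda>_. borel) X {1..n}"
    and bd: "\<And>j \<omega>. j \<in> {1..n} \<Longrightarrow> \<omega> \<in> space P \<Longrightarrow> \<bar>X j \<omega>\<bar> \<le> B"
    and mean: "\<And>j. j \<in> {1..n} \<Longrightarrow> (\<integral>\<omega>. X j \<omega> \<partial>P) = b"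
    and sq: "\<And>j. j \<in> {1..n} \<Longrightarrow> (\<integral>\<omega>. (X j \<omega>)\<^sup>2 \<partial>P) = q"
  shows "integrable P (\<lambda>\<omega>. ((\<Sum>j=1..n. X j \<omega>) / real n - b)\<^sup>2)"
    and "(\<integral>\<omega>. ((\<Sum>j=1..n. X j \<omega>) / real n - b)\<^sup>2 \<partial>P) \<le> q / real n"
proof -
  interpret prob_space P by fact
  have Xm: "X j \<in> borel_measurable P" if "j \<in> {1..n}" for j
    using indep that by (auto simp: indep_vars_def)
  define Z where "Z j \<omega> = X j \<omega> - b" for j \<omega>
  have Zm: "Z j \<in> borel_measurable P" if "j \<in> {1..n}" for j
    unfolding Z_def[abs_def] using Xm[OF that] by simp
  have Zb: "\<bar>Z j \<omega>\<bar> \<le> B + \<bar>b\<bar>" if "j \<in> {1..n}" "\<omega> \<in> space P" for j \<omega>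
    using bd[OF that] by (simp add: Z_def)
  have int: "integrable P (X j)" if "j \<in> {1..n}" for j
    by (rule integrable_const_bound[where B=B]) (use bd Xm that in auto)
  have intsq: "integrable P (\<lambda>\<omega>. (X j \<omega>)\<^sup>2)" if "j \<in> {1..n}" for j
    by (rule integrable_const_bound[where B="B\<^sup>2"]) (use bd Xm that in \<open>auto simp: abs_le_square_iff[symmetric] intro!: abs_le_square_iff[THEN iffD1] order_trans[OF _ abs_ge_self]\<close>)
  have intZ: "integrable P (\<lambda>\<omega>. Z i \<omega> * Z j \<omega>)" if "i \<in> {1..n}" "j \<in> {1..n}" for i j
  proof (rule integrable_const_bound[where B="(B + \<bar>b\<bar>) * (B + \<bar>b\<bar>)"])
    show "AE \<omega> in P. norm (Z i \<omega> * Z j \<omega>) \<le> (B + \<bar>b\<bar>) * (B + \<bar>b\<bar>)"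
      using Zb that by (intro AE_I2) (auto simp: abs_mult intro!: mult_mono order_trans[OF abs_ge_zero])
  qed (use Zm that in auto)
  have Zmean: "expectation (Z j) = 0" if "j \<in> {1..n}" for j
    unfolding Z_def[abs_def] using int[OF that] mean[OF that] by (simp add: prob_space)
  have indZ: "indep_vars (\<lambda>_. borel) Z {1..n}"
    unfolding Z_def[abs_def] using indep_vars_compose2[OF indep, of "\<lambda>_ x. x - b" "\<lambda>_. borel"] by simp
  have cross: "expectation (\<lambda>\<omega>. Z i \<omega> * Z j \<omega>) = (if i = j then q - b\<^sup>2 else 0)"
    if ij: "i \<in> {1..n}" "j \<in> {1..n}" for i j
  proof (cases "i = j")
    case True
    have "expectation (\<lambda>\<omega>. Z i \<omega> * Z j \<omega>) = expectation (\<lambda>\<omega>. (X i \<omega>)\<^sup>2 - (2 * b * X i \<omega> - b\<^sup>2))"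
      using True by (intro Bochner_Integration.integral_cong) (auto simp: Z_def power2_eq_square algebra_simps)
    also have "\<dots> = q - (2 * b * b - b\<^sup>2)"
      using int[OF ij(1)] intsq[OF ij(1)] mean[OF ij(1)] sq[OF ij(1)] by (simp add: prob_space)
    finally show ?thesis using True by (simp add: power2_eq_square)
  next
    case False
    have "indep_vars (\<lambda>_. borel) Z {i, j}" by (rule indep_vars_subset[OF indZ]) (use ij in auto)
    moreover have "integrable P (Z k)" if "k \<in> {i, j}" for k
      unfolding Z_def[abs_def] using int that ij by auto
    ultimately have "expectation (\<lambda>\<omega>. \<Prod>k\<in>{i, j}. Z k \<omega>) = (\<Prod>k\<in>{i, j}. expectation (Z k))"
      by (intro indep_vars_lebesgue_integral) auto
    then show ?thesis using False Zmean ij by simp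
  qed
  have eq: "((\<Sum>j=1..n. X j \<omega>) / real n - b)\<^sup>2 = (\<Sum>i=1..n. \<Sum>j=1..n. Z i \<omega> * Z j \<omega>) / (real n)\<^sup>2" for \<omega>
  proof -
    have "(\<Sum>j=1..n. X j \<omega>) / real n - b = (\<Sum>j=1..n. Z j \<omega>) / real n"
      using n by (simp add: Z_def sum_subtractf field_simps)
    then show ?thesis by (simp add: power_divide power2_eq_square[of "sum _ _"] sum_product)
  qed
  show "integrable P (\<lambda>\<omega>. ((\<Sum>j=1..n. X j \<omega>) / real n - b)\<^sup>2)"
    unfolding eq by (intro integrable_divide Bochner_Integration.integrable_sum intZ)
  have "expectation (\<lambda>\<omega>. \<Sum>i=1..n. \<Sum>j=1..n. Z i \<omega> * Z j \<omega>) =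
      (\<Sum>i=1..n. expectation (\<lambda>\<omega>. \<Sum>j=1..n. Z i \<omega> * Z j \<omega>))"
    by (intro Bochner_Integration.integral_sum Bochner_Integration.integrable_sum intZ)
  also have "\<dots> = (\<Sum>i=1..n. \<Sum>j=1..n. expectation (\<lambda>\<omega>. Z i \<omega> * Z j \<omega>))"
    by (intro sum.cong refl Bochner_Integration.integral_sum intZ)
  finally have "(\<integral>\<omega>. ((\<Sum>j=1..n. X j \<omega>) / real n - b)\<^sup>2 \<partial>P) =
      (\<Sum>i=1..n. \<Sum>j=1..n. expectation (\<lambda>\<omega>. Z i \<omega> * Z j \<omega>)) / (real n)\<^sup>2"
    unfolding eq by simp
  also have "(\<Sum>i=1..n. \<Sum>j=1..n. expectation (\<lambda>\<omega>. Z i \<omega> * Z j \<omega>)) =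
      (\<Sum>i=1..n. \<Sum>j=1..n. if i = j then q - b\<^sup>2 else 0)"
    by (intro sum.cong refl cross)
  also have "\<dots> = real n * (q - b\<^sup>2)" by simp
  also have "\<dots> / (real n)\<^sup>2 \<le> q / real n"
  proof -
    have "real n * (q - b\<^sup>2) / (real n)\<^sup>2 = (q - b\<^sup>2) / real n" using n by (simp add: power2_eq_square)
    then show ?thesis using n by (simp add: divide_right_mono)
  qed
  finally show "(\<integral>\<omega>. ((\<Sum>j=1..n. X j \<omega>) / real n - b)\<^sup>2 \<partial>P) \<le> q / real n" .
qed

section \<open>Interpolant, estimator and their deterministic error\<close>

context tik
begin

lemma inner_diff_sq:
  assumes "u \<in> rk_space d \<rho>" "v \<in> rk_space d \<rho>"
  shows "rk_inner d \<rho> (\<lambda>x. u x - v x) (\<lambda>x. u x - v x) =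
    rk_inner d \<rho> u u - 2 * rk_inner d \<rho> u v + rk_inner d \<rho> v v"
proof -
  have "rk_inner d \<rho> (\<lambda>x. u x - v x) (\<lambda>x. u x - v x) =
      rk_inner d \<rho> u (\<lambda>x. u x - v x) - rk_inner d \<rho> v (\<lambda>x. u x - v x)"
    by (rule inner_diff) (use assms diff_mem in auto)
  then show ?thesis
    unfolding inner_sym[of u "\<lambda>x. u x - v x"] inner_sym[of v "\<lambda>x. u x - v x"]
    by (simp add: inner_diff assms inner_sym[of v u])
qed

lemma l2_inner_diff:
  "u \<in> rk_space d \<rho> \<Longrightarrow> v \<in> rk_space d \<rho> \<Longrightarrow> w \<in> rk_space d \<rho> \<Longrightarrow>
    l2_inner d (\<lambda>x. u x - v x) w = l2_inner d u w - l2_inner d v w"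
  using l2_inner_lin[of u v w 1 "-1"] by simp

lemma l2_diff_sq:
  assumes "u \<in> rk_space d \<rho>" "v \<in> rk_space d \<rho>"
  shows "l2_inner d (\<lambda>x. u x - v x) (\<lambda>x. u x - v x) =
    l2_inner d u u - 2 * l2_inner d u v + l2_inner d v v"
proof -
  have "l2_inner d (\<lambda>x. u x - v x) (\<lambda>x. u x - v x) =
      l2_inner d u (\<lambda>x. u x - v x) - l2_inner d v (\<lambda>x. u x - v x)"
    by (rule l2_inner_diff) (use assms diff_mem in auto)
  then show ?thesis
    unfolding l2_inner_sym[of d u "\<lambda>x. u x - v x"] l2_inner_sym[of d v "\<lambda>x. u x - v x"]
    by (simp add: l2_inner_diff assms l2_inner_sym[of d v u])
qed

text \<open>
  The factor 1/4 matters: in \<open>bias_smooth\<close> two such terms are absorbed into \<open>l2_inner d v v\<close>.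
\<close>

lemma l2_young:
  assumes "u \<in> rk_space d \<rho>" "v \<in> rk_space d \<rho>"
  shows "l2_inner d u v \<le> l2_inner d u u + l2_inner d v v / 4"
proof -
  have "l2_inner d u v \<le> (\<integral>x. u x * u x + v x * v x / 4 \<partial>cube_measure d)"
    unfolding l2_inner_def
  proof (rule integral_mono)
    show "u x * v x \<le> u x * u x + v x * v x / 4" for x
      using zero_le_power2[of "u x - v x / 2"] by (simp add: power2_eq_square algebra_simps)
  qed (use assms l2_integrable in auto)
  then show ?thesis using assms l2_integrable by (simp add: l2_inner_def)
qed

lemma l2_diff_sq_le:
  assumes "u \<in> rk_space d \<rho>" "v \<in> rk_space d \<rho>"
  shows "l2_inner d (\<lambda>x. u x - v x) (\<lambda>x. u x - v x) \<le> 2 * l2_inner d u u + 2 * l2_inner d v v"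
proof -
  have "l2_inner d (\<lambda>x. u x - v x) (\<lambda>x. u x - v x) \<le>
      (\<integral>x. 2 * (u x * u x) + 2 * (v x * v x) \<partial>cube_measure d)"
    unfolding l2_inner_def
  proof (rule integral_mono)
    show "(u x - v x) * (u x - v x) \<le> 2 * (u x * u x) + 2 * (v x * v x)" for x
      using zero_le_power2[of "u x + v x"] by (simp add: power2_eq_square algebra_simps)
  qed (use assms diff_mem l2_integrable in auto)
  then show ?thesis using assms l2_integrable by (simp add: l2_inner_def)
qed

lemma l2_sum:
  assumes "finite I" "\<And>i. i \<in> I \<Longrightarrow> \<phi> i \<in> rk_space d \<rho>" "w \<in> rk_space d \<rho>"
  shows "l2_inner d (\<lambda>x. \<Sum>i\<in>I. a i * \<phi> i x) w = (\<Sum>i\<in>I. a i * l2_inner d (\<phi> i) w)"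
proof -
  have "l2_inner d (\<lambda>x. \<Sum>i\<in>I. a i * \<phi> i x) w = (\<integral>x. (\<Sum>i\<in>I. a i * (\<phi> i x * w x)) \<partial>cube_measure d)"
    by (simp add: l2_inner_def sum_distrib_right mult.assoc)
  also have "\<dots> = (\<Sum>i\<in>I. a i * l2_inner d (\<phi> i) w)"
    using assms l2_integrable by (subst Bochner_Integration.integral_sum) (auto simp: l2_inner_def)
  finally show ?thesis .
qed

lemma lattice_span_mem: "v \<in> lattice_span d \<rho> N z \<Longrightarrow> v \<in> rk_space d \<rho>"
  unfolding lattice_span_fspan by (rule fspan_mem[OF kernel_mem(1)])

lemma interpolant_props:
  assumes f: "f \<in> rk_space d \<rho>"
  shows "interpolant d \<rho> N z f \<in> lattice_span d \<rho> N z"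
    and "v \<in> lattice_span d \<rho> N z \<Longrightarrow> rk_inner d \<rho> (interpolant d \<rho> N z f) v = rk_inner d \<rho> f v"
proof -
  define g where "g k = rk_kernel d \<rho> (lattice_pt d N z k)" for k
  have V: "lattice_span d \<rho> N z = fspan d g N" by (simp add: lattice_span_fspan g_def[abs_def])
  have g: "g k \<in> rk_space d \<rho>" for k unfolding g_def by (rule kernel_mem)
  obtain m \<phi> where onb: "onb d \<rho> (fspan d g N) m \<phi>" using onb_exists[of N g] g by blast
  have \<phi>: "\<phi> i \<in> rk_space d \<rho>" if "i < m" for i
    by (rule fspan_mem[OF g]) (use onb that in \<open>auto simp: onb_def\<close>)
  define L where "L v = rk_inner d \<rho> f v" for v
  have L: "L (\<lambda>x\<in>cube d. \<Sum>i<m. a i * \<phi> i x) = (\<Sum>i<m. a i * L (\<phi> i))" for a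
  proof -
    have "L (\<lambda>x\<in>cube d. \<Sum>i<m. a i * \<phi> i x) = rk_inner d \<rho> f (\<lambda>x. \<Sum>i<m. a i * \<phi> i x)"
      unfolding L_def by (rule rk_inner_cong) auto
    also have "\<dots> = (\<Sum>i<m. a i * rk_inner d \<rho> (\<phi> i) f)"
      unfolding inner_sym[of f] by (rule sum_mem) (use \<phi> f in auto)
    finally show ?thesis by (simp add: L_def inner_sym[of f])
  qed
  note R = onb_riesz[OF g onb, of L, OF L]
  have orth: "rk_inner d \<rho> (\<lambda>x. f x - w x) v = 0 \<longleftrightarrow> rk_inner d \<rho> w v = L v"
    if "w \<in> fspan d g N" "v \<in> fspan d g N" for v w
    using inner_diff[OF f fspan_mem[OF g that(1)] fspan_mem[OF g that(2)]] by (auto simp: L_def)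
  define u where "u = (\<lambda>x\<in>cube d. \<Sum>i<m. L (\<phi> i) * \<phi> i x)"
  have uV: "u \<in> fspan d g N" unfolding u_def by (rule R(1))
  have uL: "rk_inner d \<rho> u v = L v" if "v \<in> fspan d g N" for v
    unfolding u_def by (rule R(2)[OF that])
  have "interpolant d \<rho> N z f = u"
    unfolding interpolant_def V
  proof (rule the_equality)
    show "u \<in> fspan d g N \<and> (\<forall>v\<in>fspan d g N. rk_inner d \<rho> (\<lambda>x. f x - u x) v = 0)"
      using uV uL orth by blast
    show "w = u" if "w \<in> fspan d g N \<and> (\<forall>v\<in>fspan d g N. rk_inner d \<rho> (\<lambda>x. f x - w x) v = 0)" for w
      unfolding u_def by (rule R(3)) (use that orth in auto)
  qed
  then show "interpolant d \<rho> N z f \<in> lattice_span d \<rho> N z"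
    and "v \<in> lattice_span d \<rho> N z \<Longrightarrow> rk_inner d \<rho> (interpolant d \<rho> N z f) v = rk_inner d \<rho> f v"
    using uV uL[of v] by (auto simp: V L_def)
qed

lemma estimator_onb:
  assumes lam: "lam > 0" and onb: "onb d (reg lam) (lattice_span d \<rho> N z) m \<phi>"
    and y: "\<And>j. j \<in> {1..M} \<Longrightarrow> y j \<in> cube d"
  shows "estimator d \<rho> N z M lam y = (\<lambda>x\<in>cube d. \<Sum>i<m. (\<Sum>j=1..M. \<phi> i (y j)) / real M * \<phi> i x)"
proof -
  interpret R: tik d "reg lam" by (rule tik_reg[OF lam])
  define g where "g k = rk_kernel d \<rho> (lattice_pt d N z k)" for k
  have V: "lattice_span d \<rho> N z = fspan d g N" by (simp add: lattice_span_fspan g_def[abs_def])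
  have g: "g k \<in> rk_space d (reg lam)" for k unfolding g_def rk_space_reg[OF lam] by (rule kernel_mem)
  define L where "L v = (\<Sum>j=1..M. v (y j)) / real M" for v
  have L: "L (\<lambda>x\<in>cube d. \<Sum>i<m. a i * \<phi> i x) = (\<Sum>i<m. a i * L (\<phi> i))" for a
  proof -
    have "L (\<lambda>x\<in>cube d. \<Sum>i<m. a i * \<phi> i x) = (\<Sum>j=1..M. \<Sum>i<m. a i * \<phi> i (y j)) / real M"
      using y by (simp add: L_def)
    also have "\<dots> = (\<Sum>i<m. a i * L (\<phi> i))"
      by (subst sum.swap) (simp add: L_def sum_divide_distrib sum_distrib_left)
    finally show ?thesis .
  qed
  note Riesz = R.onb_riesz[OF g onb[unfolded V], of L, OF L]
  have form: "l2_inner d w v + lam * rk_inner d \<rho> w v = rk_inner d (reg lam) w v"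
    if "w \<in> fspan d g N" "v \<in> fspan d g N" for v w
    using rk_inner_reg[of w v lam] that lattice_span_mem[of _ N z, unfolded V] by simp
  show ?thesis
    unfolding estimator_def V L_def[symmetric]
  proof (rule the_equality)
    let ?u = "\<lambda>x\<in>cube d. \<Sum>i<m. L (\<phi> i) * \<phi> i x"
    show "?u \<in> fspan d g N \<and> (\<forall>v\<in>fspan d g N. l2_inner d ?u v + lam * rk_inner d \<rho> ?u v = L v)"
      using Riesz(1,2) form by simp
    show "w = ?u" if "w \<in> fspan d g N \<and> (\<forall>v\<in>fspan d g N. l2_inner d w v + lam * rk_inner d \<rho> w v = L v)" for w
      by (rule Riesz(3)) (use that form in auto)
  qed
qed

text \<open>
  This is the population version of the estimator, with the empirical mean replaced by the integral
  against \<open>f\<close>; it will be the mean of the estimator.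
\<close>

lemma ridge_projection:
  assumes lam: "lam > 0" and onb: "onb d (reg lam) (lattice_span d \<rho> N z) m \<phi>"
    and f: "f \<in> rk_space d \<rho>"
  defines "u \<equiv> (\<lambda>x\<in>cube d. \<Sum>i<m. l2_inner d f (\<phi> i) * \<phi> i x)"
  shows "u \<in> lattice_span d \<rho> N z"
    and "v \<in> lattice_span d \<rho> N z \<Longrightarrow> l2_inner d u v + lam * rk_inner d \<rho> u v = l2_inner d f v"
proof -
  interpret R: tik d "reg lam" by (rule tik_reg[OF lam])
  define g where "g k = rk_kernel d \<rho> (lattice_pt d N z k)" for k
  have V: "lattice_span d \<rho> N z = fspan d g N" by (simp add: lattice_span_fspan g_def[abs_def])
  have g: "g k \<in> rk_space d (reg lam)" for k unfolding g_def rk_space_reg[OF lam] by (rule kernel_mem)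
  have \<phi>: "\<phi> i \<in> rk_space d \<rho>" if "i < m" for i
    by (rule lattice_span_mem) (use onb that in \<open>auto simp: onb_def\<close>)
  have L: "l2_inner d f (\<lambda>x\<in>cube d. \<Sum>i<m. a i * \<phi> i x) = (\<Sum>i<m. a i * l2_inner d f (\<phi> i))" for a
  proof -
    have "l2_inner d f (\<lambda>x\<in>cube d. \<Sum>i<m. a i * \<phi> i x) = l2_inner d f (\<lambda>x. \<Sum>i<m. a i * \<phi> i x)"
      by (rule l2_inner_cong) auto
    also have "\<dots> = (\<Sum>i<m. a i * l2_inner d (\<phi> i) f)"
      unfolding l2_inner_sym[of d f] by (rule l2_sum) (use \<phi> f in auto)
    finally show ?thesis by (simp add: l2_inner_sym[of d f])
  qed
  note Riesz = R.onb_riesz[OF g onb[unfolded V], of "l2_inner d f", OF L]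
  show u: "u \<in> lattice_span d \<rho> N z" unfolding V u_def by (rule Riesz)
  assume v: "v \<in> lattice_span d \<rho> N z"
  show "l2_inner d u v + lam * rk_inner d \<rho> u v = l2_inner d f v"
    using Riesz(2)[of v] v rk_inner_reg[OF lattice_span_mem[OF u] lattice_span_mem[OF v], of lam]
    by (simp add: V u_def)
qed

text \<open>
  The hypotheses on \<open>u\<close> are the normal equations \<open>B(u, v) = \<langle>f, v\<rangle>\<close> for \<open>v = u\<close> and \<open>v = w\<close>; they make
  \<open>u\<close> at least as good as \<open>w\<close> for the regularised least squares functional. By \<open>ww\<close>, the function \<open>w\<close> is an orthogonal projection of \<open>f\<close> for the kernel inner product, so its penalty is at most that of \<open>f\<close>.
\<close>

lemma bias_energy:
  assumes lam: "lam > 0" and f: "f \<in> rk_space d \<rho>" and u: "u \<in> rk_space d \<rho>" and w: "w \<in> rk_space d \<rho>"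
    and uu: "l2_inner d u u + lam * rk_inner d \<rho> u u = l2_inner d f u"
    and uw: "l2_inner d u w + lam * rk_inner d \<rho> u w = l2_inner d f w"
    and ww: "rk_inner d \<rho> w w = rk_inner d \<rho> f w"
  shows "l2_inner d (\<lambda>x. f x - u x) (\<lambda>x. f x - u x) \<le>
    l2_inner d (\<lambda>x. f x - w x) (\<lambda>x. f x - w x) + lam * rk_inner d \<rho> f f"
proof -
  let ?K = "rk_inner d \<rho>"
  have "0 \<le> ?K (\<lambda>x. f x - w x) (\<lambda>x. f x - w x)" by (rule inner_pos(1)[OF diff_mem[OF f w]])
  then have "?K w w \<le> ?K f f" using inner_diff_sq[OF f w] ww by simp
  then have 1: "lam * ?K w w \<le> lam * ?K f f" using lam by simp
  have "0 \<le> ?K (\<lambda>x. w x - u x) (\<lambda>x. w x - u x)" by (rule inner_pos(1)[OF diff_mem[OF w u]])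
  then have "0 \<le> ?K w w - 2 * ?K u w + ?K u u" using inner_diff_sq[OF w u] inner_sym[of w u] by simp
  then have "0 \<le> lam * (?K w w - 2 * ?K u w + ?K u u)" using lam by simp
  then have 2: "0 \<le> lam * ?K w w - 2 * (lam * ?K u w) + lam * ?K u u" by (simp add: algebra_simps)
  have 3: "0 \<le> lam * ?K u u" using lam inner_pos(1)[OF u] by simp
  have 4: "0 \<le> l2_inner d w w - 2 * l2_inner d u w + l2_inner d u u"
    using l2_diff_sq[OF w u] l2_inner_nonneg[of d "\<lambda>x. w x - u x"] l2_inner_sym[of d w u] by simp
  show ?thesis unfolding l2_diff_sq[OF f u] l2_diff_sq[OF f w]
    using 1 2 3 4 uu uw by linarith
qed

text \<open>
  The kernel inner product with \<open>f\<close> is the \<open>L\<^sup>2\<close> inner product with the function with Fourier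
  coefficients \<open>\<rho> h * fcoeff d f h\<close>. No sign is imposed on \<open>lam\<close>, as it is applied with a negative one.
\<close>

lemma inner_young:
  assumes f: "f \<in> rk_space d \<rho>" "(\<lambda>h. (\<rho> h)\<^sup>2 * (cmod (fcoeff d f h))\<^sup>2) summable_on freqs d"
    and v: "v \<in> rk_space d \<rho>"
  shows "lam * rk_inner d \<rho> f v \<le>
    lam\<^sup>2 * (\<Sum>\<^sub>\<infinity>h\<in>freqs d. (\<rho> h)\<^sup>2 * (cmod (fcoeff d f h))\<^sup>2) + l2_inner d v v / 4"
proof -
  let ?t = "\<lambda>h. complex_of_real (\<rho> h) * fcoeff d f h * cnj (fcoeff d v h)"
  have "(?t has_sum infsum ?t (freqs d)) (freqs d)"
    by (intro has_sum_infsum prod_summ rkD f v)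
  then have 1: "((\<lambda>h. lam * Re (?t h)) has_sum lam * rk_inner d \<rho> f v) (freqs d)"
    unfolding rk_inner_def by (intro has_sum_cmult_right has_sum_Re)
  have 2: "((\<lambda>h. lam\<^sup>2 * ((\<rho> h)\<^sup>2 * (cmod (fcoeff d f h))\<^sup>2) + (1 / 4) * (cmod (fcoeff d v h))\<^sup>2) has_sum
      (lam\<^sup>2 * (\<Sum>\<^sub>\<infinity>h\<in>freqs d. (\<rho> h)\<^sup>2 * (cmod (fcoeff d f h))\<^sup>2) + (1 / 4) * l2_inner d v v)) (freqs d)"
    by (intro has_sum_add has_sum_cmult_right has_sum_infsum f l2_self v)
  have "lam * rk_inner d \<rho> f v \<le>
      lam\<^sup>2 * (\<Sum>\<^sub>\<infinity>h\<in>freqs d. (\<rho> h)\<^sup>2 * (cmod (fcoeff d f h))\<^sup>2) + (1 / 4) * l2_inner d v v"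
  proof (rule has_sum_mono[OF 1 2])
    fix h
    define A where "A = \<bar>lam\<bar> * \<bar>\<rho> h\<bar> * cmod (fcoeff d f h)"
    define B where "B = cmod (fcoeff d v h)"
    have "lam * Re (?t h) \<le> \<bar>lam\<bar> * cmod (?t h)"
      by (rule order_trans[OF abs_ge_self], unfold abs_mult, rule mult_left_mono[OF abs_Re_le_cmod abs_ge_zero])
    also have "\<dots> = A * B" by (simp add: A_def B_def norm_mult)
    also have "\<dots> \<le> A\<^sup>2 + (1 / 4) * B\<^sup>2"
      using zero_le_power2[of "A - B / 2"] by (simp add: power2_diff power_divide)
    also have "A\<^sup>2 = lam\<^sup>2 * ((\<rho> h)\<^sup>2 * (cmod (fcoeff d f h))\<^sup>2)"
      by (simp add: A_def power_mult_distrib)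
    finally show "lam * Re (?t h) \<le> lam\<^sup>2 * ((\<rho> h)\<^sup>2 * (cmod (fcoeff d f h))\<^sup>2) + (1 / 4) * (cmod (fcoeff d v h))\<^sup>2"
      by (simp add: B_def)
  qed
  then show ?thesis by simp
qed

text \<open>
  Testing the equation for \<open>v = u - w\<close> with \<open>v\<close> itself gives
  \<open>B(v, v) = \<langle>f - w, v\<rangle> - lam * rk_inner d \<rho> f v\<close>, as \<open>w\<close> and \<open>f\<close> have the same kernel inner products with \<open>u\<close> and
  \<open>w\<close>. Young's inequality bounds both terms at the price of half of \<open>\<parallel>v\<parallel>\<^sup>2\<close>, so
  \<open>\<parallel>v\<parallel>\<^sup>2 \<le> 2 \<parallel>f - w\<parallel>\<^sup>2 + 2 F\<close>, with \<open>F\<close> the squared smooth norm times \<open>lam\<^sup>2\<close>; the constants 6 and 4 come from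
  \<open>\<parallel>f - u\<parallel>\<^sup>2 \<le> 2 \<parallel>f - w\<parallel>\<^sup>2 + 2 \<parallel>v\<parallel>\<^sup>2\<close>.
\<close>

lemma bias_smooth:
  assumes lam: "lam > 0" and f: "f \<in> rk_space d \<rho>" and u: "u \<in> rk_space d \<rho>" and w: "w \<in> rk_space d \<rho>"
    and f2: "(\<lambda>h. (\<rho> h)\<^sup>2 * (cmod (fcoeff d f h))\<^sup>2) summable_on freqs d"
    and uu: "l2_inner d u u + lam * rk_inner d \<rho> u u = l2_inner d f u"
    and uw: "l2_inner d u w + lam * rk_inner d \<rho> u w = l2_inner d f w"
    and ww: "rk_inner d \<rho> w w = rk_inner d \<rho> f w"
    and wu: "rk_inner d \<rho> w u = rk_inner d \<rho> f u"
  shows "l2_inner d (\<lambda>x. f x - u x) (\<lambda>x. f x - u x) \<le>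
    6 * l2_inner d (\<lambda>x. f x - w x) (\<lambda>x. f x - w x) +
    4 * (lam\<^sup>2 * (\<Sum>\<^sub>\<infinity>h\<in>freqs d. (\<rho> h)\<^sup>2 * (cmod (fcoeff d f h))\<^sup>2))"
proof -
  let ?K = "rk_inner d \<rho>" and ?I = "l2_inner d"
  define F where "F = lam\<^sup>2 * (\<Sum>\<^sub>\<infinity>h\<in>freqs d. (\<rho> h)\<^sup>2 * (cmod (fcoeff d f h))\<^sup>2)"
  define a where "a = (\<lambda>x. f x - w x)"
  define v where "v = (\<lambda>x. u x - w x)"
  have a: "a \<in> rk_space d \<rho>" unfolding a_def by (rule diff_mem[OF f w])
  have v: "v \<in> rk_space d \<rho>" unfolding v_def by (rule diff_mem[OF u w])
  have "(- lam) * ?K f v \<le> F + ?I v v / 4"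
    using inner_young[OF f f2 v, of "- lam"] by (simp add: F_def)
  moreover have "?K f v = ?K f u - ?K f w"
    unfolding v_def inner_sym[of f] by (rule inner_diff[OF u w f])
  ultimately have 1: "lam * ?K w w - lam * ?K u w \<le> F + ?I v v / 4"
    using ww wu inner_sym[of u w] by (simp add: right_diff_distrib)
  have "0 \<le> ?K v v" by (rule inner_pos(1)[OF v])
  then have "0 \<le> lam * (?K u u - 2 * ?K u w + ?K w w)"
    using inner_diff_sq[OF u w] lam by (simp add: v_def)
  then have 2: "0 \<le> lam * ?K w w - 2 * (lam * ?K u w) + lam * ?K u u" by (simp add: algebra_simps)
  have vv: "?I v v = ?I u u - 2 * ?I u w + ?I w w"
    unfolding v_def by (rule l2_diff_sq[OF u w])
  have "?I a v = ?I f v - ?I w v" unfolding a_def by (rule l2_inner_diff[OF f w v])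
  moreover have "?I v f = ?I u f - ?I w f" unfolding v_def by (rule l2_inner_diff[OF u w f])
  moreover have "?I v w = ?I u w - ?I w w" unfolding v_def by (rule l2_inner_diff[OF u w w])
  ultimately have av: "?I a v = ?I f u - ?I f w - ?I u w + ?I w w"
    using l2_inner_sym[of d v f] l2_inner_sym[of d v w] l2_inner_sym[of d u f] l2_inner_sym[of d w f]
    by simp
  have "?I v v \<le> 2 * ?I a a + 2 * F"
    using 1 2 l2_young[OF a v] uu uw vv av by linarith
  moreover have "?I (\<lambda>x. f x - u x) (\<lambda>x. f x - u x) \<le> 2 * ?I a a + 2 * ?I v v"
    using l2_diff_sq_le[OF a v] by (simp add: a_def v_def)
  ultimately show ?thesis by (simp add: a_def F_def)
qed

end

section \<open>The risk of the estimator\<close>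

context tik
begin

text \<open>
  Coefficients with respect to the basis separate randomness from space: those of the estimator are sample
  means \<open>c i\<close> with expectation \<open>b i\<close>. Hence the squared error is a quadratic polynomial in finitely many
  bounded random variables, which gives integrability, and the squared \<open>B\<close>-distance of the estimator from
  \<open>u\<close> is \<open>\<Sum> (c i - b i)\<^sup>2\<close>. Bounding the sum of the squared basis functions, and not each of them, keeps
  the estimate independent of \<open>m\<close>.
\<close>

lemma risk_decomposition:
  fixes P :: "'w measure" and Y :: "nat \<Rightarrow> 'w \<Rightarrow> nat \<Rightarrow> real"
  assumes lam: "lam > 0" and M: "M \<ge> 1" and dens: "prob_density d f" and f: "f \<in> rk_space d \<rho>"
    and iid: "iid_sample d f M P Y" and onb: "onb d (reg lam) (lattice_span d \<rho> N z) m \<phi>"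
  defines "u \<equiv> (\<lambda>x\<in>cube d. \<Sum>i<m. l2_inner d f (\<phi> i) * \<phi> i x)"
  shows "integrable P (sq_error d \<rho> N z M lam f Y)"
    and "(\<integral>\<omega>. sq_error d \<rho> N z M lam f Y \<omega> \<partial>P) \<le>
      2 * l2_inner d (\<lambda>x. f x - u x) (\<lambda>x. f x - u x) +
      2 * ((\<Sum>\<^sub>\<infinity>h\<in>freqs d. 1 / reg lam h) / real M)"
proof -
  interpret prob_space P using iid by (simp add: iid_sample_def)
  interpret R: tik d "reg lam" by (rule tik_reg[OF lam])
  define g where "g k = rk_kernel d \<rho> (lattice_pt d N z k)" for k
  have V: "lattice_span d \<rho> N z = fspan d g N" by (simp add: lattice_span_fspan g_def[abs_def])
  have g: "g k \<in> rk_space d (reg lam)" for k unfolding g_def rk_space_reg[OF lam] by (rule kernel_mem)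
  define \<kappa> where "\<kappa> = (\<Sum>\<^sub>\<infinity>h\<in>freqs d. 1 / reg lam h)"
  have \<phi>V: "\<phi> i \<in> lattice_span d \<rho> N z" if "i < m" for i using onb that by (simp add: onb_def)
  have \<phi>: "\<phi> i \<in> rk_space d \<rho>" if "i < m" for i by (rule lattice_span_mem[OF \<phi>V[OF that]])
  have ortho: "rk_inner d (reg lam) (\<phi> i) (\<phi> j) = (if i = j then 1 else 0)" if "i < m" "j < m" for i j
    using onb that by (simp add: onb_def)
  have diag: "(\<Sum>i<m. (\<phi> i y)\<^sup>2) \<le> \<kappa>" if "y \<in> cube d" for y
    unfolding \<kappa>_def by (rule R.onb_diag_bound[OF g onb[unfolded V] that])
  have \<phi>b: "\<bar>\<phi> i y\<bar> \<le> sqrt \<kappa>" if "i < m" "y \<in> cube d" for i y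
  proof (rule real_le_rsqrt)
    have "(\<phi> i y)\<^sup>2 \<le> (\<Sum>i<m. (\<phi> i y)\<^sup>2)" by (rule member_le_sum) (use that in auto)
    then show "\<bar>\<phi> i y\<bar>\<^sup>2 \<le> \<kappa>" using diag[OF that(2)] by simp
  qed
  have \<phi>m: "\<phi> i \<in> borel_measurable (cube_measure d)" if "i < m" for i
    using rkD(1)[OF \<phi>[OF that]] by auto
  have dist: "distributed P (cube_measure d) (Y j) (\<lambda>x. ennreal (f x))" if "j \<in> {1..M}" for j
    using iid that by (simp add: iid_sample_def)
  have Ym: "Y j \<in> measurable P (cube_measure d)" if "j \<in> {1..M}" for j
    using dist[OF that] by (rule distributed_measurable)
  have Yc: "Y j \<omega> \<in> cube d" if "j \<in> {1..M}" "\<omega> \<in> space P" for j \<omega>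
    using measurable_space[OF Ym[OF that(1)] that(2)] by (simp add: space_cube_measure)
  have f0: "0 \<le> f x" if "x \<in> space (cube_measure d)" for x
    using dens that by (simp add: prob_density_def space_cube_measure)
  have mean: "expectation (\<lambda>\<omega>. q (Y j \<omega>)) = (\<integral>x. f x * q x \<partial>cube_measure d)"
    if "j \<in> {1..M}" "q \<in> borel_measurable (cube_measure d)" for j and q :: "(nat \<Rightarrow> real) \<Rightarrow> real"
    using distributed_integral[OF dist[OF that(1)] that(2) f0] by simp
  define b where "b i = l2_inner d f (\<phi> i)" for i
  define c where "c i \<omega> = (\<Sum>j=1..M. \<phi> i (Y j \<omega>)) / real M" for i \<omega>
  have u: "u = (\<lambda>x\<in>cube d. \<Sum>i<m. b i * \<phi> i x)" by (simp add: u_def b_def)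
  have uH: "u \<in> rk_space d \<rho>"
    unfolding u_def by (rule lattice_span_mem[OF ridge_projection(1)[OF lam onb f]])
  define s where "s \<omega> = (\<lambda>x. \<Sum>i<m. c i \<omega> * \<phi> i x)" for \<omega>
  have sH: "s \<omega> \<in> rk_space d \<rho>" for \<omega> unfolding s_def by (rule sum_mem) (use \<phi> in auto)
  have err: "sq_error d \<rho> N z M lam f Y \<omega> = l2_inner d (\<lambda>x. s \<omega> x - f x) (\<lambda>x. s \<omega> x - f x)"
    if \<omega>: "\<omega> \<in> space P" for \<omega>
  proof -
    have "estimator d \<rho> N z M lam (\<lambda>j. Y j \<omega>) x = s \<omega> x" if "x \<in> cube d" for x
      using estimator_onb[OF lam onb, of M "\<lambda>j. Y j \<omega>"] Yc \<omega> that by (simp add: s_def c_def)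
    then show ?thesis
      unfolding sq_error_def l2_inner_def
      by (intro Bochner_Integration.integral_cong) (auto simp: space_cube_measure power2_eq_square)
  qed
  have cm: "c i \<in> borel_measurable P" if "i < m" for i
    unfolding c_def[abs_def]
    by (intro borel_measurable_divide borel_measurable_sum borel_measurable_const
        measurable_compose[OF Ym \<phi>m] that)
  have cb: "\<bar>c i \<omega>\<bar> \<le> sqrt \<kappa>" if "i < m" "\<omega> \<in> space P" for i \<omega>
  proof -
    have "\<bar>\<Sum>j=1..M. \<phi> i (Y j \<omega>)\<bar> \<le> (\<Sum>j=1..M. \<bar>\<phi> i (Y j \<omega>)\<bar>)" by (rule sum_abs)
    also have "\<dots> \<le> (\<Sum>j=1..M. sqrt \<kappa>)" by (rule sum_mono) (use \<phi>b that Yc in auto)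
    finally show ?thesis using M by (simp add: c_def divide_le_eq mult.commute)
  qed
  have icc: "integrable P (\<lambda>\<omega>. c i \<omega> * c j \<omega>)" if "i < m" "j < m" for i j
  proof (rule integrable_const_bound[where B="sqrt \<kappa> * sqrt \<kappa>"])
    show "AE \<omega> in P. norm (c i \<omega> * c j \<omega>) \<le> sqrt \<kappa> * sqrt \<kappa>"
      using cb that by (intro AE_I2) (auto simp only: real_norm_def abs_mult intro!: mult_mono order_trans[OF abs_ge_zero])
  qed (use cm that in auto)
  have ic: "integrable P (c i)" if "i < m" for i
    by (rule integrable_const_bound[where B="sqrt \<kappa>"]) (use cb cm that in auto)
  have poly: "l2_inner d (\<lambda>x. s \<omega> x - f x) (\<lambda>x. s \<omega> x - f x) =
      (\<Sum>i<m. \<Sum>j<m. c i \<omega> * c j \<omega> * l2_inner d (\<phi> i) (\<phi> j)) - 2 * (\<Sum>i<m. c i \<omega> * b i) + l2_inner d f f" for \<omega>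
  proof -
    have lin: "l2_inner d (s \<omega>) w = (\<Sum>i<m. c i \<omega> * l2_inner d (\<phi> i) w)" if "w \<in> rk_space d \<rho>" for w
      unfolding s_def by (rule l2_sum) (use \<phi> that in auto)
    have "l2_inner d (s \<omega>) (s \<omega>) = (\<Sum>i<m. c i \<omega> * (\<Sum>j<m. c j \<omega> * l2_inner d (\<phi> i) (\<phi> j)))"
      unfolding lin[OF sH]
    proof (rule sum.cong[OF refl])
      fix i assume "i \<in> {..<m}"
      then have i: "i < m" by simp
      have "l2_inner d (\<phi> i) (s \<omega>) = l2_inner d (s \<omega>) (\<phi> i)" by (rule l2_inner_sym)
      also have "\<dots> = (\<Sum>j<m. c j \<omega> * l2_inner d (\<phi> j) (\<phi> i))" by (rule lin[OF \<phi>[OF i]])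
      also have "\<dots> = (\<Sum>j<m. c j \<omega> * l2_inner d (\<phi> i) (\<phi> j))"
        by (intro sum.cong refl arg_cong2[where f="(*)"]) (rule l2_inner_sym)
      finally show "c i \<omega> * l2_inner d (\<phi> i) (s \<omega>) = c i \<omega> * (\<Sum>j<m. c j \<omega> * l2_inner d (\<phi> i) (\<phi> j))"
        by simp
    qed
    also have "\<dots> = (\<Sum>i<m. \<Sum>j<m. c i \<omega> * c j \<omega> * l2_inner d (\<phi> i) (\<phi> j))"
      by (simp add: sum_distrib_left mult.assoc)
    finally have "l2_inner d (s \<omega>) (s \<omega>) = \<dots>" .
    moreover have "l2_inner d (s \<omega>) f = (\<Sum>i<m. c i \<omega> * b i)"
      unfolding lin[OF f] b_def by (intro sum.cong refl arg_cong2[where f="(*)"]) (rule l2_inner_sym)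
    ultimately show ?thesis unfolding l2_diff_sq[OF sH f] by simp
  qed
  have "integrable P (\<lambda>\<omega>. l2_inner d (\<lambda>x. s \<omega> x - f x) (\<lambda>x. s \<omega> x - f x))"
    unfolding poly
    by (intro Bochner_Integration.integrable_add Bochner_Integration.integrable_diff
        Bochner_Integration.integrable_sum integrable_mult_left integrable_mult_right icc ic integrable_const) auto
  then show int: "integrable P (sq_error d \<rho> N z M lam f Y)"
    by (subst Bochner_Integration.integrable_cong[OF refl err])
  have pt: "sq_error d \<rho> N z M lam f Y \<omega> \<le>
      2 * l2_inner d (\<lambda>x. f x - u x) (\<lambda>x. f x - u x) + 2 * (\<Sum>i<m. (c i \<omega> - b i)\<^sup>2)"
    if \<omega>: "\<omega> \<in> space P" for \<omega>
  proof -
    define e where "e = (\<lambda>x. \<Sum>i<m. (c i \<omega> - b i) * \<phi> i x)"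
    have e: "e \<in> rk_space d \<rho>" unfolding e_def by (rule sum_mem) (use \<phi> in auto)
    define a where "a = (\<lambda>x. f x - u x)"
    have a: "a \<in> rk_space d \<rho>" unfolding a_def by (rule diff_mem[OF f uH])
    have ein: "rk_inner d (reg lam) e w = (\<Sum>i<m. (c i \<omega> - b i) * rk_inner d (reg lam) (\<phi> i) w)"
      if "w \<in> rk_space d \<rho>" for w
      unfolding e_def by (rule R.sum_mem) (use \<phi> that rk_space_reg[OF lam] in auto)
    have "rk_inner d (reg lam) (\<phi> j) e = c j \<omega> - b j" if j: "j < m" for j
    proof -
      have "rk_inner d (reg lam) e (\<phi> j) = (\<Sum>i<m. if i = j then c i \<omega> - b i else 0)"
        unfolding ein[OF \<phi>[OF j]] by (rule sum.cong) (auto simp: ortho j)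
      then show ?thesis using j R.inner_sym[of "\<phi> j" e] by simp
    qed
    then have "rk_inner d (reg lam) e e = (\<Sum>i<m. (c i \<omega> - b i)\<^sup>2)"
      unfolding ein[OF e] by (intro sum.cong) (auto simp: power2_eq_square)
    then have ee: "l2_inner d e e + lam * rk_inner d \<rho> e e = (\<Sum>i<m. (c i \<omega> - b i)\<^sup>2)"
      using rk_inner_reg[OF e e, of lam] by simp
    have "0 \<le> lam * rk_inner d \<rho> e e" using lam inner_pos(1)[OF e] by simp
    then have ee': "l2_inner d e e \<le> (\<Sum>i<m. (c i \<omega> - b i)\<^sup>2)" using ee by linarith
    have "sq_error d \<rho> N z M lam f Y \<omega> = l2_inner d (\<lambda>x. e x - a x) (\<lambda>x. e x - a x)"
      unfolding err[OF \<omega>]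
      by (rule l2_inner_cong) (auto simp: s_def e_def a_def u left_diff_distrib sum_subtractf)
    also have "\<dots> \<le> 2 * l2_inner d e e + 2 * l2_inner d a a" by (rule l2_diff_sq_le[OF e a])
    finally show ?thesis using ee' by (simp add: a_def)
  qed
  define q where "q i = (\<integral>x. f x * (\<phi> i x)\<^sup>2 \<partial>cube_measure d)" for i
  have var: "integrable P (\<lambda>\<omega>. (c i \<omega> - b i)\<^sup>2)"
    "expectation (\<lambda>\<omega>. (c i \<omega> - b i)\<^sup>2) \<le> q i / real M" if i: "i < m" for i
  proof -
    have ind: "indep_vars (\<lambda>_. borel) (\<lambda>j \<omega>. \<phi> i (Y j \<omega>)) {1..M}"
      by (rule indep_vars_compose2[where M'="\<lambda>_. cube_measure d"])
         (use iid \<phi>m[OF i] in \<open>auto simp: iid_sample_def\<close>)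
    have sqm: "(\<lambda>x. (\<phi> i x)\<^sup>2) \<in> borel_measurable (cube_measure d)"
      using \<phi>m[OF i] by (rule borel_measurable_power)
    have B: "\<bar>\<phi> i (Y j \<omega>)\<bar> \<le> sqrt \<kappa>" if "j \<in> {1..M}" "\<omega> \<in> space P" for j \<omega>
      by (rule \<phi>b[OF i Yc[OF that]])
    have E1: "expectation (\<lambda>\<omega>. \<phi> i (Y j \<omega>)) = b i" if "j \<in> {1..M}" for j
      unfolding b_def l2_inner_def by (rule mean[OF that \<phi>m[OF i]])
    have E2: "expectation (\<lambda>\<omega>. (\<phi> i (Y j \<omega>))\<^sup>2) = q i" if "j \<in> {1..M}" for j
      unfolding q_def by (rule mean[OF that sqm])
    show "integrable P (\<lambda>\<omega>. (c i \<omega> - b i)\<^sup>2)" "expectation (\<lambda>\<omega>. (c i \<omega> - b i)\<^sup>2) \<le> q i / real M"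
      unfolding c_def
      using mean_square_error_sample_mean[OF prob_space_axioms M ind B E1 E2] by blast+
  qed
  have one: "1 \<in> {1..M}" using M by simp
  have iY: "integrable P (\<lambda>\<omega>. (\<phi> i (Y 1 \<omega>))\<^sup>2)" if i: "i < m" for i
  proof (rule integrable_const_bound[where B=\<kappa>])
    have "(\<phi> i y)\<^sup>2 \<le> \<kappa>" if "y \<in> cube d" for y
      using member_le_sum[of i "{..<m}" "\<lambda>i. (\<phi> i y)\<^sup>2"] i diag[OF that] by simp
    then show "AE \<omega> in P. norm ((\<phi> i (Y 1 \<omega>))\<^sup>2) \<le> \<kappa>" using Yc[OF one] by (intro AE_I2) simp
    show "(\<lambda>\<omega>. (\<phi> i (Y 1 \<omega>))\<^sup>2) \<in> borel_measurable P"
      by (rule borel_measurable_power[OF measurable_compose[OF Ym[OF one] \<phi>m[OF i]]])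
  qed
  have "(\<Sum>i<m. q i) = (\<Sum>i<m. expectation (\<lambda>\<omega>. (\<phi> i (Y 1 \<omega>))\<^sup>2))"
    unfolding q_def by (rule sum.cong[OF refl], rule mean[OF one, symmetric], rule borel_measurable_power[OF \<phi>m]) simp
  also have "\<dots> = expectation (\<lambda>\<omega>. \<Sum>i<m. (\<phi> i (Y 1 \<omega>))\<^sup>2)"
    by (rule Bochner_Integration.integral_sum[symmetric]) (use iY in auto)
  also have "\<dots> \<le> expectation (\<lambda>\<omega>. \<kappa>)"
    by (rule integral_mono) (use iY diag Yc[OF one] in auto)
  finally have sumq: "(\<Sum>i<m. q i) \<le> \<kappa>" by (simp add: prob_space)
  have isum: "integrable P (\<lambda>\<omega>. \<Sum>i<m. (c i \<omega> - b i)\<^sup>2)"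
    by (rule Bochner_Integration.integrable_sum) (use var(1) in simp)
  have "expectation (\<lambda>\<omega>. \<Sum>i<m. (c i \<omega> - b i)\<^sup>2) = (\<Sum>i<m. expectation (\<lambda>\<omega>. (c i \<omega> - b i)\<^sup>2))"
    by (rule Bochner_Integration.integral_sum) (use var(1) in simp)
  note esum = this
  have "expectation (sq_error d \<rho> N z M lam f Y) \<le>
      expectation (\<lambda>\<omega>. 2 * l2_inner d (\<lambda>x. f x - u x) (\<lambda>x. f x - u x) + 2 * (\<Sum>i<m. (c i \<omega> - b i)\<^sup>2))"
    by (rule integral_mono[OF int _ pt])
       (intro Bochner_Integration.integrable_add integrable_const integrable_mult_right isum)
  also have "\<dots> = 2 * l2_inner d (\<lambda>x. f x - u x) (\<lambda>x. f x - u x) +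
      2 * (\<Sum>i<m. expectation (\<lambda>\<omega>. (c i \<omega> - b i)\<^sup>2))"
    using isum by (simp add: prob_space esum)
  also have "(\<Sum>i<m. expectation (\<lambda>\<omega>. (c i \<omega> - b i)\<^sup>2)) \<le> (\<Sum>i<m. q i / real M)"
    by (rule sum_mono) (use var(2) in simp)
  also have "\<dots> \<le> \<kappa> / real M"
    using sumq by (simp add: sum_divide_distrib[symmetric] divide_right_mono)
  finally show "(\<integral>\<omega>. sq_error d \<rho> N z M lam f Y \<omega> \<partial>P) \<le>
      2 * l2_inner d (\<lambda>x. f x - u x) (\<lambda>x. f x - u x) +
      2 * ((\<Sum>\<^sub>\<infinity>h\<in>freqs d. 1 / reg lam h) / real M)"
    by (simp add: \<kappa>_def)
qed

text \<open>
  The left-hand side is the trace of \<open>T (T + lam)\<^sup>-\<^sup>1\<close> for the diagonal operator \<open>T\<close> with eigenvalues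
  \<open>1 / \<rho> h\<close>, known as the effective dimension. Each term is estimated by \<open>t powr \<tau> \<le> 1 + t\<close> with
  \<open>t = lam * \<rho> h\<close>.
\<close>

lemma effective_dimension:
  assumes lam: "lam > 0" and \<tau>: "0 < \<tau>" "\<tau> \<le> 1"
    and s: "(\<lambda>h. \<rho> h powr - \<tau>) summable_on freqs d"
  shows "(\<Sum>\<^sub>\<infinity>h\<in>freqs d. 1 / reg lam h) \<le> (\<Sum>\<^sub>\<infinity>h\<in>freqs d. \<rho> h powr - \<tau>) / lam powr \<tau>"
proof -
  interpret R: tik d "reg lam" by (rule tik_reg[OF lam])
  have "(\<Sum>\<^sub>\<infinity>h\<in>freqs d. 1 / reg lam h) \<le> (\<Sum>\<^sub>\<infinity>h\<in>freqs d. \<rho> h powr - \<tau> * (1 / lam powr \<tau>))"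
  proof (rule infsum_mono[OF R.summ summable_on_cmult_left[OF s]])
    fix h assume h: "h \<in> freqs d"
    define t where "t = lam * \<rho> h"
    have t: "t > 0" using lam pos[OF h] by (simp add: t_def)
    have "t powr \<tau> \<le> 1 + t"
    proof (cases "t \<le> 1")
      case True
      then have "t powr \<tau> \<le> 1" using t \<tau> by (simp add: powr_le1)
      then show ?thesis using t by simp
    next
      case False
      then have "t powr \<tau> \<le> t powr 1" using \<tau> by (intro powr_mono) auto
      then show ?thesis using t by simp
    qed
    then have "1 / (1 + t) \<le> 1 / t powr \<tau>" using t by (intro divide_left_mono) auto
    also have "\<dots> = \<rho> h powr - \<tau> * (1 / lam powr \<tau>)"
      using lam pos[OF h] by (simp add: t_def powr_mult powr_minus field_simps)
    finally show "1 / reg lam h \<le> \<rho> h powr - \<tau> * (1 / lam powr \<tau>)" by (simp add: reg_def t_def)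
  qed
  also have "\<dots> = (\<Sum>\<^sub>\<infinity>h\<in>freqs d. \<rho> h powr - \<tau>) / lam powr \<tau>"
    by (simp add: infsum_cmult_left' divide_inverse)
  finally show ?thesis .
qed

end

section \<open>Sums of Korobov weights\<close>

lemma zeta_has_sum:
  assumes "s > 1"
  shows "((\<lambda>n. real (Suc n) powr - s) has_sum zeta s) UNIV"
proof -
  have "summable (\<lambda>n. real n powr - s)"
    using assms summable_real_powr_iff[of "- s"] by simp
  then have s: "summable (\<lambda>n. real (Suc n) powr - s)"
    using summable_Suc_iff[of "\<lambda>n. real n powr - s"] by simp
  moreover have "(\<Sum>n. real (Suc n) powr - s) = zeta s"
    unfolding zeta_def by (simp add: powr_minus_divide)
  ultimately show ?thesis
    by (intro norm_summable_imp_has_sum) (auto simp: summable_sums_iff summable_sums)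
qed

lemma zeta_ge_1: "s > 1 \<Longrightarrow> 1 \<le> zeta s"
  using has_sum_mono_neutral[OF has_sum_finite[of "{0}" "\<lambda>n. real (Suc n) powr - s"] zeta_has_sum[of s]] by simp

lemma zeta_antimono:
  assumes "1 < s" "s \<le> t"
  shows "zeta t \<le> zeta s"
proof (rule has_sum_mono[OF zeta_has_sum zeta_has_sum])
  show "real (Suc n) powr - t \<le> real (Suc n) powr - s" for n
    using assms by (intro powr_mono) auto
qed (use assms in auto)

lemma zeta_has_sum_int:
  assumes "s > 1"
  shows "((\<lambda>k::int. if k = 0 then 0 else \<bar>real_of_int k\<bar> powr - s) has_sum 2 * zeta s) UNIV"
proof -
  let ?w = "\<lambda>k::int. if k = 0 then 0 else \<bar>real_of_int k\<bar> powr - s"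
  have p: "(?w has_sum zeta s) ((\<lambda>n. int (Suc n)) ` UNIV)"
    using zeta_has_sum[OF assms] by (subst has_sum_reindex) (auto simp: inj_on_def o_def add.commute)
  have m: "(?w has_sum zeta s) ((\<lambda>n. - int (Suc n)) ` UNIV)"
    using zeta_has_sum[OF assms] by (subst has_sum_reindex) (auto simp: inj_on_def o_def add.commute)
  have "(?w has_sum (zeta s + zeta s)) ((\<lambda>n. int (Suc n)) ` UNIV \<union> (\<lambda>n. - int (Suc n)) ` UNIV)"
    by (rule has_sum_Un_disjoint[OF p m]) auto
  moreover have "k \<in> (\<lambda>n. int (Suc n)) ` UNIV \<union> (\<lambda>n. - int (Suc n)) ` UNIV" if "k \<noteq> 0" for k
  proof (cases "k > 0")
    case True
    then have "k = int (Suc (nat (k - 1)))" by simp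
    then show ?thesis by blast
  next
    case False
    then have "k = - int (Suc (nat (- k - 1)))" using that by simp
    then show ?thesis by blast
  qed
  ultimately show ?thesis
    by (subst has_sum_cong_neutral[where T="(\<lambda>n. int (Suc n)) ` UNIV \<union> (\<lambda>n. - int (Suc n)) ` UNIV" and g="?w"]) auto
qed

lemma has_sum_sum_finite:
  fixes f :: "'a \<Rightarrow> 'b \<Rightarrow> real"
  assumes "finite U" "\<And>u. u \<in> U \<Longrightarrow> (f u has_sum S u) A"
  shows "((\<lambda>h. \<Sum>u\<in>U. f u h) has_sum (\<Sum>u\<in>U. S u)) A"
  using assms
proof (induction U rule: finite_induct)
  case (insert u U)
  then have "((\<lambda>h. f u h + (\<Sum>u\<in>U. f u h)) has_sum (S u + (\<Sum>u\<in>U. S u))) A"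
    by (intro has_sum_add) auto
  then show ?case using insert.hyps by simp
qed (simp add: has_sum_0)

text \<open>
  Each term of the series is written as a sum over all \<open>u \<subseteq> {1..d}\<close>, of which only the one with
  \<open>u = supp d h\<close> is nonzero. Every summand is a product of functions of one coordinate, so its sum over the
  frequencies factorises: coordinates in \<open>u\<close> contribute \<open>2 * zeta \<beta>\<close>, the others \<open>1\<close>.
\<close>

lemma kor_trace:
  assumes \<beta>: "\<beta> > 1" and g1: "\<gamma> {} = 1"
  shows "((\<lambda>h. 1 / kor d \<beta> \<gamma> h) has_sum (\<Sum>u\<in>Pow {1..d}. \<gamma> u * (2 * zeta \<beta>) ^ card u)) (freqs d)"
proof -
  define w where "w u j k = (if j \<in> u then (if k = 0 then 0 else \<bar>real_of_int k\<bar> powr - \<beta>)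
      else if k = 0 then 1 else 0)" for u :: "nat set" and j :: nat and k :: int
  have w: "(w u j has_sum (if j \<in> u then 2 * zeta \<beta> else 1)) UNIV" for u j
  proof (cases "j \<in> u")
    case True
    then show ?thesis using zeta_has_sum_int[OF \<beta>] by (simp add: w_def[abs_def])
  next
    case False
    have "(w u j has_sum 1) UNIV"
      by (rule has_sum_finite_neutralI[of "{0}"]) (use False in \<open>auto simp: w_def\<close>)
    then show ?thesis using False by simp
  qed
  have wn: "norm (w u j k) = w u j k" for u j k by (simp add: w_def)
  have wsum: "(\<lambda>k. norm (w u j k)) summable_on UNIV" for u j
    unfolding wn by (rule has_sum_imp_summable[OF w])
  then have wabs: "Infinite_Set_Sum.abs_summable_on (w u j) UNIV" for u j
    by (rule abs_summable_equivalent[THEN iffD1])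
  have prod: "((\<lambda>h. \<Prod>j\<in>{1..d}. w u j (h j)) has_sum (2 * zeta \<beta>) ^ card u) (freqs d)"
    if u: "u \<subseteq> {1..d}" for u
  proof -
    have "Infinite_Set_Sum.abs_summable_on (\<lambda>h. \<Prod>j\<in>{1..d}. w u j (h j)) (PiE {1..d} (\<lambda>_. UNIV))"
      by (intro abs_summable_on_prod_PiE) (use wabs in auto)
    then have "(\<lambda>h. norm (\<Prod>j\<in>{1..d}. w u j (h j))) summable_on (PiE {1..d} (\<lambda>_. UNIV))"
      by (rule abs_summable_equivalent[THEN iffD2])
    then have "(\<lambda>h. \<Prod>j\<in>{1..d}. w u j (h j)) summable_on freqs d"
      unfolding freqs_def by (rule abs_summable_summable)
    moreover have "(\<Sum>\<^sub>\<infinity>h\<in>freqs d. \<Prod>j\<in>{1..d}. w u j (h j)) = (2 * zeta \<beta>) ^ card u"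
    proof -
      have "(\<Sum>\<^sub>\<infinity>h\<in>freqs d. \<Prod>j\<in>{1..d}. w u j (h j)) = (\<Prod>j\<in>{1..d}. infsum (w u j) UNIV)"
        unfolding freqs_def by (rule infsum_prod_PiE_abs) (use wsum in auto)
      also have "\<dots> = (\<Prod>j\<in>{1..d}. if j \<in> u then 2 * zeta \<beta> else 1)"
        by (rule prod.cong[OF refl]) (rule infsumI[OF w])
      also have "\<dots> = (\<Prod>j\<in>{1..d} \<inter> u. 2 * zeta \<beta>)" by (rule prod.inter_restrict[symmetric]) simp
      also have "{1..d} \<inter> u = u" using u by blast
      finally show ?thesis by simp
    qed
    ultimately show ?thesis using has_sum_infsum by fastforce
  qed
  have eq: "1 / kor d \<beta> \<gamma> h = (\<Sum>u\<in>Pow {1..d}. \<gamma> u * (\<Prod>j\<in>{1..d}. w u j (h j)))" for h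
  proof -
    let ?s = "supp d h"
    have sub: "?s \<subseteq> {1..d}" by (auto simp: supp_def)
    have z: "(\<Prod>j\<in>{1..d}. w u j (h j)) = 0" if u: "u \<subseteq> {1..d}" "u \<noteq> ?s" for u
    proof -
      obtain j where "j \<in> {1..d}" "j \<in> u \<longleftrightarrow> j \<notin> ?s" using u sub by blast
      then have "j \<in> {1..d}" "j \<in> u \<longleftrightarrow> h j = 0" by (auto simp: supp_def)
      then show ?thesis by (intro prod_zero) (auto simp: w_def intro!: bexI[of _ j])
    qed
    have "(\<Prod>j\<in>{1..d}. w ?s j (h j)) = (\<Prod>j\<in>?s. w ?s j (h j))"
      by (rule prod.mono_neutral_right) (auto simp: supp_def w_def)
    also have "\<dots> = (\<Prod>j\<in>?s. 1 / (\<bar>real_of_int (h j)\<bar> powr \<beta>))"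
      by (rule prod.cong[OF refl]) (auto simp: w_def supp_def powr_minus_divide)
    finally have "(\<Prod>j\<in>{1..d}. w ?s j (h j)) = 1 / (\<Prod>j\<in>?s. \<bar>real_of_int (h j)\<bar> powr \<beta>)"
      by (simp add: prod_dividef)
    then have "1 / kor d \<beta> \<gamma> h = \<gamma> ?s * (\<Prod>j\<in>{1..d}. w ?s j (h j))"
      using g1 by (auto simp: kor_def)
    also have "\<dots> = (\<Sum>u\<in>Pow {1..d}. if u = ?s then \<gamma> u * (\<Prod>j\<in>{1..d}. w u j (h j)) else 0)"
      using sub by simp
    also have "\<dots> = (\<Sum>u\<in>Pow {1..d}. \<gamma> u * (\<Prod>j\<in>{1..d}. w u j (h j)))"
    proof (rule sum.cong[OF refl])
      fix u assume u: "u \<in> Pow {1..d}"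
      show "(if u = ?s then \<gamma> u * (\<Prod>j\<in>{1..d}. w u j (h j)) else 0) = \<gamma> u * (\<Prod>j\<in>{1..d}. w u j (h j))"
      proof (cases "u = ?s")
        case False
        have "(\<Prod>j\<in>{1..d}. w u j (h j)) = 0" by (rule z[OF _ False]) (use u in blast)
        with False show ?thesis by (simp only: if_False mult_zero_right)
      qed simp
    qed
    finally show ?thesis .
  qed
  show ?thesis unfolding eq
  proof (rule has_sum_sum_finite)
    fix u assume "u \<in> Pow {1..d}"
    then show "((\<lambda>h. \<gamma> u * (\<Prod>j\<in>{1..d}. w u j (h j))) has_sum \<gamma> u * (2 * zeta \<beta>) ^ card u) (freqs d)"
      by (intro has_sum_cmult_right prod) blast
  qed simp
qed

text \<open>
  A power of a Korobov weight is again a Korobov weight, so fractional traces reduce to plain ones.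
\<close>

lemma kor_powr:
  assumes g: "\<And>u. u \<subseteq> {1..d} \<Longrightarrow> \<gamma> u > 0"
  shows "kor d \<alpha> \<gamma> h powr - \<tau> = 1 / kor d (\<alpha> * \<tau>) (\<lambda>u. \<gamma> u powr \<tau>) h"
proof -
  have "\<gamma> (supp d h) > 0" by (rule g) (auto simp: supp_def)
  moreover have "(\<Prod>j\<in>supp d h. \<bar>real_of_int (h j)\<bar> powr \<alpha>) powr \<tau> =
      (\<Prod>j\<in>supp d h. \<bar>real_of_int (h j)\<bar> powr (\<alpha> * \<tau>))"
    by (simp add: prod_powr_distrib powr_powr)
  moreover have "0 \<le> (\<Prod>j\<in>supp d h. \<bar>real_of_int (h j)\<bar> powr \<alpha>)" by (rule prod_nonneg) simp
  ultimately show ?thesis by (simp add: kor_def powr_minus_divide powr_divide)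
qed

lemma kor_trace_term:
  assumes "\<alpha> * \<tau> > 1" and g: "\<And>u. u \<subseteq> {1..d} \<Longrightarrow> \<gamma> u > 0" and "\<gamma> {} = 1"
  shows "((\<lambda>h. kor d \<alpha> \<gamma> h powr - \<tau>) has_sum (\<Sum>u\<in>Pow {1..d}. trace_term \<alpha> \<tau> \<gamma> u)) (freqs d)"
proof -
  have "kor d \<alpha> \<gamma> h powr - \<tau> = 1 / kor d (\<alpha> * \<tau>) (\<lambda>u. \<gamma> u powr \<tau>) h" for h
    by (rule kor_powr[OF g])
  then show ?thesis
    unfolding trace_term_def using kor_trace[of "\<alpha> * \<tau>" "\<lambda>u. \<gamma> u powr \<tau>" d] assms(1,3) by simp
qed

text \<open>
  The summability conditions for both kernels, and the trace condition, compare the same weights at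
  different exponents \<open>p\<close>; taking \<open>p\<close> as the parameter makes them terms of one monotone family.
\<close>

definition weight_at :: "real \<Rightarrow> real \<Rightarrow> (nat set \<Rightarrow> real) \<Rightarrow> nat set \<Rightarrow> real" where
  "weight_at \<alpha> p \<gamma> u = real (max (card u) 1) * \<gamma> u powr p * (2 * zeta (\<alpha> * p)) ^ card u"

lemma weight_term_weight_at: "weight_term \<alpha> \<delta> \<gamma> = weight_at \<alpha> (1 / (\<alpha> - 4 * \<delta>)) \<gamma>"
  by (simp add: weight_term_def[abs_def] weight_at_def[abs_def])

lemma weight_term_doubled:
  assumes "\<delta> < \<alpha> / 4" and g: "\<And>u. u \<in> finsets \<Longrightarrow> \<gamma> u > 0" and "u \<in> finsets"
  shows "weight_term (2 * \<alpha>) \<delta> (\<lambda>u. (\<gamma> u)\<^sup>2) u = weight_at \<alpha> (1 / (\<alpha> - 2 * \<delta>)) \<gamma> u"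
proof -
  have h: "2 * \<alpha> - 4 * \<delta> = 2 * (\<alpha> - 2 * \<delta>)" by simp
  have "(\<gamma> u)\<^sup>2 powr (1 / (2 * (\<alpha> - 2 * \<delta>))) = (\<gamma> u powr 2) powr (1 / (2 * (\<alpha> - 2 * \<delta>)))"
    using g[OF assms(3)] by (simp add: powr_numeral)
  also have "\<dots> = \<gamma> u powr (1 / (\<alpha> - 2 * \<delta>))"
  proof -
    have "2 * (1 / (2 * x)) = 1 / x" for x :: real by simp
    then show ?thesis by (simp only: powr_powr)
  qed
  finally have "(\<gamma> u)\<^sup>2 powr (1 / (2 * (\<alpha> - 2 * \<delta>))) = \<gamma> u powr (1 / (\<alpha> - 2 * \<delta>))" .
  moreover have "2 * \<alpha> / (2 * x) = \<alpha> * (1 / x)" for x by simp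
  ultimately show ?thesis unfolding weight_term_def weight_at_def h by (simp only:)
qed

lemma weight_at_nonneg: "\<alpha> * p > 1 \<Longrightarrow> 0 \<le> weight_at \<alpha> p \<gamma> u"
  using zeta_ge_1[of "\<alpha> * p"] by (simp add: weight_at_def)

lemma trace_term_nonneg: "\<alpha> * \<tau> > 1 \<Longrightarrow> 0 \<le> trace_term \<alpha> \<tau> \<gamma> u"
  using zeta_ge_1[of "\<alpha> * \<tau>"] by (simp add: trace_term_def)

lemma trace_term_le_weight_at:
  assumes "\<alpha> * \<tau> > 1"
  shows "trace_term \<alpha> \<tau> \<gamma> u \<le> weight_at \<alpha> \<tau> \<gamma> u"
proof -
  have "1 * trace_term \<alpha> \<tau> \<gamma> u \<le> real (max (card u) 1) * trace_term \<alpha> \<tau> \<gamma> u"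
    by (rule mult_right_mono[OF _ trace_term_nonneg[OF assms]]) simp
  then show ?thesis by (simp add: weight_at_def trace_term_def mult.assoc)
qed

text \<open>
  Only finitely many terms exceed \<open>1\<close>. For the remaining \<open>u\<close> one has \<open>\<gamma> u \<le> 1\<close>, since the other two factors are at
  least \<open>1\<close>, and then a larger exponent decreases both the power of \<open>\<gamma> u\<close> and the zeta value.
\<close>

lemma weight_at_summable_mono:
  assumes \<alpha>: "\<alpha> > 0" and p: "\<alpha> * p > 1" "p \<le> q" and g: "\<And>u. u \<in> finsets \<Longrightarrow> \<gamma> u > 0"
    and s: "weight_at \<alpha> p \<gamma> summable_on finsets"
  shows "weight_at \<alpha> q \<gamma> summable_on finsets"
proof -
  have p0: "p > 0" using \<alpha> p(1) by (smt (verit) mult_nonneg_nonpos)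
  have q: "\<alpha> * q > 1" using p \<alpha> by (meson less_le_trans mult_left_mono less_imp_le)
  define F where "F = {u \<in> finsets. weight_at \<alpha> p \<gamma> u > 1}"
  have "finite F"
  proof -
    have "card G \<le> nat \<lceil>infsum (weight_at \<alpha> p \<gamma>) finsets\<rceil>" if "finite G" "G \<subseteq> F" for G
    proof -
      have "real (card G) = (\<Sum>u\<in>G. 1)" by simp
      also have "\<dots> \<le> (\<Sum>u\<in>G. weight_at \<alpha> p \<gamma> u)" by (rule sum_mono) (use that in \<open>auto simp: F_def\<close>)
      also have "\<dots> \<le> infsum (weight_at \<alpha> p \<gamma>) finsets"
        by (rule finite_sum_le_infsum[OF s]) (use that weight_at_nonneg p in \<open>auto simp: F_def\<close>)
      finally show ?thesis by linarith
    qed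
    then show ?thesis by (intro conjunct1[OF finite_if_finite_subsets_card_bdd])
  qed
  have le: "weight_at \<alpha> q \<gamma> u \<le> weight_at \<alpha> p \<gamma> u" if u: "u \<in> finsets - F" for u
  proof -
    have z1: "1 \<le> zeta (\<alpha> * p)" by (rule zeta_ge_1[OF p(1)])
    have small: "\<gamma> u powr p \<le> 1"
    proof -
      have "1 \<le> real (max (card u) 1) * (2 * zeta (\<alpha> * p)) ^ card u"
      proof -
        have "1 \<le> (2 * zeta (\<alpha> * p)) ^ card u" by (rule one_le_power) (use z1 in simp)
        then have "1 * 1 \<le> real (max (card u) 1) * (2 * zeta (\<alpha> * p)) ^ card u"
          by (intro mult_mono) auto
        then show ?thesis by simp
      qed
      then have "\<gamma> u powr p * 1 \<le> \<gamma> u powr p * (real (max (card u) 1) * (2 * zeta (\<alpha> * p)) ^ card u)"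
        by (rule mult_left_mono) simp
      also have "\<dots> = weight_at \<alpha> p \<gamma> u" by (simp add: weight_at_def mult_ac)
      also have "\<dots> \<le> 1" using u by (auto simp: F_def not_less)
      finally show ?thesis by simp
    qed
    have "\<gamma> u \<le> 1"
    proof (rule ccontr)
      assume "\<not> \<gamma> u \<le> 1"
      then have "1 powr p < \<gamma> u powr p" using p0 by (intro powr_less_mono2) auto
      then show False using small by simp
    qed
    then have "\<gamma> u powr q \<le> \<gamma> u powr p" using g[of u] u p(2) by (intro powr_mono') auto
    moreover have "zeta (\<alpha> * q) \<le> zeta (\<alpha> * p)"
      by (rule zeta_antimono[OF p(1)]) (use p \<alpha> in simp)
    ultimately show ?thesis
      unfolding weight_at_def using zeta_ge_1[OF q] z1
      by (intro mult_mono power_mono mult_nonneg_nonneg) auto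
  qed
  have "weight_at \<alpha> p \<gamma> summable_on (finsets - F)"
    by (rule summable_on_subset_banach[OF s]) auto
  then have "weight_at \<alpha> q \<gamma> summable_on (finsets - F)"
    by (rule summable_on_comparison_test) (use le weight_at_nonneg[OF q] in auto)
  moreover have "weight_at \<alpha> q \<gamma> summable_on F" using \<open>finite F\<close> by simp
  ultimately have "weight_at \<alpha> q \<gamma> summable_on (finsets - F \<union> F)"
    by (rule summable_on_union)
  moreover have "finsets - F \<union> F = finsets" by (auto simp: F_def)
  ultimately show ?thesis by simp
qed

lemma sum_Pow_le_infsum_finsets:
  fixes t :: "nat set \<Rightarrow> real"
  assumes "t summable_on finsets" "\<And>u. 0 \<le> t u"
  shows "(\<Sum>u\<in>Pow {1..d}. t u) \<le> infsum t finsets"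
  by (rule finite_sum_le_infsum[OF assms(1)]) (use assms(2) in \<open>auto simp: finsets_def intro: finite_subset\<close>)

section \<open>The constant and the two bounds\<close>

text \<open>
  This follows from \<open>0 \<le> \<integral> (f - 1)\<^sup>2\<close>, and is the reason why the norm of \<open>f\<close> may appear in the variance term.
\<close>

lemma l2_norm_density_ge_1:
  assumes "prob_density d f" and f2: "integrable (cube_measure d) (\<lambda>x. f x * f x)"
  shows "1 \<le> l2_norm d f"
proof -
  interpret prob_space "cube_measure d" by (rule prob_cube)
  have f: "integrable (cube_measure d) f" "(\<integral>x. f x \<partial>cube_measure d) = 1"
    using assms(1) by (auto simp: prob_density_def)
  have "(\<integral>x. 2 * f x - 1 \<partial>cube_measure d) \<le> (\<integral>x. f x * f x \<partial>cube_measure d)"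
  proof (rule integral_mono)
    show "2 * f x - 1 \<le> f x * f x" for x
      using zero_le_power2[of "f x - 1"] by (simp add: power2_eq_square algebra_simps)
  qed (use f f2 in auto)
  then have "1 \<le> (\<integral>x. f x * f x \<partial>cube_measure d)" using f by (simp add: prob_space)
  then show ?thesis by (simp add: l2_norm_def power2_eq_square)
qed

text \<open>
  The factor 16 is a common upper bound for the numerical constants of both estimates; the squared
  interpolation constant, \<open>1\<close> and the trace multiply the interpolation, regularisation and variance terms.
\<close>

definition risk_const :: "nat \<Rightarrow> real \<Rightarrow> real \<Rightarrow> real \<Rightarrow> (nat set \<Rightarrow> real) \<Rightarrow> real" where
  "risk_const d \<alpha> \<delta> \<tau> \<gamma> =
     16 * ((interp_const d \<alpha> \<delta> \<gamma>)\<^sup>2 + 1 + (\<Sum>u\<in>Pow {1..d}. trace_term \<alpha> \<tau> \<gamma> u))"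

text \<open>
  The exponent \<open>p\<close> is \<open>1 / (\<alpha> - 4 * \<delta>)\<close> for the condition on the original kernel and
  \<open>1 / (\<alpha> - 2 * \<delta>)\<close> for the condition on the squared one.
\<close>

lemma risk_const_bounded:
  assumes \<alpha>: "\<alpha> > 0" and \<delta>: "0 < \<delta>" "\<delta> < \<alpha> / 4" and \<tau>: "1 / \<alpha> < \<tau>"
    and g: "\<And>u. u \<in> finsets \<Longrightarrow> \<gamma> u > 0"
    and p: "\<alpha> * p > 1" "p \<le> 1 / (\<alpha> - 4 * \<delta>)" and s: "weight_at \<alpha> p \<gamma> summable_on finsets"
    and t: "p \<le> \<tau> \<or> trace_term \<alpha> \<tau> \<gamma> summable_on finsets"
  shows "\<exists>B. \<forall>d. risk_const d \<alpha> \<delta> \<tau> \<gamma> \<le> B"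
proof -
  let ?q = "1 / (\<alpha> - 4 * \<delta>)"
  have q: "\<alpha> * ?q > 1" using \<alpha> \<delta> by (simp add: field_simps)
  have \<alpha>\<tau>: "\<alpha> * \<tau> > 1" using \<alpha> \<tau> by (simp add: field_simps)
  have w: "weight_term \<alpha> \<delta> \<gamma> summable_on finsets"
    unfolding weight_term_weight_at by (rule weight_at_summable_mono[OF \<alpha> p g s])
  have tr: "trace_term \<alpha> \<tau> \<gamma> summable_on finsets"
    using t
  proof
    assume "p \<le> \<tau>"
    then have "weight_at \<alpha> \<tau> \<gamma> summable_on finsets"
      by (intro weight_at_summable_mono[OF \<alpha> p(1) _ g s])
    then show ?thesis
      by (rule summable_on_comparison_test)
         (use trace_term_le_weight_at[OF \<alpha>\<tau>] trace_term_nonneg[OF \<alpha>\<tau>] in auto)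
  qed
  have wn: "0 \<le> weight_term \<alpha> \<delta> \<gamma> u" for u
    unfolding weight_term_weight_at by (rule weight_at_nonneg[OF q])
  define W where "W = infsum (weight_term \<alpha> \<delta> \<gamma>) finsets powr (\<alpha> - 4 * \<delta>)"
  have "risk_const d \<alpha> \<delta> \<tau> \<gamma> \<le> 16 * (W\<^sup>2 + 1 + infsum (trace_term \<alpha> \<tau> \<gamma>) finsets)" for d
  proof -
    have "interp_const d \<alpha> \<delta> \<gamma> \<le> W"
      unfolding interp_const_def W_def using \<delta>
      by (intro powr_mono2 sum_Pow_le_infsum_finsets[OF w wn] sum_nonneg wn) auto
    moreover have "0 \<le> interp_const d \<alpha> \<delta> \<gamma>" by (simp add: interp_const_def)
    ultimately have "(interp_const d \<alpha> \<delta> \<gamma>)\<^sup>2 \<le> W\<^sup>2" by (rule power_mono)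
    then show ?thesis
      using sum_Pow_le_infsum_finsets[OF tr trace_term_nonneg[OF \<alpha>\<tau>], of d]
      by (simp add: risk_const_def)
  qed
  then show ?thesis by blast
qed

text \<open>
  Both bounds come from the same chain; they differ only in the regularisation term \<open>Z\<close>, for which the
  bias satisfies \<open>D \<le> 6 * E + 4 * Z\<close> with \<open>E\<close> the squared interpolation error.
\<close>

lemma risk_bounds:
  fixes P :: "'w measure" and Y :: "nat \<Rightarrow> 'w \<Rightarrow> nat \<Rightarrow> real"
  assumes \<alpha>: "\<alpha> > 1" and \<tau>: "1 / \<alpha> < \<tau>" "\<tau> \<le> 1" and g: "\<And>u. u \<subseteq> {1..d} \<Longrightarrow> \<gamma> u > 0" and g1: "\<gamma> {} = 1"
    and dens: "prob_density d f" and f: "f \<in> rk_space d (kor d \<alpha> \<gamma>)" and M: "M \<ge> 1" and lam: "lam > 0"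
    and z: "good_generator d \<alpha> \<delta> \<gamma> N z" and iid: "iid_sample d f M P Y"
  defines "\<rho> \<equiv> kor d \<alpha> \<gamma>" and "K \<equiv> risk_const d \<alpha> \<delta> \<tau> \<gamma>"
  shows "integrable P (sq_error d \<rho> N z M lam f Y)"
    and "(\<integral>\<omega>. sq_error d \<rho> N z M lam f Y \<omega> \<partial>P) \<le>
      K * ((rk_norm d \<rho> f)\<^sup>2 * (1 / real N powr (\<alpha> / 2 - 2 * \<delta>)) + lam * (rk_norm d \<rho> f)\<^sup>2
        + l2_norm d f / (real M * lam powr \<tau>))"
    and "f \<in> rk_space d (korsq d \<alpha> \<gamma>) \<Longrightarrow> (\<integral>\<omega>. sq_error d \<rho> N z M lam f Y \<omega> \<partial>P) \<le>
      K * ((rk_norm d \<rho> f)\<^sup>2 * (1 / real N powr (\<alpha> / 2 - 2 * \<delta>)) + lam\<^sup>2 * (rk_norm d (korsq d \<alpha> \<gamma>) f)\<^sup>2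
        + l2_norm d f / (real M * lam powr \<tau>))"
proof -
  interpret tik d \<rho> unfolding \<rho>_def by (rule tik_kor[OF \<alpha> g])
  interpret R: tik d "reg lam" by (rule tik_reg[OF lam])
  have fH: "f \<in> rk_space d \<rho>" using f by (simp add: \<rho>_def)
  have "0 < 1 / \<alpha>" using \<alpha> by simp
  then have "0 < \<tau>" using \<tau>(1) by (rule less_trans)
  moreover have "\<alpha> * \<tau> > 1" using \<alpha> \<tau>(1) by (simp add: field_simps)
  ultimately have \<tau>0: "0 < \<tau>" "\<alpha> * \<tau> > 1" by auto
  define T where "T = (\<Sum>u\<in>Pow {1..d}. trace_term \<alpha> \<tau> \<gamma> u)"
  define c where "c = interp_const d \<alpha> \<delta> \<gamma>"
  have T0: "0 \<le> T" unfolding T_def by (rule sum_nonneg) (rule trace_term_nonneg[OF \<tau>0(2)])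
  have K: "K = 16 * (c\<^sup>2 + 1 + T)" by (simp add: K_def risk_const_def c_def T_def)
  have "\<exists>m \<phi>. onb d (reg lam) (lattice_span d \<rho> N z) m \<phi>"
    unfolding lattice_span_fspan by (rule R.onb_exists) (simp add: rk_space_reg[OF lam] kernel_mem)
  then obtain m \<phi> where onb: "onb d (reg lam) (lattice_span d \<rho> N z) m \<phi>" by blast
  define u where "u = (\<lambda>x\<in>cube d. \<Sum>i<m. l2_inner d f (\<phi> i) * \<phi> i x)"
  define w where "w = interpolant d \<rho> N z f"
  note uP = ridge_projection[OF lam onb fH, folded u_def]
  note wP = interpolant_props[OF fH, where N=N and z=z, folded w_def]
  have uH: "u \<in> rk_space d \<rho>" and wH: "w \<in> rk_space d \<rho>"
    by (rule lattice_span_mem[OF uP(1)], rule lattice_span_mem[OF wP(1)])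
  define D where "D = l2_inner d (\<lambda>x. f x - u x) (\<lambda>x. f x - u x)"
  define E where "E = l2_inner d (\<lambda>x. f x - w x) (\<lambda>x. f x - w x)"
  define X where "X = (rk_norm d \<rho> f)\<^sup>2 * (1 / real N powr (\<alpha> / 2 - 2 * \<delta>))"
  define V where "V = l2_norm d f / (real M * lam powr \<tau>)"
  have nf: "(rk_norm d \<rho> f)\<^sup>2 = rk_inner d \<rho> f f"
    using inner_pos(1)[OF fH] by (simp add: rk_norm_inner[OF fH])
  have EX: "E \<le> c\<^sup>2 * X"
  proof -
    have "E = (l2_norm d (\<lambda>x. w x - f x))\<^sup>2"
      unfolding E_def l2_norm_sq l2_inner_def by (rule Bochner_Integration.integral_cong) (auto simp: algebra_simps)
    also have "\<dots> \<le> (c * rk_norm d \<rho> f * real N powr (- (\<alpha> / 4 - \<delta>)))\<^sup>2"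
    proof (rule power_mono)
      show "l2_norm d (\<lambda>x. w x - f x) \<le> c * rk_norm d \<rho> f * real N powr (- (\<alpha> / 4 - \<delta>))"
        using z f unfolding good_generator_def w_def \<rho>_def c_def by blast
      show "0 \<le> l2_norm d (\<lambda>x. w x - f x)" by (simp add: l2_norm_def)
    qed
    also have "(real N powr (- (\<alpha> / 4 - \<delta>)))\<^sup>2 = real N powr (- (\<alpha> / 2 - 2 * \<delta>))"
      by (simp add: power2_eq_square powr_add[symmetric])
    then have "(c * rk_norm d \<rho> f * real N powr (- (\<alpha> / 4 - \<delta>)))\<^sup>2 = c\<^sup>2 * X"
      by (simp only: X_def power_mult_distrib powr_minus_divide mult.assoc)
    finally show ?thesis .
  qed
  have X0: "0 \<le> X" by (simp add: X_def)
  have V1: "(\<Sum>\<^sub>\<infinity>h\<in>freqs d. 1 / reg lam h) / real M \<le> T * V" and V0: "0 \<le> V"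
  proof -
    have tr: "((\<lambda>h. \<rho> h powr - \<tau>) has_sum T) (freqs d)"
      unfolding \<rho>_def T_def by (rule kor_trace_term[OF \<tau>0(2)]) (use g g1 in auto)
    have "(\<Sum>\<^sub>\<infinity>h\<in>freqs d. 1 / reg lam h) \<le> T / lam powr \<tau>"
      using effective_dimension[OF lam \<tau>0(1) \<tau>(2) has_sum_imp_summable[OF tr]] infsumI[OF tr] by simp
    then have "(\<Sum>\<^sub>\<infinity>h\<in>freqs d. 1 / reg lam h) / real M \<le> T / lam powr \<tau> / real M"
      by (rule divide_right_mono) simp
    also have "\<dots> = T * (1 / (real M * lam powr \<tau>))" by (simp add: mult.commute)
    also have "\<dots> \<le> T * V"
      unfolding V_def using l2_norm_density_ge_1[OF dens l2_integrable[OF fH fH]] T0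
      by (intro mult_left_mono divide_right_mono) auto
    finally show "(\<Sum>\<^sub>\<infinity>h\<in>freqs d. 1 / reg lam h) / real M \<le> T * V" .
    show "0 \<le> V" by (simp add: V_def l2_norm_def)
  qed
  note risk = risk_decomposition[OF lam M dens fH iid onb, folded u_def D_def]
  show "integrable P (sq_error d \<rho> N z M lam f Y)" by (rule risk(1))
  have main: "(\<integral>\<omega>. sq_error d \<rho> N z M lam f Y \<omega> \<partial>P) \<le> 2 * D + 2 * (T * V)"
    using risk(2) V1 by linarith
  \<comment> \<open>Each of \<open>X\<close>, \<open>Z\<close>, \<open>V\<close> needs only one summand of \<open>K\<close>, namely \<open>c\<^sup>2\<close>, \<open>1\<close>, \<open>T\<close>; the mixed products are nonnegative.\<close>
  have final: "(\<integral>\<omega>. sq_error d \<rho> N z M lam f Y \<omega> \<partial>P) \<le> K * (X + Z + V)"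
    if D: "D \<le> 6 * E + 4 * Z" and Z: "0 \<le> Z" for Z
  proof -
    have "0 \<le> c\<^sup>2 * X" "0 \<le> c\<^sup>2 * Z" "0 \<le> c\<^sup>2 * V" "0 \<le> T * X" "0 \<le> T * Z" "0 \<le> T * V"
      using X0 Z V0 T0 by simp_all
    moreover have "K * (X + Z + V) = 16 * (c\<^sup>2 * X) + 16 * (c\<^sup>2 * Z) + 16 * (c\<^sup>2 * V) +
        16 * X + 16 * Z + 16 * V + 16 * (T * X) + 16 * (T * Z) + 16 * (T * V)"
      unfolding K by (simp add: algebra_simps)
    ultimately show ?thesis using main D EX X0 Z V0 by linarith
  qed
  have ww: "rk_inner d \<rho> w w = rk_inner d \<rho> f w" by (rule wP(2)[OF wP(1)])
  have wu: "rk_inner d \<rho> w u = rk_inner d \<rho> f u" by (rule wP(2)[OF uP(1)])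
  have D1: "D \<le> E + lam * (rk_norm d \<rho> f)\<^sup>2"
    unfolding nf D_def E_def by (rule bias_energy[OF lam fH uH wH uP(2)[OF uP(1)] uP(2)[OF wP(1)] ww])
  have E0: "0 \<le> E" unfolding E_def by (rule l2_inner_nonneg)
  have Z1: "0 \<le> lam * (rk_norm d \<rho> f)\<^sup>2" using lam by simp
  show "(\<integral>\<omega>. sq_error d \<rho> N z M lam f Y \<omega> \<partial>P) \<le>
      K * ((rk_norm d \<rho> f)\<^sup>2 * (1 / real N powr (\<alpha> / 2 - 2 * \<delta>)) + lam * (rk_norm d \<rho> f)\<^sup>2
        + l2_norm d f / (real M * lam powr \<tau>))"
    using final[OF _ Z1] D1 E0 Z1 by (simp add: X_def V_def)
  assume f2: "f \<in> rk_space d (korsq d \<alpha> \<gamma>)"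
  have f2s: "(\<lambda>h. (\<rho> h)\<^sup>2 * (cmod (fcoeff d f h))\<^sup>2) summable_on freqs d"
    using f2 by (simp add: rk_space_def korsq_def \<rho>_def)
  have "0 \<le> (\<Sum>\<^sub>\<infinity>h\<in>freqs d. (\<rho> h)\<^sup>2 * (cmod (fcoeff d f h))\<^sup>2)" by (rule infsum_nonneg) simp
  then have nf2: "(rk_norm d (korsq d \<alpha> \<gamma>) f)\<^sup>2 = (\<Sum>\<^sub>\<infinity>h\<in>freqs d. (\<rho> h)\<^sup>2 * (cmod (fcoeff d f h))\<^sup>2)"
    by (simp add: rk_norm_def korsq_def \<rho>_def)
  have D2: "D \<le> 6 * E + 4 * (lam\<^sup>2 * (rk_norm d (korsq d \<alpha> \<gamma>) f)\<^sup>2)"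
    unfolding nf2 D_def E_def
    by (rule bias_smooth[OF lam fH uH wH f2s uP(2)[OF uP(1)] uP(2)[OF wP(1)] ww wu])
  show "(\<integral>\<omega>. sq_error d \<rho> N z M lam f Y \<omega> \<partial>P) \<le>
      K * ((rk_norm d \<rho> f)\<^sup>2 * (1 / real N powr (\<alpha> / 2 - 2 * \<delta>)) + lam\<^sup>2 * (rk_norm d (korsq d \<alpha> \<gamma>) f)\<^sup>2
        + l2_norm d f / (real M * lam powr \<tau>))"
    using final[OF D2] by (simp add: X_def V_def)
qed

theorem theorem4p3:
  fixes \<alpha> \<delta> \<tau> :: real and \<gamma> :: "nat set \<Rightarrow> real"
  assumes "\<alpha> > 1"
    and "0 < \<delta>" and "\<delta> < \<alpha> / 4"
    and "1 / \<alpha> < \<tau>" and "\<tau> \<le> 1"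
    and "\<And>u. finite u \<Longrightarrow> u \<subseteq> {1..} \<Longrightarrow> \<gamma> u > 0"
    and "\<gamma> {} = 1"
  shows "\<exists>C Ct :: nat \<Rightarrow> real.
    (\<forall>d\<ge>1. C d > 0 \<and> Ct d > 0 \<and>
      (\<forall>(f :: (nat \<Rightarrow> real) \<Rightarrow> real) (M :: nat) (lam :: real) (N :: nat) (z :: nat \<Rightarrow> nat)
          (P :: 'w measure) (Y :: nat \<Rightarrow> 'w \<Rightarrow> (nat \<Rightarrow> real)).
        prob_density d f \<longrightarrow> f \<in> rk_space d (kor d \<alpha> \<gamma>) \<longrightarrow> M \<ge> 1 \<longrightarrow> lam > 0 \<longrightarrow>
        prime N \<longrightarrow> good_generator d \<alpha> \<delta> \<gamma> N z \<longrightarrow> iid_sample d f M P Y \<longrightarrow>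
          integrable P (sq_error d (kor d \<alpha> \<gamma>) N z M lam f Y) \<and>
          (\<integral>\<omega>. sq_error d (kor d \<alpha> \<gamma>) N z M lam f Y \<omega> \<partial>P)
            \<le> C d * ((rk_norm d (kor d \<alpha> \<gamma>) f)\<^sup>2 * (1 / real N powr (\<alpha> / 2 - 2 * \<delta>))
                  + lam * (rk_norm d (kor d \<alpha> \<gamma>) f)\<^sup>2
                  + l2_norm d f / (real M * lam powr \<tau>)) \<and>
          (f \<in> rk_space d (korsq d \<alpha> \<gamma>) \<longrightarrow>
            (\<integral>\<omega>. sq_error d (kor d \<alpha> \<gamma>) N z M lam f Y \<omega> \<partial>P)
              \<le> Ct d * ((rk_norm d (kor d \<alpha> \<gamma>) f)\<^sup>2 * (1 / real N powr (\<alpha> / 2 - 2 * \<delta>))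
                    + lam\<^sup>2 * (rk_norm d (korsq d \<alpha> \<gamma>) f)\<^sup>2
                    + l2_norm d f / (real M * lam powr \<tau>))))) \<and>
    (weight_term \<alpha> \<delta> \<gamma> summable_on finsets \<longrightarrow>
      (1 / (\<alpha> - 4 * \<delta>) \<le> \<tau> \<or> trace_term \<alpha> \<tau> \<gamma> summable_on finsets) \<longrightarrow>
        (\<exists>B. \<forall>d\<ge>1. C d \<le> B)) \<and>
    (weight_term (2 * \<alpha>) \<delta> (\<lambda>u. (\<gamma> u)\<^sup>2) summable_on finsets \<longrightarrow>
      (1 / (\<alpha> - 2 * \<delta>) \<le> \<tau> \<or> trace_term \<alpha> \<tau> \<gamma> summable_on finsets) \<longrightarrow>
        (\<exists>B. \<forall>d\<ge>1. Ct d \<le> B))"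
proof -
  let ?C = "\<lambda>d. risk_const d \<alpha> \<delta> \<tau> \<gamma>"
  have \<alpha>0: "\<alpha> > 0" using assms(1) by simp
  have \<alpha>\<tau>: "\<alpha> * \<tau> > 1" using assms(1,4) by (simp add: field_simps)
  have gfin: "\<gamma> u > 0" if "u \<in> finsets" for u using assms(6) that by (simp add: finsets_def)
  have gd: "\<gamma> u > 0" if "u \<subseteq> {1..d}" for u d
    by (rule assms(6)) (use that finite_subset[OF that] in auto)
  have Cpos: "?C d > 0" for d
  proof -
    have "0 \<le> (\<Sum>u\<in>Pow {1..d}. trace_term \<alpha> \<tau> \<gamma> u)"
      by (rule sum_nonneg) (rule trace_term_nonneg[OF \<alpha>\<tau>])
    then show ?thesis by (simp add: risk_const_def add_nonneg_pos add_pos_nonneg)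
  qed
  have p1: "\<alpha> * (1 / (\<alpha> - 4 * \<delta>)) > 1" "\<alpha> * (1 / (\<alpha> - 2 * \<delta>)) > 1"
    "1 / (\<alpha> - 2 * \<delta>) \<le> 1 / (\<alpha> - 4 * \<delta>)"
    using assms(1-3) by (auto simp add: field_simps)
  have bd1: "\<exists>B. \<forall>d. ?C d \<le> B"
    if w: "weight_term \<alpha> \<delta> \<gamma> summable_on finsets"
      and t: "1 / (\<alpha> - 4 * \<delta>) \<le> \<tau> \<or> trace_term \<alpha> \<tau> \<gamma> summable_on finsets"
    by (rule risk_const_bounded[OF \<alpha>0 assms(2,3,4) gfin p1(1) order_refl w[unfolded weight_term_weight_at] t])
  have bd2: "\<exists>B. \<forall>d. ?C d \<le> B"
    if w: "weight_term (2 * \<alpha>) \<delta> (\<lambda>u. (\<gamma> u)\<^sup>2) summable_on finsets"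
      and t: "1 / (\<alpha> - 2 * \<delta>) \<le> \<tau> \<or> trace_term \<alpha> \<tau> \<gamma> summable_on finsets"
  proof -
    have "weight_term (2 * \<alpha>) \<delta> (\<lambda>u. (\<gamma> u)\<^sup>2) u = weight_at \<alpha> (1 / (\<alpha> - 2 * \<delta>)) \<gamma> u"
      if "u \<in> finsets" for u
      by (rule weight_term_doubled[OF assms(3) gfin that])
    then have s: "weight_at \<alpha> (1 / (\<alpha> - 2 * \<delta>)) \<gamma> summable_on finsets"
      by (rule summable_on_cong[THEN iffD1, OF _ w])
    show ?thesis
      by (rule risk_const_bounded[OF \<alpha>0 assms(2,3,4) gfin p1(2,3) s t])
  qed
  show ?thesis
  proof (intro exI[of _ ?C] conjI allI impI)
    show "?C d > 0" for d by (rule Cpos)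
    show "?C d > 0" for d by (rule Cpos)
    fix d M N :: nat and f :: "(nat \<Rightarrow> real) \<Rightarrow> real" and lam :: real and z :: "nat \<Rightarrow> nat"
      and P :: "'w measure" and Y :: "nat \<Rightarrow> 'w \<Rightarrow> (nat \<Rightarrow> real)"
    assume A: "prob_density d f" "f \<in> rk_space d (kor d \<alpha> \<gamma>)" "M \<ge> 1" "lam > 0" "prime N"
      "good_generator d \<alpha> \<delta> \<gamma> N z" "iid_sample d f M P Y"
    note R = risk_bounds[OF assms(1,4,5) gd assms(7) A(1-4) A(6,7)]
    show "integrable P (sq_error d (kor d \<alpha> \<gamma>) N z M lam f Y)" by (rule R(1))
    show "(\<integral>\<omega>. sq_error d (kor d \<alpha> \<gamma>) N z M lam f Y \<omega> \<partial>P)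
            \<le> ?C d * ((rk_norm d (kor d \<alpha> \<gamma>) f)\<^sup>2 * (1 / real N powr (\<alpha> / 2 - 2 * \<delta>))
                  + lam * (rk_norm d (kor d \<alpha> \<gamma>) f)\<^sup>2
                  + l2_norm d f / (real M * lam powr \<tau>))" by (rule R(2))
    show "(\<integral>\<omega>. sq_error d (kor d \<alpha> \<gamma>) N z M lam f Y \<omega> \<partial>P)
              \<le> ?C d * ((rk_norm d (kor d \<alpha> \<gamma>) f)\<^sup>2 * (1 / real N powr (\<alpha> / 2 - 2 * \<delta>))
                    + lam\<^sup>2 * (rk_norm d (korsq d \<alpha> \<gamma>) f)\<^sup>2
                    + l2_norm d f / (real M * lam powr \<tau>))"
      if "f \<in> rk_space d (korsq d \<alpha> \<gamma>)" by (rule R(3)) (use that in auto)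
  next
    show "\<exists>B. \<forall>d\<ge>1. ?C d \<le> B"
      if "weight_term \<alpha> \<delta> \<gamma> summable_on finsets"
        "1 / (\<alpha> - 4 * \<delta>) \<le> \<tau> \<or> trace_term \<alpha> \<tau> \<gamma> summable_on finsets"
      using bd1[OF that] by (elim exE) (intro exI, blast)
    show "\<exists>B. \<forall>d\<ge>1. ?C d \<le> B"
      if "weight_term (2 * \<alpha>) \<delta> (\<lambda>u. (\<gamma> u)\<^sup>2) summable_on finsets"
        "1 / (\<alpha> - 2 * \<delta>) \<le> \<tau> \<or> trace_term \<alpha> \<tau> \<gamma> summable_on finsets"
      using bd2[OF that] by (elim exE) (intro exI, blast)
  qed
qed

end
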